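(* Let $2\le m\le n$ be integers, and consider the set $\mathcal{D}$ of all normalized (trace-one) decomposable entanglement witnesses $W$ on $\mathbb{C}^m\otimes\mathbb{C}^n$, with eigenvalues $\lambda_1(W)\ge\cdots\ge\lambda_{mn}(W)$. Then: (i) For each $x\in(\frac{1}{mn-1},1]$ there is $W\in\mathcal{D}$ with $\operatorname{tr}(W^2)=x$. The infimum of $\operatorname{tr}(W^2)$ over $\mathcal{D}$ is $\frac{1}{mn-1}$ and is not attained; the supremum is $1$ and is attained. (ii) For $W\in\mathcal{D}$, $\operatorname{tr}(W^2)=1$ if and only if $W=|\psi\rangle\langle\psi|^\Gamma$ for some entangled unit vector $|\psi\rangle\in\mathbb{C}^m\otimes\mathbb{C}^n$. (iii) For each $x\in[-\frac12,0)$ there is $W\in\mathcal{D}$ with $\lambda_{mn}(W)=x$. The infimum of $\lambda_{mn}$ over $\mathcal{D}$ is $-\frac12$ and is attained; the supremum is $0$ and is not attained. (iv) For $W\in\mathcal{D}$, $\lambda_{mn}(W)=-\frac12$ if and only if $W=|\psi\rangle\langle\psi|^\Gamma$ for a unit vector $|\psi\rangle$ having exactly two nonzero Schmidt coefficients, both equal to $\frac{\sqrt2}{2}$. (v) For each $x\in(\frac{1}{mn-1},1)$ there is $W\in\mathcal{D}$ with $\lambda_1(W)=x$. The infimum of $\lambda_1$ over $\mathcal{D}$ is $\frac{1}{mn-1}$ and is not attained; the supremum is $1$ and is not attained. (vi) Every $W\in\mathcal{D}$ satisfies $0<\mathcal{N}(W)\le\frac{m-1}{2}$. For each $x\in(0,\frac{m-1}{2}]$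 there is $W\in\mathcal{D}$ with $\mathcal{N}(W)=x$. The supremum $\frac{m-1}{2}$ is attained and the infimum $0$ is not attained. (vii) For integers $1\le j\le\lfloor n/m\rfloor$ let $|\Phi_j\rangle:=\frac{1}{\sqrt m}\sum_{i=1}^m|i\rangle\otimes|i+(j-1)m\rangle\in\mathbb{C}^m\otimes\mathbb{C}^n$. Then for $W\in\mathcal{D}$, $\mathcal{N}(W)=\frac{m-1}{2}$ if and only if there exist unitaries $U\in M_m(\mathbb{C})$, $V\in M_n(\mathbb{C})$ and an integer $1\le k\le\lfloor n/m\rfloor$ such that $(U\otimes V)W(U\otimes V)^\dagger$ is a convex combination of $|\Phi_1\rangle\langle\Phi_1|^\Gamma,\dots,|\Phi_k\rangle\langle\Phi_k|^\Gamma$. (viii) Let $m=2$. The infimum of $\sum_{i=3}^{2n}\lambda_i(W)$ over $\mathcal{D}$ is $-\frac{1}{2+2\sqrt2}$, and it is attained by $W=|\phi\rangle\langle\phi|^\Gamma$ with $|\phi\rangle=x_1|11\rangle+x_2|22\rangle$, where $x_1,x_2>0$, $x_1^2+x_2^2=1$ and $x_1^2+x_1x_2=1+\frac{1}{2+2\sqrt2}$ (numerically $x_1\approx0.92388$, $x_2\approx0.382683$). For every $4\le k\le 2n$, the infimum of $\sum_{i=k}^{2n}\lambda_i(W)$ over $\mathcal{D}$ is $-\frac12$, attained by the partial transpose of a maximally entangled pure state of $\mathbb{C}^2\otimes\mathbb{C}^n$ (i.e. a unit vector with Schmidt coefficients $\frac{1}{\sqrt2},\frac{1}{\sqrt2}$).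 (ix) Let $3\le m\le n$. The infimum of $\lambda_{mn}+\lambda_{mn-1}$ over $\mathcal{D}$ is $-\frac{\sqrt2}{2}$, attained by $|\psi\rangle\langle\psi|^\Gamma$ for a unit vector $|\psi\rangle$ whose nonzero Schmidt coefficients are $\frac{\sqrt2}{2},\frac12,\frac12$. The infimum of $\lambda_{mn}+\lambda_{mn-1}+\lambda_{mn-2}$ over $\mathcal{D}$ is $-1$, attained by the partial transpose of a two-qutrit maximally entangled state (a unit vector with three nonzero Schmidt coefficients all equal to $\frac{1}{\sqrt3}$).
   Context: For $M\in M_m(\mathbb{C})\otimes M_n(\mathbb{C})$, the partial transpose is $M^\Gamma:=(T\otimes \mathrm{id})(M)$, where $T$ is the transpose on the first factor (with respect to the standard basis). A Hermitian $W\in M_m(\mathbb{C})\otimes M_n(\mathbb{C})$ is block-positive if $\langle a,b|W|a,b\rangle\ge0$ for all $|a\rangle\in\mathbb{C}^m,|b\rangle\in\mathbb{C}^n$; it is an entanglement witness (EW) if it is block-positive and has at least one negative eigenvalue. An EW is decomposable (DEW) if $W=P+Q^\Gamma$ for some positive semidefinite $P,Q$, and nondecomposable otherwise. Normalized means $\operatorname{tr}W=1$. Eigenvalues of a Hermitian matrix are listed in non-increasing order $\lambda_1\ge\lambda_2\ge\cdots$. For Hermitian trace-one $M$, $\mathcal{N}(M):=\frac{\|M\|_1-1}{2}$, i.e. the absolute value of the sum of the negative eigenvalues of $M$, where $\|\cdot\|_1$ is the trace norm. $|i\rangle$ denotes the standard basis vectors; $|ij\rangle=|i\rangle\otimes|j\rangle$.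 *)

theory Defs
  imports "Jordan_Normal_Form.Jordan_Normal_Form" "Jordan_Normal_Form.Schur_Decomposition"
begin

text \<open>Matrices on C^m (x) C^n are (m*n) x (m*n) complex matrices; the basis vector
 |i> (x) |j> (0-based i < m, j < n) has index i*n + j (Kronecker convention).\<close>

definition trace :: "complex mat \<Rightarrow> complex" where
  "trace A = (\<Sum>i<dim_row A. A $$ (i,i))"

definition hermitian :: "complex mat \<Rightarrow> bool" where
  "hermitian A \<longleftrightarrow> A \<in> carrier_mat (dim_row A) (dim_row A) \<and> mat_adjoint A = A"

definition unitary :: "complex mat \<Rightarrow> bool" where
  "unitary U \<longleftrightarrow> U \<in> carrier_mat (dim_row U) (dim_row U) \<and> mat_adjoint U * U = 1\<^sub>m (dim_row U)"

definition psd :: "complex mat \<Rightarrow> bool" where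
  "psd A \<longleftrightarrow> hermitian A \<and>
     (\<forall>v \<in> carrier_vec (dim_row A). 0 \<le> Re (conjugate v \<bullet> (A *\<^sub>v v)))"

text \<open>Eigenvalues (with multiplicity) of a Hermitian matrix, as real numbers,
 in non-increasing order: lambda_1 >= lambda_2 >= ... (0-based list index i is lambda_(i+1)).\<close>
definition eigvals :: "complex mat \<Rightarrow> real list" where
  "eigvals A = rev (sorted_list_of_multiset (image_mset Re (proots (char_poly A))))"

definition trace_norm :: "complex mat \<Rightarrow> real" where
  "trace_norm A = sum_list (map sqrt (eigvals (mat_adjoint A * A)))"

definition negativity :: "complex mat \<Rightarrow> real" where
  "negativity M = (trace_norm M - 1) / 2"

text \<open>Partial transpose on the first factor C^m of C^m (x) C^n.\<close>
definition ptrans :: "nat \<Rightarrow> nat \<Rightarrow> complex mat \<Rightarrow> complex mat" where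
  "ptrans m n M = mat (m*n) (m*n)
     (\<lambda>(r,c). M $$ ((c div n) * n + r mod n, (r div n) * n + c mod n))"

definition kron_vec :: "complex vec \<Rightarrow> complex vec \<Rightarrow> complex vec" where
  "kron_vec a b = vec (dim_vec a * dim_vec b) (\<lambda>k. a $ (k div dim_vec b) * b $ (k mod dim_vec b))"

definition kron :: "complex mat \<Rightarrow> complex mat \<Rightarrow> complex mat" where
  "kron A B = mat (dim_row A * dim_row B) (dim_col A * dim_col B)
     (\<lambda>(i,j). A $$ (i div dim_row B, j div dim_col B) * B $$ (i mod dim_row B, j mod dim_col B))"

definition proj :: "complex vec \<Rightarrow> complex mat" where
  "proj v = mat (dim_vec v) (dim_vec v) (\<lambda>(i,j). v $ i * cnj (v $ j))"

definition block_positive :: "nat \<Rightarrow> nat \<Rightarrow> complex mat \<Rightarrow> bool" where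
  "block_positive m n W \<longleftrightarrow> hermitian W \<and> W \<in> carrier_mat (m*n) (m*n) \<and>
     (\<forall>a \<in> carrier_vec m. \<forall>b \<in> carrier_vec n.
        0 \<le> Re (conjugate (kron_vec a b) \<bullet> (W *\<^sub>v kron_vec a b)))"

definition entanglement_witness :: "nat \<Rightarrow> nat \<Rightarrow> complex mat \<Rightarrow> bool" where
  "entanglement_witness m n W \<longleftrightarrow> block_positive m n W \<and>
     (\<exists>l::real. eigenvalue W (complex_of_real l) \<and> l < 0)"

definition decomposable_EW :: "nat \<Rightarrow> nat \<Rightarrow> complex mat \<Rightarrow> bool" where
  "decomposable_EW m n W \<longleftrightarrow> entanglement_witness m n W \<and>
     (\<exists>P Q. P \<in> carrier_mat (m*n) (m*n) \<and> Q \<in> carrier_mat (m*n) (m*n) \<and>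
        psd P \<and> psd Q \<and> W = P + ptrans m n Q)"

definition DEWs :: "nat \<Rightarrow> nat \<Rightarrow> complex mat set" where
  "DEWs m n = {W. decomposable_EW m n W \<and> trace W = 1}"

definition unit_vec :: "nat \<Rightarrow> complex vec \<Rightarrow> bool" where
  "unit_vec d v \<longleftrightarrow> v \<in> carrier_vec d \<and> conjugate v \<bullet> v = 1"

definition entangled :: "nat \<Rightarrow> nat \<Rightarrow> complex vec \<Rightarrow> bool" where
  "entangled m n v \<longleftrightarrow> \<not> (\<exists>a \<in> carrier_vec m. \<exists>b \<in> carrier_vec n. v = kron_vec a b)"

text \<open>Schmidt coefficients of v in C^m (x) C^n: the singular values of the
 m x n coefficient matrix C with C_ij = v_(i*n+j), i.e. square roots of the
 eigenvalues of C C^dagger (a multiset of m values, zeros included).\<close>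
definition coeff_mat :: "nat \<Rightarrow> nat \<Rightarrow> complex vec \<Rightarrow> complex mat" where
  "coeff_mat m n v = mat m n (\<lambda>(i,j). v $ (i*n + j))"

definition schmidt_coeffs :: "nat \<Rightarrow> nat \<Rightarrow> complex vec \<Rightarrow> real multiset" where
  "schmidt_coeffs m n v =
     mset (map sqrt (eigvals (coeff_mat m n v * mat_adjoint (coeff_mat m n v))))"

definition nonzero_schmidt :: "nat \<Rightarrow> nat \<Rightarrow> complex vec \<Rightarrow> real multiset" where
  "nonzero_schmidt m n v = filter_mset (\<lambda>x. x \<noteq> 0) (schmidt_coeffs m n v)"

text \<open>|Phi_j> = 1/sqrt m * sum_(i=1..m) |i> (x) |i+(j-1)m>, written 0-based.\<close>
definition Phi :: "nat \<Rightarrow> nat \<Rightarrow> nat \<Rightarrow> complex vec" where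
  "Phi m n j = vec (m*n) (\<lambda>r. if \<exists>i<m. r = i*n + (i + (j-1)*m)
                               then complex_of_real (1 / sqrt (real m)) else 0)"

definition is_inf :: "real set \<Rightarrow> real \<Rightarrow> bool" where
  "is_inf S c \<longleftrightarrow> (\<forall>x\<in>S. c \<le> x) \<and> (\<forall>y. (\<forall>x\<in>S. y \<le> x) \<longrightarrow> y \<le> c)"

definition is_sup :: "real set \<Rightarrow> real \<Rightarrow> bool" where
  "is_sup S c \<longleftrightarrow> (\<forall>x\<in>S. x \<le> c) \<and> (\<forall>y. (\<forall>x\<in>S. x \<le> y) \<longrightarrow> c \<le> y)"

end

theory Submission imports Defs begin

text \<open>Write \<open>W = P + Q\<^sup>\<Gamma>\<close> and diagonalise \<open>Q\<close>. If a unit vector has Schmidt coefficients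
  \<open>s\<^sub>p\<close>, its partial transpose is diagonal in product-type vectors with eigenvalues \<open>s\<^sub>p\<^sup>2\<close> and
  \<open>\<plusminus> s\<^sub>p s\<^sub>q\<close>, the negative ones belonging to antisymmetric vectors. Sums of the smallest eigenvalues of
  \<open>W\<close> are therefore bounded below by Ky Fan's principle, Bessel's inequality limiting how much of each
  antisymmetric vector an orthonormal family can contain, and the values are attained by trial vectors.
  The purity is bounded by the triangle inequality for the Hilbert-Schmidt norm, which is invariant under
  partial transposition. Equality cases are read off from equality in these estimates.\<close>

section \<open>Orthonormal families and the spectral theorem\<close>

text \<open>The bounds are linear in \<open>P\<close> and \<open>Q\<close>. Since
  \<open>tr P + tr Q = 1\<close>, the matrix \<open>Q\<close> is a mixture of pure states of total
  weight at most 1, and \<open>P\<close> can only raise lower bounds, so each extremal problem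
  reduces to a unit vector with Schmidt coefficients \<open>s\<^sub>p\<close>. Minimising over k
  orthonormal vectors is then a linear program in the weights of the antisymmetric vectors: each
  weight is at most 1, their total at most k. Its value is governed by the k largest products
  \<open>s\<^sub>p s\<^sub>q\<close>; the constants 1/2, sqrt 2 / 2, 1 and (m-1)/2 are the maxima
  over unit vectors of the sum of one, two, three and all of these products. Equality forces
  \<open>tr P = 0\<close> and makes every eigenvector of \<open>Q\<close> of positive weight
  extremal for the same trial vectors. What remains is to decide which extremal vectors can occur
  together. For the smallest eigenvalue it is only one: \<open>ptf\<close> is symmetric in state and
  trial vector, so two of them would violate the bound for k = 2. For the negativity it is those
  whose supports in the second factor are orthogonal, so at most n div m of them fit.\<close>

definition ip :: "nat \<Rightarrow> (nat \<Rightarrow> complex) \<Rightarrow> (nat \<Rightarrow> complex) \<Rightarrow> complex" where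
  "ip N f g = (\<Sum>i<N. cnj (f i) * g i)"

lemma sum_swap3:
  "(\<Sum>i\<in>I. \<Sum>r\<in>A. \<Sum>c\<in>B. g i r c) = (\<Sum>r\<in>A. \<Sum>c\<in>B. \<Sum>i\<in>I. g i r c)"
proof -
  have "(\<Sum>i\<in>I. \<Sum>r\<in>A. \<Sum>c\<in>B. g i r c) = (\<Sum>r\<in>A. \<Sum>i\<in>I. \<Sum>c\<in>B. g i r c)" by (rule sum.swap)
  also have "\<dots> = (\<Sum>r\<in>A. \<Sum>c\<in>B. \<Sum>i\<in>I. g i r c)" by (intro sum.cong refl sum.swap)
  finally show ?thesis .
qed

lemma cnj_ip: "cnj (ip N f g) = ip N g f"
  by (simp add: ip_def mult.commute)

lemma ip_cong: "(\<And>x. x < N \<Longrightarrow> f x = f' x) \<Longrightarrow> (\<And>x. x < N \<Longrightarrow> g x = g' x) \<Longrightarrow> ip N f g = ip N f' g'"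
  by (auto simp: ip_def intro!: sum.cong)

lemma ip_add_right: "ip N f (\<lambda>x. g x + h x) = ip N f g + ip N f h"
  by (simp add: ip_def algebra_simps sum.distrib)
lemma ip_diff_right: "ip N f (\<lambda>x. g x - h x) = ip N f g - ip N f h"
  by (simp add: ip_def algebra_simps sum_subtractf)
lemma ip_add_left: "ip N (\<lambda>x. g x + h x) f = ip N g f + ip N h f"
  by (simp add: ip_def algebra_simps sum.distrib)
lemma ip_diff_left: "ip N (\<lambda>x. g x - h x) f = ip N g f - ip N h f"
  by (simp add: ip_def algebra_simps sum_subtractf)
lemma ip_scale_right: "ip N f (\<lambda>x. c * g x) = c * ip N f g"
  by (simp add: ip_def algebra_simps sum_distrib_left)
lemma ip_scale_left: "ip N (\<lambda>x. c * f x) g = cnj c * ip N f g"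
  by (simp add: ip_def algebra_simps sum_distrib_left)
lemma ip_sum_right: "ip N f (\<lambda>x. \<Sum>i\<in>J. c i * g i x) = (\<Sum>i\<in>J. c i * ip N f (g i))"
proof -
  have "ip N f (\<lambda>x. \<Sum>i\<in>J. c i * g i x) = (\<Sum>x<N. \<Sum>i\<in>J. c i * (cnj (f x) * g i x))"
    by (simp add: ip_def sum_distrib_left mult_ac)
  also have "\<dots> = (\<Sum>i\<in>J. \<Sum>x<N. c i * (cnj (f x) * g i x))" by (rule sum.swap)
  finally show ?thesis by (simp add: ip_def sum_distrib_left)
qed
lemma ip_sum_left: "ip N (\<lambda>x. \<Sum>i\<in>J. c i * g i x) f = (\<Sum>i\<in>J. cnj (c i) * ip N (g i) f)"
proof -
  have "cnj (ip N f (\<lambda>x. \<Sum>i\<in>J. c i * g i x)) = (\<Sum>i\<in>J. cnj (c i) * cnj (ip N f (g i)))"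
    by (simp add: ip_sum_right)
  thus ?thesis by (simp add: cnj_ip)
qed

lemma ip_self: "ip N f f = of_real (\<Sum>i<N. (cmod (f i))\<^sup>2)"
  by (simp add: ip_def complex_norm_square mult.commute del: of_real_power)

lemma ip_self_ge0: "0 \<le> Re (ip N f f)"
  by (simp add: ip_self sum_nonneg)

lemma ip_self_eq0: "Re (ip N f f) = 0 \<longleftrightarrow> (\<forall>x<N. f x = 0)"
  by (simp add: ip_self sum_nonneg_eq_0_iff Ball_def)

lemma ip_self_Re: "of_real (Re (ip N f f)) = ip N f f"
  by (simp add: ip_self)

lemma cnj_mult_cmod: "cnj z * z = of_real ((cmod z)\<^sup>2)" "z * cnj z = of_real ((cmod z)\<^sup>2)"
  using complex_norm_square[of z] by (simp_all add: mult.commute)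

lemma ip_mult_swap: "ip N f g * ip N g f = of_real ((cmod (ip N f g))\<^sup>2)"
  using cnj_mult_cmod(2)[of "ip N f g"] by (simp add: cnj_ip)

lemma cmod_ip_commute: "cmod (ip N f g) = cmod (ip N g f)"
  by (metis cnj_ip complex_mod_cnj)

text \<open>The index set is arbitrary, so that one notion covers bases, single trial vectors and
  families indexed by pairs or triples. Vectors are functions on \<open>nat\<close> of which only
  the values below \<open>N\<close> count.\<close>

definition ons :: "nat \<Rightarrow> 'a set \<Rightarrow> ('a \<Rightarrow> nat \<Rightarrow> complex) \<Rightarrow> bool" where
  "ons N J v \<longleftrightarrow> (\<forall>i\<in>J. \<forall>j\<in>J. ip N (v i) (v j) = (if i = j then 1 else 0))"

lemma onsD: "ons N J v \<Longrightarrow> i \<in> J \<Longrightarrow> j \<in> J \<Longrightarrow> ip N (v i) (v j) = (if i = j then 1 else 0)"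
  by (simp add: ons_def)

lemma ons_subset: "ons N J v \<Longrightarrow> I \<subseteq> J \<Longrightarrow> ons N I v"
  unfolding ons_def by blast

text \<open>Zero vectors are allowed in the family, which spares completing a singular vector system
  to a basis later on.\<close>

lemma bessel_residual:
  assumes fin: "finite J" and orth: "\<And>i j. i \<in> J \<Longrightarrow> j \<in> J \<Longrightarrow> i \<noteq> j \<Longrightarrow> ip N (f i) (f j) = 0"
  fixes u
  defines "w \<equiv> \<lambda>x. u x - (\<Sum>i\<in>J. ip N (f i) u * f i x)"
  shows "Re (ip N w w) = Re (ip N u u) - (\<Sum>i\<in>J. (cmod (ip N (f i) u))\<^sup>2 * (2 - Re (ip N (f i) (f i))))"
proof -
  define c where "c i = ip N (f i) u" for i
  have fw: "ip N (f j) w = c j - c j * ip N (f j) (f j)" if j: "j \<in> J" for j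
  proof -
    have "(\<Sum>i\<in>J. c i * ip N (f j) (f i)) = (\<Sum>i\<in>J. if i = j then c j * ip N (f j) (f j) else 0)"
      using orth[OF j] by (intro sum.cong) auto
    also have "\<dots> = c j * ip N (f j) (f j)" using fin j by simp
    finally show ?thesis by (simp add: w_def ip_diff_right ip_sum_right c_def)
  qed
  have "ip N w w = ip N u w - (\<Sum>i\<in>J. cnj (c i) * ip N (f i) w)"
    by (subst (1) w_def) (simp add: ip_diff_left ip_sum_left c_def)
  also have "ip N u w = ip N u u - (\<Sum>i\<in>J. c i * cnj (c i))"
    by (simp add: w_def ip_diff_right ip_sum_right c_def cnj_ip)
  also have "(\<Sum>i\<in>J. cnj (c i) * ip N (f i) w) = (\<Sum>i\<in>J. c i * cnj (c i) * (1 - ip N (f i) (f i)))"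
    by (intro sum.cong) (auto simp: fw algebra_simps)
  \<comment> \<open>Each coefficient is subtracted once through \<open>ip N u w\<close> and once,
    with factor \<open>1 - ip N (f i) (f i)\<close>, through the correction. The resulting factor is
    1 for a unit vector; for a zero vector it is 2, but the coefficient is 0.\<close>
  finally have "ip N w w = ip N u u - (\<Sum>i\<in>J. c i * cnj (c i) * (2 - ip N (f i) (f i)))"
    by (simp add: right_diff_distrib sum_subtractf sum_distrib_left mult.assoc flip: mult_2 sum.distrib)
      (simp add: mult_ac)
  also have "(\<Sum>i\<in>J. c i * cnj (c i) * (2 - ip N (f i) (f i)))
      = of_real (\<Sum>i\<in>J. (cmod (c i))\<^sup>2 * (2 - Re (ip N (f i) (f i))))"
    by (simp add: cnj_mult_cmod(2) ip_self_Re del: of_real_power)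
  finally show ?thesis by (simp add: c_def)
qed

lemma bessel:
  assumes fin: "finite J" and orth: "\<And>i j. i \<in> J \<Longrightarrow> j \<in> J \<Longrightarrow> i \<noteq> j \<Longrightarrow> ip N (f i) (f j) = 0"
    and le: "\<And>i. i \<in> J \<Longrightarrow> Re (ip N (f i) (f i)) \<le> 1"
  shows "(\<Sum>i\<in>J. (cmod (ip N (f i) u))\<^sup>2) \<le> Re (ip N u u)"
proof -
  have "(\<Sum>i\<in>J. (cmod (ip N (f i) u))\<^sup>2) \<le> (\<Sum>i\<in>J. (cmod (ip N (f i) u))\<^sup>2 * (2 - Re (ip N (f i) (f i))))"
  proof (rule sum_mono)
    fix i assume "i \<in> J"
    hence "(cmod (ip N (f i) u))\<^sup>2 * 1 \<le> (cmod (ip N (f i) u))\<^sup>2 * (2 - Re (ip N (f i) (f i)))"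
      using le by (intro mult_left_mono) auto
    thus "(cmod (ip N (f i) u))\<^sup>2 \<le> (cmod (ip N (f i) u))\<^sup>2 * (2 - Re (ip N (f i) (f i)))" by simp
  qed
  also have "\<dots> \<le> Re (ip N u u)"
    using bessel_residual[where N=N and f=f and u=u, OF fin orth] ip_self_ge0[of N "\<lambda>x. u x - (\<Sum>i\<in>J. ip N (f i) u * f i x)"] by simp
  finally show ?thesis .
qed

lemma bessel_ons:
  assumes "finite J" "ons N J f"
  shows "(\<Sum>i\<in>J. (cmod (ip N (f i) u))\<^sup>2) \<le> Re (ip N u u)"
  using assms by (intro bessel) (auto simp: ons_def)

text \<open>In the equality case the residual has norm zero, so the vector is its own projection
  onto the family.\<close>

lemma bessel_eq:
  assumes fin: "finite J" and ons: "ons N J f"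
    and eq: "(\<Sum>i\<in>J. (cmod (ip N (f i) u))\<^sup>2) = Re (ip N u u)" and x: "x < N"
  shows "u x = (\<Sum>i\<in>J. ip N (f i) u * f i x)"
proof -
  have "(\<Sum>i\<in>J. (cmod (ip N (f i) u))\<^sup>2 * (2 - Re (ip N (f i) (f i)))) = (\<Sum>i\<in>J. (cmod (ip N (f i) u))\<^sup>2)"
    by (intro sum.cong) (auto simp: onsD[OF ons])
  hence "Re (ip N (\<lambda>x. u x - (\<Sum>i\<in>J. ip N (f i) u * f i x)) (\<lambda>x. u x - (\<Sum>i\<in>J. ip N (f i) u * f i x))) = 0"
    using bessel_residual[OF fin, of N f u] ons eq by (auto simp: ons_def)
  thus ?thesis using x unfolding ip_self_eq0 by simp
qed

section \<open>Traces, eigenvalues and the extension of eigenvector systems\<close>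

lemma trace_mult_commute:
  assumes "A \<in> carrier_mat n n" "B \<in> carrier_mat n n"
  shows "trace (A * B) = trace (B * A)"
proof -
  have "trace (A * B) = (\<Sum>i<n. \<Sum>j<n. A $$ (i,j) * B $$ (j,i))"
    using assms by (auto simp: trace_def scalar_prod_def lessThan_atLeast0 intro!: sum.cong)
  also have "\<dots> = (\<Sum>j<n. \<Sum>i<n. A $$ (i,j) * B $$ (j,i))" by (rule sum.swap)
  also have "\<dots> = trace (B * A)"
    using assms by (auto simp: trace_def scalar_prod_def lessThan_atLeast0 mult.commute intro!: sum.cong)
  finally show ?thesis .
qed

text \<open>Schur triangularisation is a similarity that puts the roots on the diagonal, and the
  trace is cyclic.\<close>

lemma trace_eq_sum_roots:
  assumes A: "A \<in> carrier_mat n n" and c: "char_poly A = (\<Prod>e\<leftarrow>es. [:- e, 1:])"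
  shows "trace A = sum_list es"
proof -
  obtain B P Q where "schur_decomposition A es = (B,P,Q)" by (cases "schur_decomposition A es") auto
  from schur_decomposition[OF A c this] have s: "similar_mat_wit A B P Q" and d: "diag_mat B = es" by auto
  from s A have car: "B \<in> carrier_mat n n" "P \<in> carrier_mat n n" "Q \<in> carrier_mat n n"
    and QP: "Q * P = 1\<^sub>m n" and AB: "A = P * B * Q"
    unfolding similar_mat_wit_def Let_def by auto
  have "trace A = trace (Q * (P * B))" using car unfolding AB by (intro trace_mult_commute[of _ n]) auto
  also have "Q * (P * B) = B" using car by (simp add: assoc_mult_mat[symmetric, of Q n n P n B n] QP)
  also have "trace B = sum_list (diag_mat B)"
    by (simp add: trace_def diag_mat_def sum_list_sum_nth atLeast0LessThan)
  finally show ?thesis by (simp add: d)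
qed

text \<open>If all eigenvalues were equal to \<open>c\<close>, the trace would be \<open>N * c\<close>.\<close>

lemma ex_eigenvalue_neq:
  assumes tr: "(\<Sum>i<N. A i i) \<noteq> of_nat N * c"
  obtains e w where "e \<noteq> c" "\<exists>x<N. w x \<noteq> 0" "\<And>r. r < N \<Longrightarrow> (\<Sum>x<N. A r x * w x) = (e::complex) * w r"
proof -
  define M where "M = mat N N (\<lambda>(i,j). A i j)"
  have M: "M \<in> carrier_mat N N" by (simp add: M_def)
  obtain es where es: "char_poly M = (\<Prod>a\<leftarrow>es. [:- a, 1:])" "length es = N"
    using char_poly_factorized[OF M] by auto
  have "trace M = (\<Sum>i<N. A i i)" by (simp add: trace_def M_def)
  moreover have "trace M = sum_list es" by (rule trace_eq_sum_roots[OF M es(1)])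
  ultimately have s: "sum_list es \<noteq> of_nat N * c" using tr by simp
  have "\<exists>e\<in>set es. e \<noteq> c"
  proof (rule ccontr)
    assume "\<not> ?thesis"
    hence "es = replicate N c" using es(2) by (metis replicate_eqI)
    thus False using s by (simp add: sum_list_replicate)
  qed
  then obtain e where e: "e \<in> set es" "e \<noteq> c" by auto
  have "poly (char_poly M) e = 0" using e by (auto simp: es poly_prod_list prod_list_zero_iff)
  hence "eigenvalue M e" using eigenvalue_root_char_poly[OF M] by simp
  then obtain v where v: "v \<in> carrier_vec N" "v \<noteq> 0\<^sub>v N" "M *\<^sub>v v = e \<cdot>\<^sub>v v"
    unfolding eigenvalue_def eigenvector_def using M by auto
  have "\<exists>x<N. v $ x \<noteq> 0"
  proof (rule ccontr)
    assume "\<not> ?thesis"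
    hence "v = 0\<^sub>v N" using v(1) by (intro eq_vecI) auto
    thus False using v(2) by simp
  qed
  moreover have "(\<Sum>x<N. A r x * v $ x) = e * v $ r" if r: "r < N" for r
  proof -
    have "(M *\<^sub>v v) $ r = (\<Sum>x<N. A r x * v $ x)"
      using r v(1) by (simp add: M_def scalar_prod_def lessThan_atLeast0)
    thus ?thesis using v r by simp
  qed
  ultimately show ?thesis using that e(2) by blast
qed

definition mv :: "nat \<Rightarrow> (nat \<Rightarrow> nat \<Rightarrow> complex) \<Rightarrow> (nat \<Rightarrow> complex) \<Rightarrow> nat \<Rightarrow> complex" where
  "mv N A u r = (\<Sum>c<N. A r c * u c)"

lemma ip_mv_herm:
  assumes "\<And>r c. r < N \<Longrightarrow> c < N \<Longrightarrow> A c r = cnj (A r c)"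
  shows "ip N u (mv N A w) = ip N (mv N A u) w"
proof -
  have "ip N u (mv N A w) = (\<Sum>r<N. \<Sum>c<N. cnj (u r) * A r c * w c)"
    by (simp add: ip_def mv_def sum_distrib_left mult_ac)
  also have "\<dots> = (\<Sum>c<N. \<Sum>r<N. cnj (u r) * A r c * w c)" by (rule sum.swap)
  also have "\<dots> = (\<Sum>c<N. \<Sum>r<N. cnj (u r) * cnj (A c r) * w c)"
    by (intro sum.cong refl) (metis assms lessThan_iff)
  also have "\<dots> = ip N (mv N A u) w"
    by (simp add: ip_def mv_def sum_distrib_left sum_distrib_right mult_ac)
  finally show ?thesis .
qed

text \<open>With \<open>\<Pi>\<close> the projection onto the orthogonal complement of the eigenvectors found so far,
  \<open>\<Pi> A \<Pi> + c (1 - \<Pi>)\<close> has an eigenvalue other than \<open>c\<close> for a suitable \<open>c\<close>, and any eigenvector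
  belonging to it is orthogonal to the given ones.\<close>

lemma extend_eigenvectors:
  fixes l :: "nat \<Rightarrow> real"
  assumes herm: "\<And>r c. r < N \<Longrightarrow> c < N \<Longrightarrow> A c r = cnj (A r c)"
    and ons: "ons N {..<k} u" and k: "k < N"
    and ev: "\<And>i r. i < k \<Longrightarrow> r < N \<Longrightarrow> mv N A (u i) r = of_real (l i) * u i r"
  obtains w and e :: real where "ip N w w = 1" "\<And>i. i < k \<Longrightarrow> ip N (u i) w = 0"
    "\<And>r. r < N \<Longrightarrow> mv N A w r = of_real e * w r"
proof -
  \<comment> \<open>Since the \<open>u i\<close> are eigenvectors with eigenvalues
    \<open>l i\<close>, this matrix agrees with \<open>A\<close> on their orthogonal complement and
    acts as \<open>c\<close> on their span.\<close>
  define B where "B c = (\<lambda>r x. A r x + (\<Sum>i<k. (of_real (c - l i)) * u i r * cnj (u i x)))" for c :: real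
  have trB: "(\<Sum>r<N. B c r r) = (\<Sum>r<N. A r r) + of_real (\<Sum>i<k. c - l i)" for c
  proof -
    have "(\<Sum>r<N. \<Sum>i<k. of_real (c - l i) * u i r * cnj (u i r))
        = (\<Sum>i<k. \<Sum>r<N. of_real (c - l i) * u i r * cnj (u i r))" by (rule sum.swap)
    also have "\<dots> = (\<Sum>i<k. of_real (c - l i) * ip N (u i) (u i))"
      by (simp add: ip_def sum_distrib_left mult_ac)
    also have "\<dots> = (\<Sum>i<k. of_real (c - l i))" by (intro sum.cong) (auto simp: onsD[OF ons])
    finally show ?thesis by (simp add: B_def sum.distrib)
  qed
  obtain c :: real where c: "(\<Sum>r<N. B c r r) \<noteq> of_nat N * of_real c"
  proof -
    define T where "T = (\<Sum>r<N. A r r) - of_real (\<Sum>i<k. l i)"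
    have eq: "(\<Sum>r<N. B c r r) - of_nat N * of_real c = T - of_real (real (N - k) * c)" for c
      using k by (simp add: trB T_def sum_subtractf of_nat_diff algebra_simps)
    \<comment> \<open>By \<open>eq\<close> the difference between the trace and \<open>N * c\<close>
      is affine in \<open>c\<close> with slope \<open>-(N - k)\<close>, which is nonzero; this
      choice gives it real part -1.\<close>
    define c where "c = (Re T + 1) / real (N - k)"
    have "real (N - k) * c = Re T + 1" using k by (simp add: c_def)
    hence "T - of_real (real (N - k) * c) \<noteq> 0" by (simp add: complex_eq_iff)
    hence "(\<Sum>r<N. B c r r) \<noteq> of_nat N * of_real c" using eq[of c] by auto
    thus ?thesis by (rule that)
  qed
  obtain e w where e: "e \<noteq> of_real c" and w: "\<exists>x<N. w x \<noteq> 0"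
    and ew: "\<And>r. r < N \<Longrightarrow> (\<Sum>x<N. B c r x * w x) = e * w r"
    using ex_eigenvalue_neq[of "B c" N "of_real c"] c by auto
  have Bu: "mv N (B c) v r = mv N A v r + (\<Sum>i<k. of_real (c - l i) * ip N (u i) v * u i r)" for v r
  proof -
    have "mv N (B c) v r = mv N A v r + (\<Sum>x<N. \<Sum>i<k. of_real (c - l i) * u i r * cnj (u i x) * v x)"
      by (simp add: mv_def B_def algebra_simps sum.distrib sum_distrib_left sum_distrib_right)
    also have "(\<Sum>x<N. \<Sum>i<k. of_real (c - l i) * u i r * cnj (u i x) * v x)
        = (\<Sum>i<k. \<Sum>x<N. of_real (c - l i) * u i r * cnj (u i x) * v x)" by (rule sum.swap)
    also have "\<dots> = (\<Sum>i<k. of_real (c - l i) * ip N (u i) v * u i r)"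
      by (simp add: ip_def sum_distrib_left sum_distrib_right mult_ac)
    finally show ?thesis .
  qed
  have hermB: "B c x r = cnj (B c r x)" if "r < N" "x < N" for r x
    using herm[OF that] by (simp add: B_def mult_ac)
  have orth: "ip N (u i) w = 0" if i: "i < k" for i
  proof -
    have Bui: "mv N (B c) (u i) r = of_real c * u i r" if r: "r < N" for r
    proof -
      have "(\<Sum>j<k. of_real (c - l j) * ip N (u j) (u i) * u j r) = (\<Sum>j<k. if j = i then of_real (c - l i) * u i r else 0)"
        using i by (intro sum.cong) (auto simp: onsD[OF ons])
      thus ?thesis using ev[OF i r] i by (simp add: Bu algebra_simps)
    qed
    \<comment> \<open>Moving the hermitian matrix across the inner product trades its eigenvalue
      \<open>e\<close> at \<open>w\<close> for its eigenvalue \<open>c\<close> at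
      \<open>u i\<close>; the two differ.\<close>
    have "e * ip N (u i) w = ip N (u i) (\<lambda>r. e * w r)" by (simp add: ip_scale_right)
    also have "\<dots> = ip N (u i) (mv N (B c) w)" using ew by (intro ip_cong) (auto simp: mv_def)
    also have "\<dots> = ip N (mv N (B c) (u i)) w" by (rule ip_mv_herm[OF hermB])
    also have "\<dots> = ip N (\<lambda>r. of_real c * u i r) w" using Bui by (intro ip_cong) auto
    also have "\<dots> = of_real c * ip N (u i) w" by (simp add: ip_scale_left)
    finally show ?thesis using e by (simp add: algebra_simps)
  qed
  have Aw: "mv N A w r = e * w r" if "r < N" for r
    using ew[OF that] Bu[of w r] orth by (simp add: mv_def)
  have nz: "ip N w w \<noteq> 0" using w ip_self_eq0[of N w] by auto
  have "e * ip N w w = ip N w (mv N A w)"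
    unfolding ip_scale_right[symmetric] by (intro ip_cong) (auto simp: Aw)
  also have "\<dots> = ip N (mv N A w) w" by (rule ip_mv_herm[OF herm])
  also have "\<dots> = cnj e * ip N w w"
    unfolding ip_scale_left[symmetric] by (intro ip_cong) (auto simp: Aw)
  finally have "cnj e = e" using nz by simp
  hence er: "of_real (Re e) = e" by (simp add: complex_eq_iff)
  define s where "s = sqrt (Re (ip N w w))"
  have s2: "of_real s * of_real s = ip N w w"
  proof -
    have "s * s = Re (ip N w w)" using ip_self_ge0[of N w] by (simp add: s_def)
    hence "of_real s * of_real s = (of_real (Re (ip N w w)) :: complex)" by (metis of_real_mult)
    thus ?thesis by (simp only: ip_self_Re)
  qed
  have s0: "s \<noteq> 0" using s2 nz by auto
  show ?thesis
  proof (rule that[of "\<lambda>x. of_real (1 / s) * w x" "Re e"])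
    have "ip N (\<lambda>x. of_real (1 / s) * w x) (\<lambda>x. of_real (1 / s) * w x) = of_real (1/s) * of_real (1/s) * ip N w w"
      by (simp only: ip_scale_left ip_scale_right complex_cnj_complex_of_real mult.assoc)
    also have "\<dots> = 1" using s0 by (simp add: s2[symmetric])
    finally show "ip N (\<lambda>x. of_real (1 / s) * w x) (\<lambda>x. of_real (1 / s) * w x) = 1" .
    show "ip N (u i) (\<lambda>x. of_real (1 / s) * w x) = 0" if "i < k" for i
      using orth[OF that] by (simp add: ip_scale_right del: of_real_divide)
    show "mv N A (\<lambda>x. of_real (1 / s) * w x) r = of_real (Re e) * (of_real (1 / s) * w r)" if "r < N" for r
      using Aw[OF that] by (simp add: er mv_def field_simps flip: sum_divide_distrib)
  qed
qed

text \<open>Induction on the number of missing vectors. Starting from given eigenvectors makes the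
  statement serve twice: with none given it diagonalises \<open>A\<close>, and for
  \<open>A = 0\<close> it completes orthonormal systems.\<close>

lemma extend_eigenbasis:
  fixes l :: "nat \<Rightarrow> real"
  assumes herm: "\<And>r c. r < N \<Longrightarrow> c < N \<Longrightarrow> A c r = cnj (A r c)"
    and "ons N {..<k} u" and "k \<le> N"
    and "\<And>i r. i < k \<Longrightarrow> r < N \<Longrightarrow> mv N A (u i) r = of_real (l i) * u i r"
  shows "\<exists>u' l'. ons N {..<N} u' \<and> (\<forall>i<k. u' i = u i) \<and>
    (\<forall>i<N. \<forall>r<N. mv N A (u' i) r = of_real (l' i :: real) * u' i r)"
  using assms(2-)
proof (induction "N - k" arbitrary: k u l)
  case 0
  hence "k = N" by simp
  thus ?case using 0 by blast
next
  case (Suc d)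
  hence k: "k < N" by simp
  obtain w and e :: real where w: "ip N w w = 1" "\<And>i. i < k \<Longrightarrow> ip N (u i) w = 0"
    "\<And>r. r < N \<Longrightarrow> mv N A w r = of_real e * w r"
  proof (rule extend_eigenvectors[of N A k u l])
    show "A c r = cnj (A r c)" if "r < N" "c < N" for r c by (rule herm[OF that])
    show "mv N A (u i) r = of_real (l i) * u i r" if "i < k" "r < N" for i r by (rule Suc.prems(3)[OF that])
  qed (use Suc.prems(1) k in auto)
  have w': "ip N w (u i) = 0" if "i < k" for i using w(2)[OF that] by (metis cnj_ip complex_cnj_zero)
  have "\<exists>u' l'. ons N {..<N} u' \<and> (\<forall>i<Suc k. u' i = (u(k := w)) i) \<and>
    (\<forall>i<N. \<forall>r<N. mv N A (u' i) r = of_real (l' i :: real) * u' i r)"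
  proof (rule Suc.hyps(1))
    show "d = N - Suc k" "Suc k \<le> N" using Suc.hyps(2) k by auto
    show "ons N {..<Suc k} (u(k := w))"
      using Suc.prems(1) w w' by (auto simp: ons_def less_Suc_eq)
    show "mv N A ((u(k := w)) i) r = of_real ((l(k := e)) i) * (u(k := w)) i r" if "i < Suc k" "r < N" for i r
      using that Suc.prems(3) w(3) by (auto simp: less_Suc_eq)
  qed
  then obtain u' l' where "ons N {..<N} u'" "\<forall>i<Suc k. u' i = (u(k := w)) i"
    "\<forall>i<N. \<forall>r<N. mv N A (u' i) r = of_real (l' i :: real) * u' i r" by blast
  thus ?case by (intro exI[of _ u'] exI[of _ l']) auto
qed

text \<open>Every vector is an eigenvector of the zero matrix, with eigenvalue 0.\<close>

lemma extend_ons: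
  assumes "ons N {..<k} u" "k \<le> N"
  shows "\<exists>u'. ons N {..<N} u' \<and> (\<forall>i<k. u' i = u i)"
  using extend_eigenbasis[of N "\<lambda>r c. 0" k u "\<lambda>i. 0"] assms by (auto simp: mv_def)

text \<open>Orthonormality says that the square matrix with columns \<open>u i\<close> has its
  adjoint as a left inverse; it is then also a right inverse, which is the resolution of the
  identity.\<close>

lemma ons_complete:
  assumes ons: "ons N {..<N} u" and r: "r < N" and c: "c < N"
  shows "(\<Sum>i<N. u i r * cnj (u i c)) = (if r = c then 1 else 0)"
proof -
  define A where "A = mat N N (\<lambda>(i,j). cnj (u i j))"
  define B where "B = mat N N (\<lambda>(i,j). u j i)"
  have "A * B = 1\<^sub>m N"
  proof (rule eq_matI)
    fix i j assume ij: "i < dim_row (1\<^sub>m N)" "j < dim_col (1\<^sub>m N)"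
    have "(A * B) $$ (i,j) = ip N (u i) (u j)"
      using ij by (simp add: A_def B_def scalar_prod_def ip_def lessThan_atLeast0)
    thus "(A * B) $$ (i,j) = 1\<^sub>m N $$ (i,j)" using ij onsD[OF ons, of i j] by simp
  qed (auto simp: A_def B_def)
  hence "B * A = 1\<^sub>m N" by (intro mat_mult_left_right_inverse[of A N B]) (auto simp: A_def B_def)
  hence "(B * A) $$ (r,c) = (if r = c then 1 else 0)" using r c by simp
  thus ?thesis using r c by (simp add: A_def B_def scalar_prod_def lessThan_atLeast0)
qed

lemma parseval_ip:
  assumes ons: "ons N {..<N} u"
  shows "(\<Sum>i<N. ip N v (u i) * ip N (u i) w) = ip N v w"
proof -
  have "(\<Sum>i<N. ip N v (u i) * ip N (u i) w) = (\<Sum>i<N. \<Sum>r<N. \<Sum>c<N. cnj (v r) * w c * (u i r * cnj (u i c)))"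
    unfolding ip_def sum_product by (simp add: mult_ac)
  also have "\<dots> = (\<Sum>r<N. \<Sum>c<N. \<Sum>i<N. cnj (v r) * w c * (u i r * cnj (u i c)))"
    by (rule sum_swap3)
  also have "\<dots> = (\<Sum>r<N. \<Sum>c<N. cnj (v r) * w c * (if r = c then 1 else 0))"
    unfolding sum_distrib_left[symmetric] using ons_complete[OF ons] by (intro sum.cong refl) auto
  also have "\<dots> = ip N v w" by (simp add: ip_def if_distrib cong: if_cong)
  finally show ?thesis .
qed

lemma parseval:
  assumes ons: "ons N {..<N} u"
  shows "(\<Sum>i<N. (cmod (ip N (u i) v))\<^sup>2) = Re (ip N v v)"
  unfolding parseval_ip[OF ons, of v v, symmetric]
  by (simp add: ip_mult_swap cmod_ip_commute[of N v] del: of_real_power)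

text \<open>The entry formula says that \<open>A\<close> is unitarily similar to the diagonal matrix
  of the \<open>e i\<close>, so the roots with multiplicity can be read off.\<close>

lemma proots_char_poly_diag:
  fixes e :: "nat \<Rightarrow> complex"
  assumes ons: "ons N {..<N} u" and A: "A \<in> carrier_mat N N"
    and ent: "\<And>r c. r < N \<Longrightarrow> c < N \<Longrightarrow> A $$ (r,c) = (\<Sum>i<N. e i * u i r * cnj (u i c))"
  shows "char_poly A = (\<Prod>a\<leftarrow>map e [0..<N]. [:- a, 1:])" "proots (char_poly A) = mset (map e [0..<N])"
proof -
  define P where "P = mat N N (\<lambda>(i,j). u j i)"
  define Q where "Q = mat N N (\<lambda>(i,j). cnj (u i j))"
  define E where "E = mat N N (\<lambda>(i,j). if i = j then e i else 0)"
  have car: "P \<in> carrier_mat N N" "Q \<in> carrier_mat N N" "E \<in> carrier_mat N N"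
    by (auto simp: P_def Q_def E_def)
  have QP: "Q * P = 1\<^sub>m N"
    using onsD[OF ons] by (intro eq_matI) (auto simp: P_def Q_def scalar_prod_def ip_def lessThan_atLeast0)
  hence PQ: "P * Q = 1\<^sub>m N" by (rule mat_mult_left_right_inverse[OF car(2,1)])
  have PE: "P * E = mat N N (\<lambda>(i,j). u j i * e j)"
    by (intro eq_matI) (auto simp: P_def E_def scalar_prod_def if_distrib cong: if_cong)
  have "A = P * E * Q"
    using A ent unfolding PE
    by (intro eq_matI) (auto simp: Q_def scalar_prod_def lessThan_atLeast0 mult_ac intro!: sum.cong)
  hence "similar_mat_wit A E P Q" using A car PQ QP by (auto simp: similar_mat_wit_def Let_def)
  hence "char_poly A = char_poly E" by (intro char_poly_similar) (auto simp: similar_mat_def)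
  also have "\<dots> = (\<Prod>a\<leftarrow>diag_mat E. [:- a, 1:])"
    by (rule char_poly_upper_triangular[OF car(3)]) (auto simp: E_def)
  also have "diag_mat E = map e [0..<N]" by (auto simp: diag_mat_def E_def)
  finally show cp: "char_poly A = (\<Prod>a\<leftarrow>map e [0..<N]. [:- a, 1:])" .
  have "proots (\<Prod>a\<leftarrow>es. [:- a, 1:]) = mset es" for es :: "complex list"
  proof (induction es)
    case (Cons a es)
    have "(\<Prod>a\<leftarrow>es. [:- a, 1:]) \<noteq> 0" by (auto simp: prod_list_zero_iff)
    moreover have "proots ([:- a, 1:] * (\<Prod>a\<leftarrow>es. [:- a, 1:])) = {#a#} + proots (\<Prod>a\<leftarrow>es. [:- a, 1:])"
      using calculation by (subst proots_mult) (simp_all del: mult_pCons_left)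
    ultimately show ?case using Cons by (simp del: mult_pCons_left)
  qed simp
  thus "proots (char_poly A) = mset (map e [0..<N])" unfolding cp by blast
qed

section \<open>The ordered list of eigenvalues of a Hermitian matrix\<close>

lemma mset_eigvals: "mset (eigvals A) = image_mset Re (proots (char_poly A))"
  by (simp add: eigvals_def)

lemma mset_eigvals_diag:
  fixes e :: "nat \<Rightarrow> real"
  assumes "ons N {..<N} u" and "A \<in> carrier_mat N N"
    and "\<And>r c. r < N \<Longrightarrow> c < N \<Longrightarrow> A $$ (r,c) = (\<Sum>i<N. of_real (e i) * u i r * cnj (u i c))"
  shows "mset (eigvals A) = mset (map e [0..<N])"
proof -
  have "proots (char_poly A) = mset (map (\<lambda>i. complex_of_real (e i)) [0..<N])"
    by (rule proots_char_poly_diag(2)[OF assms])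
  thus ?thesis unfolding mset_eigvals by (simp add: multiset.map_comp o_def)
qed


lemma length_eigvals: "A \<in> carrier_mat N N \<Longrightarrow> length (eigvals A) = N"
  using arg_cong[OF mset_eigvals[of A], of size] degree_monic_char_poly[of A N]
  by (simp add: size_proots_complex)

lemma sorted_eigvals: "sorted (rev (eigvals A))"
  by (simp add: eigvals_def)

lemma eigvals_antimono:
  assumes "i \<le> j" "j < length (eigvals A)"
  shows "eigvals A ! j \<le> eigvals A ! i"
  using sorted_rev_nth_mono[OF sorted_eigvals assms] by simp

lemma index_adjoint:
  assumes "A \<in> carrier_mat r c" "i < c" "j < r"
  shows "mat_adjoint A $$ (i,j) = cnj (A $$ (j,i))"
  using assms by (simp add: mat_adjoint_def mat_of_rows_def)

lemma adjoint_carrier: "A \<in> carrier_mat r c \<Longrightarrow> mat_adjoint A \<in> carrier_mat c r"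
  by (auto simp: mat_adjoint_def mat_of_rows_def)

lemma hermitian_iff:
  assumes "A \<in> carrier_mat N N"
  shows "hermitian A \<longleftrightarrow> (\<forall>i<N. \<forall>j<N. A $$ (j,i) = cnj (A $$ (i,j)))"
proof
  assume "hermitian A"
  hence "mat_adjoint A = A" by (simp add: hermitian_def)
  thus "\<forall>i<N. \<forall>j<N. A $$ (j,i) = cnj (A $$ (i,j))" using index_adjoint[OF assms] by metis
next
  assume h: "\<forall>i<N. \<forall>j<N. A $$ (j,i) = cnj (A $$ (i,j))"
  have "mat_adjoint A = A"
  proof (rule eq_matI)
    show "mat_adjoint A $$ (i,j) = A $$ (i,j)" if "i < dim_row A" "j < dim_col A" for i j
    proof -
      have ij: "i < N" "j < N" using that assms by auto
      have "mat_adjoint A $$ (i,j) = cnj (A $$ (j,i))" by (rule index_adjoint[OF assms ij])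
      also have "\<dots> = A $$ (i,j)" using h[rule_format, OF ij(2,1)] by simp
      finally show ?thesis .
    qed
  qed (use assms adjoint_carrier[OF assms] in auto)
  thus "hermitian A" using assms by (simp add: hermitian_def)
qed

lemma hermitianD:
  "hermitian A \<Longrightarrow> A \<in> carrier_mat N N \<Longrightarrow> i < N \<Longrightarrow> j < N \<Longrightarrow> A $$ (j,i) = cnj (A $$ (i,j))"
  using hermitian_iff by blast

lemma entry_eigenbasis:
  assumes ons: "ons N {..<N} u" and ev: "\<And>i r. i < N \<Longrightarrow> r < N \<Longrightarrow> mv N A (u i) r = l i * u i r"
    and rc: "r < N" "c < N"
  shows "A r c = (\<Sum>i<N. l i * u i r * cnj (u i c))"
proof -
  have "A r c = (\<Sum>x<N. A r x * (if x = c then 1 else 0))" using rc by (simp add: if_distrib cong: if_cong)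
  also have "\<dots> = (\<Sum>x<N. \<Sum>i<N. A r x * (u i x * cnj (u i c)))"
    unfolding sum_distrib_left[symmetric] using ons_complete[OF ons _ rc(2)] by (intro sum.cong refl) auto
  also have "\<dots> = (\<Sum>i<N. \<Sum>x<N. A r x * (u i x * cnj (u i c)))" by (rule sum.swap)
  also have "\<dots> = (\<Sum>i<N. mv N A (u i) r * cnj (u i c))"
    by (simp add: mv_def sum_distrib_left sum_distrib_right mult_ac)
  also have "\<dots> = (\<Sum>i<N. l i * u i r * cnj (u i c))" using ev rc by (intro sum.cong) auto
  finally show ?thesis .
qed

text \<open>The constructed eigenbasis carries its eigenvalues in no particular order. They form the
  same multiset as \<open>eigvals A\<close>, so a permutation of the basis attaches the i-th vector
  to the i-th largest eigenvalue.\<close>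

theorem spectral_theorem:
  assumes herm: "hermitian A" and A: "A \<in> carrier_mat N N"
  obtains u where "ons N {..<N} u"
    "\<And>r c. r < N \<Longrightarrow> c < N \<Longrightarrow> A $$ (r,c) = (\<Sum>i<N. of_real (eigvals A ! i) * u i r * cnj (u i c))"
proof -
  obtain u l where u: "ons N {..<N} u"
    and ev: "\<And>i r. i < N \<Longrightarrow> r < N \<Longrightarrow> mv N (\<lambda>r c. A $$ (r,c)) (u i) r = of_real (l i :: real) * u i r"
  proof -
    have "\<exists>u l. ons N {..<N} u \<and> (\<forall>i<0. u i = undefined i) \<and>
        (\<forall>i<N. \<forall>r<N. mv N (\<lambda>r c. A $$ (r,c)) (u i) r = of_real (l i :: real) * u i r)"
      by (rule extend_eigenbasis[where k=0 and l="\<lambda>_. 0"]) (auto simp: ons_def intro: hermitianD[OF herm A])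
    thus ?thesis using that by blast
  qed
  have ent: "A $$ (r,c) = (\<Sum>i<N. of_real (l i) * u i r * cnj (u i c))" if "r < N" "c < N" for r c
    using entry_eigenbasis[of N u "\<lambda>r c. A $$ (r,c)" "\<lambda>i. of_real (l i)" r c] u ev that by simp
  have ms: "mset (eigvals A) = mset (map l [0..<N])" by (rule mset_eigvals_diag[OF u A ent])
  obtain p where p: "p permutes {..<length (map l [0..<N])}" "permute_list p (map l [0..<N]) = eigvals A"
    using mset_eq_permutation[OF ms] by blast
  hence pN: "p permutes {..<N}" by simp
  have pl: "eigvals A ! i = l (p i)" if "i < N" for i
    using that permute_list_nth[OF p(1), of i] p(2) permutes_in_image[OF pN] by simp
  show ?thesis
  proof (rule that[of "\<lambda>i. u (p i)"])
    have "(p i = p j) = (i = j)" for i j using permutes_inj[OF pN] by (auto dest: injD)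
    thus "ons N {..<N} (\<lambda>i. u (p i))"
      using u permutes_in_image[OF pN] by (auto simp: ons_def)
    show "A $$ (r,c) = (\<Sum>i<N. of_real (eigvals A ! i) * u (p i) r * cnj (u (p i) c))" if "r < N" "c < N" for r c
    proof -
      have "A $$ (r,c) = (\<Sum>i<N. of_real (l (p i)) * u (p i) r * cnj (u (p i) c))"
        unfolding ent[OF that] by (subst sum.permute[OF pN]) (simp add: o_def)
      also have "\<dots> = (\<Sum>i<N. of_real (eigvals A ! i) * u (p i) r * cnj (u (p i) c))"
        using pl by (intro sum.cong) auto
      finally show ?thesis .
    qed
  qed
qed

section \<open>Quadratic forms\<close>

definition qf :: "nat \<Rightarrow> complex mat \<Rightarrow> (nat \<Rightarrow> complex) \<Rightarrow> real" where
  "qf N A u = Re (\<Sum>r<N. \<Sum>c<N. cnj (u r) * A $$ (r,c) * u c)"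

lemma Re_scalar_prod_qf:
  assumes "A \<in> carrier_mat N N" "v \<in> carrier_vec N"
  shows "Re (conjugate v \<bullet> (A *\<^sub>v v)) = qf N A (($) v)"
  using assms by (auto simp: qf_def scalar_prod_def lessThan_atLeast0 sum_distrib_left mult_ac intro!: arg_cong[where f=Re] sum.cong)

lemma qf_cong: "(\<And>x. x < N \<Longrightarrow> u x = v x) \<Longrightarrow> qf N A u = qf N A v"
  by (auto simp: qf_def intro!: arg_cong[where f=Re] sum.cong)

lemma psd_iff:
  assumes "A \<in> carrier_mat N N"
  shows "psd A \<longleftrightarrow> hermitian A \<and> (\<forall>u. 0 \<le> qf N A u)"
proof -
  have "qf N A u = Re (conjugate (vec N u) \<bullet> (A *\<^sub>v vec N u))" for u
    using Re_scalar_prod_qf[OF assms, of "vec N u"] qf_cong[of N u "($) (vec N u)" A] by simp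
  thus ?thesis using assms Re_scalar_prod_qf[OF assms] unfolding psd_def
    by (metis carrier_matD(1) vec_carrier)
qed

lemma qf_diag:
  assumes ent: "\<And>r c. r < N \<Longrightarrow> c < N \<Longrightarrow> A $$ (r,c) = (\<Sum>i\<in>J. of_real (d i) * u i r * cnj (u i c))"
  shows "qf N A v = (\<Sum>i\<in>J. d i * (cmod (ip N (u i) v))\<^sup>2)"
proof -
  have "(\<Sum>r<N. \<Sum>c<N. cnj (v r) * A $$ (r,c) * v c)
      = (\<Sum>r<N. \<Sum>c<N. \<Sum>i\<in>J. of_real (d i) * (cnj (v r) * u i r * (cnj (u i c) * v c)))"
    by (intro sum.cong refl) (auto simp: ent sum_distrib_left sum_distrib_right mult_ac intro!: sum.cong)
  also have "\<dots> = (\<Sum>i\<in>J. \<Sum>r<N. \<Sum>c<N. of_real (d i) * (cnj (v r) * u i r * (cnj (u i c) * v c)))"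
    by (rule sum_swap3[symmetric])
  also have "\<dots> = (\<Sum>i\<in>J. of_real (d i) * (ip N v (u i) * ip N (u i) v))"
    unfolding ip_def sum_product by (simp add: sum_distrib_left)
  also have "\<dots> = of_real (\<Sum>i\<in>J. d i * (cmod (ip N (u i) v))\<^sup>2)"
    by (simp add: ip_mult_swap cmod_ip_commute[of N v] del: of_real_power)
  finally show ?thesis unfolding qf_def by simp
qed

section \<open>Schmidt form of a partially transposed pure state\<close>

lemma Re_of_real_mult: "Re (of_real x * z) = x * Re z"
  by simp

lemma sum_prod_index: "(\<Sum>r<m*n. f r) = (\<Sum>i<m. \<Sum>j<n. f (i * n + j :: nat))"
proof -
  have "(\<Sum>j = i*n..<i*n+n. f j) = (\<Sum>j<n. f (i*n+j))" for i
    using sum.shift_bounds_nat_ivl[of f 0 "i*n" n] by (simp add: lessThan_atLeast0 add.commute)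
  thus ?thesis using sum.nat_group[of f n m] by simp
qed

lemma prod_index_less: "i < m \<Longrightarrow> j < n \<Longrightarrow> i * n + j < m * (n::nat)"
proof -
  assume "i < m" "j < n"
  hence "i * n + j < Suc i * n" "Suc i * n \<le> m * n" by (auto simp del: mult_Suc intro: mult_le_mono1) (simp add: mult_Suc)
  thus ?thesis by linarith
qed

lemma ip_prod_index: "ip (m*n) f g = (\<Sum>i<m. ip n (\<lambda>j. f (i*n+j)) (\<lambda>j. g (i*n+j)))"
  by (simp add: ip_def sum_prod_index)

definition rowip :: "nat \<Rightarrow> (nat \<Rightarrow> complex) \<Rightarrow> (nat \<Rightarrow> complex) \<Rightarrow> nat \<Rightarrow> nat \<Rightarrow> complex" where
  "rowip n \<psi> u i k = ip n (\<lambda>l. \<psi> (i*n+l)) (\<lambda>l. u (k*n+l))"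

text \<open>The expectation of the partially transposed projector onto \<psi> in the vector
  \<open>u\<close>, as \<open>qf_ptrans_proj\<close> confirms. With \<open>R\<close> the matrix of
  the \<open>rowip n \<psi> u i k\<close>, it is the trace of the entrywise conjugate of
  \<open>R\<close> times \<open>R\<close>.\<close>

definition ptf :: "nat \<Rightarrow> nat \<Rightarrow> (nat \<Rightarrow> complex) \<Rightarrow> (nat \<Rightarrow> complex) \<Rightarrow> real" where
  "ptf m n \<psi> u = Re (\<Sum>i<m. \<Sum>k<m. cnj (rowip n \<psi> u k i) * rowip n \<psi> u i k)"

lemma cnj_rowip: "cnj (rowip n \<psi> u i k) = rowip n u \<psi> k i"
  by (simp add: rowip_def cnj_ip)

text \<open>Partial transposition is self-adjoint for the trace pairing, so state and trial vector
  may change roles. Uniqueness of the minimiser and the exclusion of product states rest on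
  this.\<close>

lemma ptf_commute: "ptf m n \<psi> u = ptf m n u \<psi>"
  unfolding ptf_def cnj_rowip by (simp add: mult.commute)

text \<open>Reordering the four indices lets the two contractions over the second factor be carried
  out separately; each is one of the row products in \<open>ptf\<close>.\<close>

lemma qf_ptrans_sum:
  assumes ent: "\<And>r c. r < m*n \<Longrightarrow> c < m*n \<Longrightarrow> Q $$ (r,c) = (\<Sum>a\<in>J. of_real (q a) * \<psi> a r * cnj (\<psi> a c))"
  shows "qf (m*n) (ptrans m n Q) u = (\<Sum>a\<in>J. q a * ptf m n (\<psi> a) u)"
proof -
  have e: "ptrans m n Q $$ (i*n+j, k*n+l) = (\<Sum>a\<in>J. of_real (q a) * \<psi> a (k*n+j) * cnj (\<psi> a (i*n+l)))"
    if "i < m" "j < n" "k < m" "l < n" for i j k l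
    using that by (simp add: ptrans_def prod_index_less ent)
  have "(\<Sum>r<m*n. \<Sum>c<m*n. cnj (u r) * ptrans m n Q $$ (r,c) * u c)
      = (\<Sum>i<m. \<Sum>j<n. \<Sum>k<m. \<Sum>l<n. cnj (u (i*n+j)) * ptrans m n Q $$ (i*n+j,k*n+l) * u (k*n+l))"
    by (simp add: sum_prod_index)
  also have "\<dots> = (\<Sum>i<m. \<Sum>j<n. \<Sum>k<m. \<Sum>l<n. \<Sum>a\<in>J. of_real (q a) *
        (\<psi> a (k*n+j) * cnj (u (i*n+j)) * (cnj (\<psi> a (i*n+l)) * u (k*n+l))))"
    by (intro sum.cong refl) (auto simp: e sum_distrib_left sum_distrib_right mult_ac intro!: sum.cong)
  also have "\<dots> = (\<Sum>i<m. \<Sum>k<m. \<Sum>j<n. \<Sum>l<n. \<Sum>a\<in>J. of_real (q a) *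
        (\<psi> a (k*n+j) * cnj (u (i*n+j)) * (cnj (\<psi> a (i*n+l)) * u (k*n+l))))"
    by (intro sum.cong refl sum.swap)
  also have "\<dots> = (\<Sum>i<m. \<Sum>k<m. \<Sum>a\<in>J. \<Sum>j<n. \<Sum>l<n. of_real (q a) *
        (\<psi> a (k*n+j) * cnj (u (i*n+j)) * (cnj (\<psi> a (i*n+l)) * u (k*n+l))))"
    by (intro sum.cong refl) (rule sum_swap3[symmetric])
  also have "\<dots> = (\<Sum>i<m. \<Sum>k<m. \<Sum>a\<in>J. of_real (q a) * (cnj (rowip n (\<psi> a) u k i) * rowip n (\<psi> a) u i k))"
    unfolding cnj_rowip unfolding rowip_def ip_def sum_product by (simp add: sum_distrib_left mult_ac)
  also have "\<dots> = (\<Sum>a\<in>J. \<Sum>i<m. \<Sum>k<m. of_real (q a) * (cnj (rowip n (\<psi> a) u k i) * rowip n (\<psi> a) u i k))"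
    by (rule sum_swap3[symmetric])
  also have "\<dots> = (\<Sum>a\<in>J. of_real (q a) * (\<Sum>i<m. \<Sum>k<m. cnj (rowip n (\<psi> a) u k i) * rowip n (\<psi> a) u i k))"
    by (simp add: sum_distrib_left)
  finally show ?thesis unfolding qf_def ptf_def by (simp only: Re_sum Re_of_real_mult)
qed

lemma qf_ptrans_proj:
  assumes "\<psi> \<in> carrier_vec (m*n)"
  shows "qf (m*n) (ptrans m n (proj \<psi>)) u = ptf m n (($) \<psi>) u"
proof -
  have "qf (m*n) (ptrans m n (proj \<psi>)) u = (\<Sum>a\<in>{0::nat}. 1 * ptf m n (($) \<psi>) u)"
    by (rule qf_ptrans_sum) (use assms in \<open>auto simp: proj_def\<close>)
  thus ?thesis by simp
qed

text \<open>The reduced operator of \<psi> on the first factor; its eigenvalues are the squared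
  Schmidt coefficients.\<close>

definition gram :: "nat \<Rightarrow> nat \<Rightarrow> (nat \<Rightarrow> complex) \<Rightarrow> complex mat" where
  "gram m n \<psi> = (let C = coeff_mat m n (vec (m*n) \<psi>) in C * mat_adjoint C)"

text \<open>Being read off from \<open>eigvals\<close>, the Schmidt coefficients come in
  non-increasing order: the indices 0, 1, 2 mean the largest ones.\<close>

definition sv :: "nat \<Rightarrow> nat \<Rightarrow> (nat \<Rightarrow> complex) \<Rightarrow> nat \<Rightarrow> real" where
  "sv m n \<psi> p = sqrt (eigvals (gram m n \<psi>) ! p)"

lemma gram_carrier [simp]: "gram m n \<psi> \<in> carrier_mat m m"
  using adjoint_carrier[of "coeff_mat m n (vec (m*n) \<psi>)" m n] by (auto simp: gram_def coeff_mat_def Let_def)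

lemma gram_entry: "i < m \<Longrightarrow> k < m \<Longrightarrow> gram m n \<psi> $$ (i,k) = (\<Sum>j<n. \<psi> (i*n+j) * cnj (\<psi> (k*n+j)))"
  using adjoint_carrier[of "coeff_mat m n (vec (m*n) \<psi>)" m n]
    index_adjoint[of "coeff_mat m n (vec (m*n) \<psi>)" m n]
  by (auto simp: gram_def coeff_mat_def Let_def scalar_prod_def lessThan_atLeast0 prod_index_less)

lemma schmidt_coeffs_sv:
  assumes "\<psi> \<in> carrier_vec (m*n)"
  shows "schmidt_coeffs m n \<psi> = mset (map (sv m n (($) \<psi>)) [0..<m])"
proof -
  have v: "vec (m*n) (($) \<psi>) = \<psi>" using assms by (intro eq_vecI) auto
  have l: "length (eigvals (gram m n (($) \<psi>))) = m" by (rule length_eigvals) simp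
  have "map sqrt (eigvals (gram m n (($) \<psi>))) = map (sv m n (($) \<psi>)) [0..<m]"
    using l by (intro nth_equalityI) (auto simp: sv_def)
  thus ?thesis unfolding schmidt_coeffs_def by (metis v gram_def)
qed

lemma gram_herm: "hermitian (gram m n \<psi>)"
  unfolding hermitian_iff[OF gram_carrier] by (auto simp: gram_entry mult.commute)

text \<open>Contracting \<psi> with the eigenvectors \<open>a p\<close> of the reduced operator
  gives vectors of the second factor that are mutually orthogonal with squared norms the
  eigenvalues. This is the Schmidt decomposition with the right vectors left unnormalised.\<close>

lemma gram_spectral:
  obtains a where "ons m {..<m} a"
    "\<And>i k. i < m \<Longrightarrow> k < m \<Longrightarrow> gram m n \<psi> $$ (i,k) = (\<Sum>p<m. of_real (eigvals (gram m n \<psi>) ! p) * a p i * cnj (a p k))"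
    "\<And>p. p < m \<Longrightarrow> eigvals (gram m n \<psi>) ! p = (\<Sum>j<n. (cmod (\<Sum>i<m. cnj (a p i) * \<psi> (i*n+j)))\<^sup>2)"
    "\<And>p q. p < m \<Longrightarrow> q < m \<Longrightarrow> (\<Sum>j<n. cnj (\<Sum>i<m. cnj (a p i) * \<psi> (i*n+j)) * (\<Sum>i<m. cnj (a q i) * \<psi> (i*n+j)))
        = (if p = q then of_real (eigvals (gram m n \<psi>) ! p) else 0)"
proof -
  obtain a where a: "ons m {..<m} a"
    and ent: "\<And>i k. i < m \<Longrightarrow> k < m \<Longrightarrow> gram m n \<psi> $$ (i,k) = (\<Sum>p<m. of_real (eigvals (gram m n \<psi>) ! p) * a p i * cnj (a p k))"
    using spectral_theorem[OF gram_herm gram_carrier] by blast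
  have 3: "(\<Sum>j<n. cnj (\<Sum>i<m. cnj (a p i) * \<psi> (i*n+j)) * (\<Sum>i<m. cnj (a q i) * \<psi> (i*n+j)))
        = (if p = q then of_real (eigvals (gram m n \<psi>) ! p) else 0)" if pq: "p < m" "q < m" for p q
  proof -
    have "(\<Sum>j<n. cnj (\<Sum>i<m. cnj (a p i) * \<psi> (i*n+j)) * (\<Sum>i<m. cnj (a q i) * \<psi> (i*n+j)))
        = (\<Sum>j<n. \<Sum>i<m. \<Sum>k<m. a p i * cnj (a q k) * (\<psi> (k*n+j) * cnj (\<psi> (i*n+j))))"
      by (simp add: sum_product mult_ac)
    also have "\<dots> = (\<Sum>i<m. \<Sum>k<m. \<Sum>j<n. a p i * cnj (a q k) * (\<psi> (k*n+j) * cnj (\<psi> (i*n+j))))"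
      by (rule sum_swap3)
    also have "\<dots> = (\<Sum>i<m. \<Sum>k<m. a p i * cnj (a q k) * gram m n \<psi> $$ (k,i))"
      by (intro sum.cong refl) (auto simp: gram_entry sum_distrib_left)
    also have "\<dots> = (\<Sum>i<m. \<Sum>k<m. \<Sum>t<m. of_real (eigvals (gram m n \<psi>) ! t) * (cnj (a q k) * a t k * (cnj (a t i) * a p i)))"
      by (intro sum.cong refl) (auto simp: ent sum_distrib_left mult_ac)
    also have "\<dots> = (\<Sum>t<m. \<Sum>i<m. \<Sum>k<m. of_real (eigvals (gram m n \<psi>) ! t) * (cnj (a q k) * a t k * (cnj (a t i) * a p i)))"
      by (rule sum_swap3[symmetric])
    also have "\<dots> = (\<Sum>t<m. of_real (eigvals (gram m n \<psi>) ! t) * (ip m (a t) (a p) * ip m (a q) (a t)))"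
      unfolding ip_def sum_product by (simp add: sum_distrib_left mult_ac)
    also have "\<dots> = (\<Sum>t<m. if t = p then (if p = q then of_real (eigvals (gram m n \<psi>) ! p) else 0) else 0)"
      using pq by (intro sum.cong) (auto simp: onsD[OF a])
    finally show ?thesis using pq by simp
  qed
  have "eigvals (gram m n \<psi>) ! p = (\<Sum>j<n. (cmod (\<Sum>i<m. cnj (a p i) * \<psi> (i*n+j)))\<^sup>2)" if "p < m" for p
  proof -
    have "complex_of_real (eigvals (gram m n \<psi>) ! p) = of_real (\<Sum>j<n. (cmod (\<Sum>i<m. cnj (a p i) * \<psi> (i*n+j)))\<^sup>2)"
      using 3[OF that that] by (simp add: cnj_mult_cmod(1) del: of_real_power cnj_sum)
    thus ?thesis by (simp only: of_real_eq_iff)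
  qed
  thus ?thesis using a ent 3 that by blast
qed

lemma eigvals_gram_nonneg: "p < m \<Longrightarrow> 0 \<le> eigvals (gram m n \<psi>) ! p"
  by (rule gram_spectral[of m n \<psi>]) (simp add: sum_nonneg)

lemma sv_sq: "p < m \<Longrightarrow> (sv m n \<psi> p)\<^sup>2 = eigvals (gram m n \<psi>) ! p"
  using eigvals_gram_nonneg by (simp add: sv_def)

lemma sv_nonneg: "p < m \<Longrightarrow> 0 \<le> sv m n \<psi> p"
  using eigvals_gram_nonneg by (simp add: sv_def)

lemma sv_antimono: "p \<le> q \<Longrightarrow> q < m \<Longrightarrow> sv m n \<psi> q \<le> sv m n \<psi> p"
  unfolding sv_def by (intro real_sqrt_le_mono eigvals_antimono) (auto simp: length_eigvals[OF gram_carrier])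

lemma sum_sv_sq: "(\<Sum>p<m. (sv m n \<psi> p)\<^sup>2) = Re (ip (m*n) \<psi> \<psi>)"
proof -
  obtain a where a: "ons m {..<m} a"
    and h: "\<And>p. p < m \<Longrightarrow> eigvals (gram m n \<psi>) ! p = (\<Sum>j<n. (cmod (\<Sum>i<m. cnj (a p i) * \<psi> (i*n+j)))\<^sup>2)"
    by (rule gram_spectral[of m n \<psi>]) blast
  have "(\<Sum>p<m. (sv m n \<psi> p)\<^sup>2) = (\<Sum>p<m. \<Sum>j<n. (cmod (ip m (a p) (\<lambda>i. \<psi> (i*n+j))))\<^sup>2)"
    by (simp add: sv_sq h ip_def)
  also have "\<dots> = (\<Sum>j<n. \<Sum>p<m. (cmod (ip m (a p) (\<lambda>i. \<psi> (i*n+j))))\<^sup>2)" by (rule sum.swap)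
  also have "\<dots> = (\<Sum>j<n. Re (ip m (\<lambda>i. \<psi> (i*n+j)) (\<lambda>i. \<psi> (i*n+j))))"
    by (simp add: parseval[OF a])
  also have "\<dots> = (\<Sum>j<n. \<Sum>i<m. (cmod (\<psi> (i*n+j)))\<^sup>2)" by (simp add: ip_self)
  also have "\<dots> = (\<Sum>i<m. \<Sum>j<n. (cmod (\<psi> (i*n+j)))\<^sup>2)" by (rule sum.swap)
  also have "\<dots> = Re (ip (m*n) \<psi> \<psi>)" by (simp add: ip_self sum_prod_index)
  finally show ?thesis .
qed

lemma ons_cnj: "ons N J a \<Longrightarrow> ons N J (\<lambda>i x. cnj (a i x))"
  unfolding ons_def
proof (intro ballI)
  fix i j assume h: "\<forall>i\<in>J. \<forall>j\<in>J. ip N (a i) (a j) = (if i = j then 1 else 0)" "i \<in> J" "j \<in> J"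
  have "ip N (\<lambda>x. cnj (a i x)) (\<lambda>x. cnj (a j x)) = ip N (a j) (a i)" by (simp add: ip_def mult.commute)
  thus "ip N (\<lambda>x. cnj (a i x)) (\<lambda>x. cnj (a j x)) = (if i = j then 1 else 0)" using h by auto
qed

text \<open>The vector \<open>f q p\<close> is the tensor product of the conjugated left singular vector \<open>q\<close> and the
  right singular vector \<open>p\<close>; it is zero if the singular value \<open>p\<close> is zero.\<close>

lemma schmidt_form:
  obtains f where
    "\<And>p q p' q'. p < m \<Longrightarrow> q < m \<Longrightarrow> p' < m \<Longrightarrow> q' < m \<Longrightarrow> (p,q) \<noteq> (p',q') \<Longrightarrow> ip (m*n) (f p q) (f p' q') = 0"
    "\<And>p q. p < m \<Longrightarrow> q < m \<Longrightarrow> Re (ip (m*n) (f p q) (f p q)) \<le> 1"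
    "\<And>p q. p < m \<Longrightarrow> q < m \<Longrightarrow> sv m n \<psi> q \<noteq> 0 \<Longrightarrow> ip (m*n) (f p q) (f p q) = 1"
    "\<And>u. ptf m n \<psi> u = (\<Sum>p<m. \<Sum>q<m. sv m n \<psi> p * sv m n \<psi> q *
        Re (cnj (ip (m*n) (f p q) u) * ip (m*n) (f q p) u))"
proof -
  obtain a where a: "ons m {..<m} a"
    and h: "\<And>p. p < m \<Longrightarrow> eigvals (gram m n \<psi>) ! p = (\<Sum>j<n. (cmod (\<Sum>i<m. cnj (a p i) * \<psi> (i*n+j)))\<^sup>2)"
    and o: "\<And>p q. p < m \<Longrightarrow> q < m \<Longrightarrow> (\<Sum>j<n. cnj (\<Sum>i<m. cnj (a p i) * \<psi> (i*n+j)) * (\<Sum>i<m. cnj (a q i) * \<psi> (i*n+j)))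
        = (if p = q then of_real (eigvals (gram m n \<psi>) ! p) else 0)"
    by (rule gram_spectral[of m n \<psi>]) blast
  define s where "s = sv m n \<psi>"
  define G where "G p j = (\<Sum>i<m. cnj (a p i) * \<psi> (i*n+j))" for p j
  \<comment> \<open>Division by zero yields 0, so \<open>B p\<close> is the zero vector when
    \<open>s p = 0\<close>; as \<open>G p\<close> vanishes there too, the relation \<open>sB\<close>
    has no exceptional case.\<close>
  define B where "B p j = of_real (1 / s p) * G p j" for p j
  define f where "f q p x = cnj (a q (x div n)) * B p (x mod n)" for q p x
  have sB: "of_real (s p) * B p j = G p j" if "p < m" "j < n" for p j
  proof (cases "s p = 0")
    case True
    hence "(\<Sum>j<n. (cmod (G p j))\<^sup>2) = 0" using sv_sq[OF that(1), of n \<psi>] h[OF that(1)] by (simp add: s_def G_def)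
    hence "G p j = 0" using that(2) by (auto simp: sum_nonneg_eq_0_iff)
    thus ?thesis using True by simp
  qed (simp add: B_def)
  have ipG: "ip n (G p) (G q) = (if p = q then of_real ((s p)\<^sup>2) else 0)" if "p < m" "q < m" for p q
    using o[OF that] unfolding ip_def G_def s_def sv_sq[OF that(1), of n \<psi>] by simp
  have ipB: "ip n (B p) (B q) = (if p = q \<and> s p \<noteq> 0 then 1 else 0)" if "p < m" "q < m" for p q
  proof -
    have "ip n (B p) (B q) = of_real (1 / s p) * of_real (1 / s q) * ip n (G p) (G q)"
      unfolding B_def by (simp only: ip_scale_left ip_scale_right complex_cnj_complex_of_real mult.assoc)
    thus ?thesis using ipG[OF that] by (auto simp: power2_eq_square)
  qed
  have ipf: "ip (m*n) (f q p) (f q' p') = ip m (a q') (a q) * ip n (B p) (B p')" for q p q' p'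
  proof -
    have "ip (m*n) (f q p) (f q' p') = (\<Sum>i<m. \<Sum>j<n. (cnj (a q' i) * a q i) * (cnj (B p j) * B p' j))"
      unfolding ip_def sum_prod_index by (intro sum.cong refl) (simp add: f_def mult_ac)
    thus ?thesis by (simp add: ip_def sum_product)
  qed
  have e: "(\<Sum>i<m. a p i * (\<Sum>k<m. a q k * rowip n \<psi> u i k)) = of_real (s p) * ip (m*n) (f q p) u"
    if p: "p < m" for p q u
  proof -
    have "(\<Sum>i<m. a p i * (\<Sum>k<m. a q k * rowip n \<psi> u i k))
        = (\<Sum>i<m. \<Sum>k<m. \<Sum>l<n. a q k * (a p i * cnj (\<psi> (i*n+l)) * u (k*n+l)))"
      by (simp add: rowip_def ip_def sum_distrib_left mult_ac)
    also have "\<dots> = (\<Sum>k<m. \<Sum>l<n. \<Sum>i<m. a q k * (a p i * cnj (\<psi> (i*n+l)) * u (k*n+l)))"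
      by (rule sum_swap3)
    also have "\<dots> = (\<Sum>k<m. \<Sum>l<n. a q k * (cnj (G p l) * u (k*n+l)))"
      by (simp add: G_def sum_distrib_left sum_distrib_right mult_ac)
    also have "\<dots> = (\<Sum>k<m. \<Sum>l<n. of_real (s p) * (cnj (f q p (k*n+l)) * u (k*n+l)))"
    proof (intro sum.cong refl)
      fix k l assume "k \<in> {..<m}" "l \<in> {..<n}"
      hence "cnj (G p l) = of_real (s p) * cnj (B p l)" using sB[OF p, of l, symmetric] by simp
      thus "a q k * (cnj (G p l) * u (k*n+l)) = of_real (s p) * (cnj (f q p (k*n+l)) * u (k*n+l))"
        using \<open>l \<in> {..<n}\<close> by (simp add: f_def mult_ac)
    qed
    also have "\<dots> = of_real (s p) * ip (m*n) (f q p) u" by (simp add: ip_def sum_prod_index sum_distrib_left)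
    finally show ?thesis .
  qed
  show ?thesis
  proof (rule that[of f])
    show "ip (m*n) (f p q) (f p' q') = 0" if "p < m" "q < m" "p' < m" "q' < m" "(p,q) \<noteq> (p',q')" for p q p' q'
      using that by (auto simp: ipf ipB onsD[OF a])
    show "Re (ip (m*n) (f p q) (f p q)) \<le> 1" if "p < m" "q < m" for p q
      using that by (auto simp: ipf ipB onsD[OF a])
    show "ip (m*n) (f p q) (f p q) = 1" if "p < m" "q < m" "sv m n \<psi> q \<noteq> 0" for p q
      using that by (auto simp: ipf ipB onsD[OF a] s_def)
    fix u
    define R where "R = rowip n \<psi> u"
    define b where "b p x = cnj (a p x)" for p x
    have b: "ons m {..<m} b" unfolding b_def by (rule ons_cnj[OF a])
    define U where "U q i = ip m (b q) (\<lambda>k. R k i)" for q i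
    define V where "V q i = ip m (b q) (R i)" for q i
    have bU: "ip m (b p) (U q) = of_real (s q) * ip (m*n) (f p q) u" if "q < m" for p q
    proof -
      have "ip m (b p) (U q) = (\<Sum>i<m. \<Sum>k<m. a p i * (a q k * R k i))"
        by (simp add: U_def ip_def b_def sum_distrib_left)
      also have "\<dots> = (\<Sum>k<m. \<Sum>i<m. a p i * (a q k * R k i))" by (rule sum.swap)
      also have "\<dots> = (\<Sum>k<m. a q k * (\<Sum>i<m. a p i * rowip n \<psi> u k i))"
        by (simp add: R_def sum_distrib_left mult_ac)
      finally show ?thesis using e[OF that] by simp
    qed
    have bV: "ip m (b p) (V q) = of_real (s p) * ip (m*n) (f q p) u" if "p < m" for p q
      using e[OF that, of q u] by (simp add: V_def ip_def b_def R_def)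
    have "(\<Sum>i<m. \<Sum>k<m. cnj (R k i) * R i k) = (\<Sum>i<m. ip m (\<lambda>k. R k i) (R i))"
      by (simp add: ip_def)
    \<comment> \<open>Parseval in the conjugated left singular basis is used twice, here for the
      inner index of \<open>R\<close> and below for the outer one.\<close>
    also have "\<dots> = (\<Sum>i<m. \<Sum>q<m. cnj (U q i) * V q i)"
      by (subst parseval_ip[OF b, symmetric]) (simp add: U_def V_def cnj_ip)
    also have "\<dots> = (\<Sum>q<m. ip m (U q) (V q))" unfolding ip_def by (rule sum.swap)
    also have "\<dots> = (\<Sum>q<m. \<Sum>p<m. cnj (ip m (b p) (U q)) * ip m (b p) (V q))"
      by (subst parseval_ip[OF b, symmetric]) (simp add: cnj_ip)
    also have "\<dots> = (\<Sum>q<m. \<Sum>p<m. of_real (s p * s q) * (cnj (ip (m*n) (f p q) u) * ip (m*n) (f q p) u))"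
      by (intro sum.cong refl) (simp add: bU bV mult_ac)
    also have "\<dots> = (\<Sum>p<m. \<Sum>q<m. of_real (s p * s q) * (cnj (ip (m*n) (f p q) u) * ip (m*n) (f q p) u))"
      by (rule sum.swap)
    finally have "ptf m n \<psi> u = Re (\<Sum>p<m. \<Sum>q<m. of_real (s p * s q) * (cnj (ip (m*n) (f p q) u) * ip (m*n) (f q p) u))"
      by (simp add: ptf_def R_def)
    also have "\<dots> = (\<Sum>p<m. \<Sum>q<m. s p * s q * Re (cnj (ip (m*n) (f p q) u) * ip (m*n) (f q p) u))"
      by (simp only: Re_sum Re_of_real_mult)
    finally show "ptf m n \<psi> u = (\<Sum>p<m. \<Sum>q<m. sv m n \<psi> p * sv m n \<psi> q * Re (cnj (ip (m*n) (f p q) u) * ip (m*n) (f q p) u))"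
      by (simp add: s_def)
  qed
qed

lemma sum_square_split:
  "(\<Sum>p<m. \<Sum>q<m. g p q) = (\<Sum>p<m. g p p) + (\<Sum>q<m. \<Sum>p<q. g p q + g q (p::nat) :: 'a :: comm_monoid_add)"
  by (induction m) (simp_all add: sum.distrib algebra_simps)

lemma cmod_polar: "(cmod (x + y))\<^sup>2 = (cmod x)\<^sup>2 + (cmod y)\<^sup>2 + 2 * Re (cnj x * y)"
  "(cmod (x - y))\<^sup>2 = (cmod x)\<^sup>2 + (cmod y)\<^sup>2 - 2 * Re (cnj x * y)"
  by (simp_all add: cmod_power2) (simp_all add: algebra_simps power2_eq_square)

lemma bessel_family:
  assumes fin: "finite J" and ons: "ons N J v"
  shows "(\<Sum>j\<in>J. (cmod (ip N e (v j)))\<^sup>2) \<le> Re (ip N e e)"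
  using bessel_ons[OF fin ons, of e] by (simp add: cmod_ip_commute)

text \<open>The weights \<open>\<delta>\<close>, \<open>\<beta>\<close>, \<open>\<alpha>\<close> are the expectation values of the projection onto the family
  in the eigenvectors \<open>|pp>\<close>, \<open>(|pq> + |qp>)/sqrt 2\<close>, \<open>(|pq> - |qp>)/sqrt 2\<close> of the partial transpose.\<close>

lemma ptf_family:
  assumes fin: "finite J" and ons: "ons (m*n) J v"
  obtains \<alpha> \<beta> \<delta> where
    "(\<Sum>j\<in>J. ptf m n \<psi> (v j)) = (\<Sum>p<m. (sv m n \<psi> p)\<^sup>2 * \<delta> p)
       + (\<Sum>q<m. \<Sum>p<q. sv m n \<psi> p * sv m n \<psi> q * (\<beta> p q - \<alpha> p q))"
    "\<And>p q. p < q \<Longrightarrow> q < m \<Longrightarrow> 0 \<le> \<alpha> p q \<and> \<alpha> p q \<le> 1" "\<And>p q. p < q \<Longrightarrow> q < m \<Longrightarrow> 0 \<le> \<beta> p q \<and> \<beta> p q \<le> 1"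
    "\<And>p. p < m \<Longrightarrow> 0 \<le> \<delta> p \<and> \<delta> p \<le> (1::real)"
    "(\<Sum>p<m. \<delta> p) + (\<Sum>q<m. \<Sum>p<q. \<beta> p q + \<alpha> p q) \<le> real (card J)"
proof -
  define N where "N = m * n"
  define s where "s = sv m n \<psi>"
  obtain f where
    orth: "\<And>p q p' q'. p < m \<Longrightarrow> q < m \<Longrightarrow> p' < m \<Longrightarrow> q' < m \<Longrightarrow> (p,q) \<noteq> (p',q') \<Longrightarrow> ip N (f p q) (f p' q') = 0"
    and le1: "\<And>p q. p < m \<Longrightarrow> q < m \<Longrightarrow> Re (ip N (f p q) (f p q)) \<le> 1"
    and form: "\<And>u. ptf m n \<psi> u = (\<Sum>p<m. \<Sum>q<m. s p * s q * Re (cnj (ip N (f p q) u) * ip N (f q p) u))"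
    unfolding N_def s_def by (rule schmidt_form[of m n \<psi>]) blast
  note ons = ons[folded N_def]
  define X where "X p q j = ip N (f p q) (v j)" for p q j
  \<comment> \<open>The halves normalise \<open>f p q - f q p\<close> and
    \<open>f p q + f q p\<close>, which have squared norm at most 2.\<close>
  define \<alpha> where "\<alpha> p q = (\<Sum>j\<in>J. (cmod (X p q j - X q p j))\<^sup>2) / 2" for p q
  define \<beta> where "\<beta> p q = (\<Sum>j\<in>J. (cmod (X p q j + X q p j))\<^sup>2) / 2" for p q
  define \<delta> where "\<delta> p = (\<Sum>j\<in>J. (cmod (X p p j))\<^sup>2)" for p
  show ?thesis
  proof (rule that[of \<delta> \<beta> \<alpha>])
    have "(\<Sum>j\<in>J. ptf m n \<psi> (v j)) = (\<Sum>j\<in>J. \<Sum>p<m. \<Sum>q<m. s p * s q * Re (cnj (X p q j) * X q p j))"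
      by (simp add: form X_def)
    also have "\<dots> = (\<Sum>p<m. \<Sum>q<m. \<Sum>j\<in>J. s p * s q * Re (cnj (X p q j) * X q p j))" by (rule sum_swap3)
    also have "\<dots> = (\<Sum>p<m. \<Sum>j\<in>J. s p * s p * Re (cnj (X p p j) * X p p j))
       + (\<Sum>q<m. \<Sum>p<q. (\<Sum>j\<in>J. s p * s q * Re (cnj (X p q j) * X q p j)) + (\<Sum>j\<in>J. s q * s p * Re (cnj (X q p j) * X p q j)))"
      by (rule sum_square_split)
    also have "(\<Sum>p<m. \<Sum>j\<in>J. s p * s p * Re (cnj (X p p j) * X p p j)) = (\<Sum>p<m. (s p)\<^sup>2 * \<delta> p)"
      unfolding \<delta>_def sum_distrib_left
      by (simp add: cnj_mult_cmod(1) power2_eq_square[of "s _"] del: of_real_power)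
    also have "(\<Sum>q<m. \<Sum>p<q. (\<Sum>j\<in>J. s p * s q * Re (cnj (X p q j) * X q p j)) + (\<Sum>j\<in>J. s q * s p * Re (cnj (X q p j) * X p q j)))
        = (\<Sum>q<m. \<Sum>p<q. s p * s q * (\<beta> p q - \<alpha> p q))"
    proof (intro sum.cong refl)
      fix p q
      have "Re (cnj (X q p j) * X p q j) = Re (cnj (X p q j) * X q p j)" for j by (simp add: mult.commute)
      hence "(\<Sum>j\<in>J. s p * s q * Re (cnj (X p q j) * X q p j)) + (\<Sum>j\<in>J. s q * s p * Re (cnj (X q p j) * X p q j))
          = s p * s q * (\<Sum>j\<in>J. 2 * Re (cnj (X p q j) * X q p j))"
        unfolding sum.distrib[symmetric] sum_distrib_left by (intro sum.cong refl) (simp add: algebra_simps)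
      also have "(\<Sum>j\<in>J. 2 * Re (cnj (X p q j) * X q p j)) = \<beta> p q - \<alpha> p q"
        unfolding \<alpha>_def \<beta>_def by (simp only: cmod_polar diff_divide_distrib[symmetric] sum_subtractf[symmetric] sum_divide_distrib)
           (intro sum.cong, auto simp: field_simps)
      finally show "(\<Sum>j\<in>J. s p * s q * Re (cnj (X p q j) * X q p j)) + (\<Sum>j\<in>J. s q * s p * Re (cnj (X q p j) * X p q j))
          = s p * s q * (\<beta> p q - \<alpha> p q)" .
    qed
    finally show "(\<Sum>j\<in>J. ptf m n \<psi> (v j)) = (\<Sum>p<m. (sv m n \<psi> p)\<^sup>2 * \<delta> p)
       + (\<Sum>q<m. \<Sum>p<q. sv m n \<psi> p * sv m n \<psi> q * (\<beta> p q - \<alpha> p q))" by (simp add: s_def)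
    fix p q :: nat
    assume pq: "p < q" "q < m"
    hence pm: "p < m" by simp
    have o: "ip N (f p q) (f q p) = 0" "ip N (f q p) (f p q) = 0" using orth pq pm by auto
    have n: "Re (ip N (f p q) (f p q)) \<le> 1" "Re (ip N (f q p) (f q p)) \<le> 1" using le1 pq pm by auto
    have "(\<Sum>j\<in>J. (cmod (X p q j - X q p j))\<^sup>2) \<le> Re (ip N (\<lambda>x. f p q x - f q p x) (\<lambda>x. f p q x - f q p x))"
      using bessel_family[OF fin ons, of "\<lambda>x. f p q x - f q p x"] unfolding X_def by (simp add: ip_diff_left)
    also have "\<dots> \<le> 2" using n by (simp add: ip_diff_left ip_diff_right o)
    finally show "0 \<le> \<alpha> p q \<and> \<alpha> p q \<le> 1" by (simp add: \<alpha>_def sum_nonneg)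
    have "(\<Sum>j\<in>J. (cmod (X p q j + X q p j))\<^sup>2) \<le> Re (ip N (\<lambda>x. f p q x + f q p x) (\<lambda>x. f p q x + f q p x))"
      using bessel_family[OF fin ons, of "\<lambda>x. f p q x + f q p x"] unfolding X_def by (simp add: ip_add_left)
    also have "\<dots> \<le> 2" using n by (simp add: ip_add_left ip_add_right o)
    finally show "0 \<le> \<beta> p q \<and> \<beta> p q \<le> 1" by (simp add: \<beta>_def sum_nonneg)
  next
    fix p assume "p < m"
    have "(\<Sum>j\<in>J. (cmod (X p p j))\<^sup>2) \<le> Re (ip N (f p p) (f p p))"
      using bessel_family[OF fin ons, of "f p p"] unfolding X_def by simp
    also have "\<dots> \<le> 1" using le1 \<open>p < m\<close> by simp
    finally show "0 \<le> \<delta> p \<and> \<delta> p \<le> 1" by (simp add: \<delta>_def sum_nonneg)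
  next
    \<comment> \<open>By the parallelogram law the weights add up to the squared overlaps of all
      \<open>f p q\<close> with the family, and Bessel's inequality allows each member of the family
      at most 1.\<close>
    have "(\<Sum>p<m. \<delta> p) + (\<Sum>q<m. \<Sum>p<q. \<beta> p q + \<alpha> p q)
        = (\<Sum>p<m. \<delta> p) + (\<Sum>q<m. \<Sum>p<q. (\<Sum>j\<in>J. (cmod (X p q j))\<^sup>2) + (\<Sum>j\<in>J. (cmod (X q p j))\<^sup>2))"
    proof -
      have "\<beta> p q + \<alpha> p q = (\<Sum>j\<in>J. (cmod (X p q j))\<^sup>2) + (\<Sum>j\<in>J. (cmod (X q p j))\<^sup>2)" for p q
        unfolding \<alpha>_def \<beta>_def
        by (simp only: cmod_polar add_divide_distrib[symmetric] sum.distrib[symmetric] sum_divide_distrib)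
           (intro sum.cong, auto)
      thus ?thesis by simp
    qed
    also have "\<dots> = (\<Sum>p<m. \<Sum>q<m. \<Sum>j\<in>J. (cmod (X p q j))\<^sup>2)"
      unfolding \<delta>_def by (rule sum_square_split[symmetric])
    also have "\<dots> = (\<Sum>j\<in>J. \<Sum>p<m. \<Sum>q<m. (cmod (X p q j))\<^sup>2)" by (rule sum_swap3[symmetric])
    also have "\<dots> \<le> (\<Sum>j\<in>J. 1)"
    proof (rule sum_mono)
      fix j assume j: "j \<in> J"
      have "(\<Sum>p<m. \<Sum>q<m. (cmod (X p q j))\<^sup>2) = (\<Sum>z\<in>{..<m}\<times>{..<m}. (cmod (ip N (case z of (p,q) \<Rightarrow> f p q) (v j)))\<^sup>2)"
        by (simp add: sum.cartesian_product X_def split_def)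
      also have "\<dots> \<le> Re (ip N (v j) (v j))"
        by (rule bessel) (auto intro: orth le1)
      finally show "(\<Sum>p<m. \<Sum>q<m. (cmod (X p q j))\<^sup>2) \<le> 1" using onsD[OF ons j j] by simp
    qed
    finally show "(\<Sum>p<m. \<delta> p) + (\<Sum>q<m. \<Sum>p<q. \<beta> p q + \<alpha> p q) \<le> real (card J)" by simp
  qed
qed

section \<open>Bounds for the partial transpose of a pure state\<close>

text \<open>Only the antisymmetric weights \<alpha> enter negatively, so the worst case maximises
  the sum of \<open>s p * s q * \<alpha> p q\<close> subject to weights at most 1 and total at most
  \<open>card J\<close>. The number \<open>t\<close> is the dual variable of the constraint on the
  total: every nonnegative \<open>t\<close> gives a bound, and the best choice is the product at
  position \<open>card J\<close> in decreasing order.\<close>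

lemma ptf_family_lower:
  assumes fin: "finite J" and ons: "ons (m*n) J v" and t: "0 \<le> t"
  shows "- (t * real (card J) + (\<Sum>q<m. \<Sum>p<q. max 0 (sv m n \<psi> p * sv m n \<psi> q - t)))
    \<le> (\<Sum>j\<in>J. ptf m n \<psi> (v j))"
proof -
  define s where "s = sv m n \<psi>"
  obtain \<alpha> \<beta> \<delta> where eq: "(\<Sum>j\<in>J. ptf m n \<psi> (v j)) = (\<Sum>p<m. (s p)\<^sup>2 * \<delta> p)
       + (\<Sum>q<m. \<Sum>p<q. s p * s q * (\<beta> p q - \<alpha> p q))"
    and \<alpha>: "\<And>p q. p < q \<Longrightarrow> q < m \<Longrightarrow> 0 \<le> \<alpha> p q \<and> \<alpha> p q \<le> 1"
    and \<beta>: "\<And>p q. p < q \<Longrightarrow> q < m \<Longrightarrow> 0 \<le> \<beta> p q \<and> \<beta> p q \<le> 1"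
    and \<delta>: "\<And>p. p < m \<Longrightarrow> 0 \<le> \<delta> p \<and> \<delta> p \<le> (1::real)"
    and tot: "(\<Sum>p<m. \<delta> p) + (\<Sum>q<m. \<Sum>p<q. \<beta> p q + \<alpha> p q) \<le> real (card J)"
    unfolding s_def by (rule ptf_family[OF fin ons, of \<psi>]) blast
  have s: "0 \<le> s p" if "p < m" for p unfolding s_def by (rule sv_nonneg[OF that])
  have \<alpha>J: "(\<Sum>q<m. \<Sum>p<q. \<alpha> p q) \<le> real (card J)"
  proof -
    have "(\<Sum>q<m. \<Sum>p<q. \<alpha> p q) \<le> (\<Sum>q<m. \<Sum>p<q. \<beta> p q + \<alpha> p q)"
      using \<beta> by (intro sum_mono) auto
    moreover have "0 \<le> (\<Sum>p<m. \<delta> p)" using \<delta> by (intro sum_nonneg) auto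
    ultimately show ?thesis using tot by linarith
  qed
  have "- (t * real (card J) + (\<Sum>q<m. \<Sum>p<q. max 0 (s p * s q - t)))
      \<le> - (t * (\<Sum>q<m. \<Sum>p<q. \<alpha> p q) + (\<Sum>q<m. \<Sum>p<q. max 0 (s p * s q - t)))"
    using mult_left_mono[OF \<alpha>J t] by simp
  also have "\<dots> = (\<Sum>q<m. \<Sum>p<q. - (t * \<alpha> p q + max 0 (s p * s q - t)))"
    by (simp add: sum_distrib_left sum.distrib sum_negf sum_subtractf)
  also have "\<dots> \<le> (\<Sum>q<m. \<Sum>p<q. s p * s q * (\<beta> p q - \<alpha> p q))"
  proof (intro sum_mono)
    fix p q assume "q \<in> {..<m}" "p \<in> {..<q}"
    hence pq: "p < q" "q < m" "p < m" by auto
    have "0 \<le> s p * s q * \<beta> p q" using \<beta>[of p q] s pq by simp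
    moreover have "(s p * s q - t) * \<alpha> p q \<le> max 0 (s p * s q - t)"
    proof (cases "s p * s q \<le> t")
      case True
      hence "(s p * s q - t) * \<alpha> p q \<le> 0" using \<alpha>[OF pq(1,2)] by (intro mult_nonpos_nonneg) auto
      thus ?thesis by simp
    next
      case False
      hence "(s p * s q - t) * \<alpha> p q \<le> (s p * s q - t) * 1" using \<alpha>[OF pq(1,2)] by (intro mult_left_mono) auto
      thus ?thesis by simp
    qed
    ultimately show "- (t * \<alpha> p q + max 0 (s p * s q - t)) \<le> s p * s q * (\<beta> p q - \<alpha> p q)"
      by (simp add: algebra_simps)
  qed
  also have "\<dots> \<le> (\<Sum>j\<in>J. ptf m n \<psi> (v j))"
    unfolding eq using \<delta> by (auto intro!: sum_nonneg mult_nonneg_nonneg)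
  finally show ?thesis by (simp add: s_def)
qed

lemma sum_triangle_restrict:
  fixes g :: "nat \<Rightarrow> nat \<Rightarrow> real"
  assumes "k \<le> m" "\<And>p q. p < q \<Longrightarrow> k \<le> q \<Longrightarrow> q < m \<Longrightarrow> g p q = 0"
  shows "(\<Sum>q<m. \<Sum>p<q. g p q) = (\<Sum>q<k. \<Sum>p<q. g p q)"
  using assms by (intro sum.mono_neutral_right) (auto intro!: sum.neutral)

lemma sv_mult_mono:
  "p \<le> p' \<Longrightarrow> q \<le> q' \<Longrightarrow> p' < m \<Longrightarrow> q' < m \<Longrightarrow> sv m n \<psi> p' * sv m n \<psi> q' \<le> sv m n \<psi> p * sv m n \<psi> q"
  by (intro mult_mono sv_antimono sv_nonneg) auto

text \<open>With \<open>t\<close> the largest product, no product exceeds \<open>t\<close> and the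
  correction sum vanishes.\<close>

lemma ptf_family1:
  assumes fin: "finite J" and ons: "ons (m*n) J v" and J: "card J = 1" and m: "2 \<le> m"
  shows "- (sv m n \<psi> 0 * sv m n \<psi> 1) \<le> (\<Sum>j\<in>J. ptf m n \<psi> (v j))"
proof -
  define s where "s = sv m n \<psi>"
  have "s p * s q \<le> s 0 * s 1" if "p < q" "q < m" for p q
    unfolding s_def using that by (intro sv_mult_mono) auto
  hence "(\<Sum>q<m. \<Sum>p<q. max 0 (s p * s q - s 0 * s 1)) = 0" by (intro sum.neutral ballI) auto
  moreover have "0 \<le> s 0 * s 1" using m unfolding s_def by (intro mult_nonneg_nonneg sv_nonneg) auto
  ultimately show ?thesis using ptf_family_lower[OF fin ons, of "s 0 * s 1" \<psi>] J by (simp add: s_def)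
qed

text \<open>The two largest products are always \<open>s 0 * s 1\<close> and
  \<open>s 0 * s 2\<close>; with \<open>t\<close> the second of them only the first exceeds
  it.\<close>

lemma ptf_family2:
  assumes fin: "finite J" and ons: "ons (m*n) J v" and J: "card J = 2" and m: "3 \<le> m"
  shows "- (sv m n \<psi> 0 * sv m n \<psi> 1 + sv m n \<psi> 0 * sv m n \<psi> 2) \<le> (\<Sum>j\<in>J. ptf m n \<psi> (v j))"
proof -
  define s where "s = sv m n \<psi>"
  have le: "s p * s q \<le> s 0 * s 2" if "p < q" "2 \<le> q" "q < m" for p q
    unfolding s_def using that by (intro sv_mult_mono) auto
  have "(\<Sum>q<m. \<Sum>p<q. max 0 (s p * s q - s 0 * s 2)) = (\<Sum>q<2. \<Sum>p<q. max 0 (s p * s q - s 0 * s 2))"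
    using m le by (intro sum_triangle_restrict) auto
  also have "\<dots> = s 0 * s 1 - s 0 * s 2"
    using sv_mult_mono[of 0 0 1 2 m n \<psi>] m by (simp add: numeral_2_eq_2 s_def)
  finally have "(\<Sum>q<m. \<Sum>p<q. max 0 (s p * s q - s 0 * s 2)) = s 0 * s 1 - s 0 * s 2" .
  moreover have "0 \<le> s 0 * s 2" using m unfolding s_def by (intro mult_nonneg_nonneg sv_nonneg) auto
  ultimately show ?thesis using ptf_family_lower[OF fin ons, of "s 0 * s 2" \<psi>] J by (simp add: s_def)
qed

text \<open>Which product comes third, \<open>s 1 * s 2\<close> or \<open>s 0 * s 3\<close>, depends
  on the vector. Hence \<open>t\<close> is only required to dominate both without exceeding the
  second largest product.\<close>

lemma ptf_family3:
  assumes fin: "finite J" and ons: "ons (m*n) J v" and J: "card J = 3" and m: "3 \<le> m"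
    and t: "sv m n \<psi> 1 * sv m n \<psi> 2 \<le> t" "4 \<le> m \<Longrightarrow> sv m n \<psi> 0 * sv m n \<psi> 3 \<le> t" "t \<le> sv m n \<psi> 0 * sv m n \<psi> 2"
  shows "- (sv m n \<psi> 0 * sv m n \<psi> 1 + sv m n \<psi> 0 * sv m n \<psi> 2 + t) \<le> (\<Sum>j\<in>J. ptf m n \<psi> (v j))"
proof -
  define s where "s = sv m n \<psi>"
  have le: "s p * s q \<le> t" if "p < q" "3 \<le> q" "q < m" for p q
  proof -
    have "s p * s q \<le> s 0 * s 3" unfolding s_def using that by (intro sv_mult_mono) auto
    thus ?thesis using t(2) that unfolding s_def by linarith
  qed
  have "0 \<le> sv m n \<psi> 1 * sv m n \<psi> 2" using m by (intro mult_nonneg_nonneg sv_nonneg) auto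
  hence t0: "0 \<le> t" using t(1) by linarith
  have "(\<Sum>q<m. \<Sum>p<q. max 0 (s p * s q - t)) = (\<Sum>q<3. \<Sum>p<q. max 0 (s p * s q - t))"
    using m le by (intro sum_triangle_restrict) auto
  also have "\<dots> = (s 0 * s 1 - t) + (s 0 * s 2 - t)"
    using sv_mult_mono[of 0 0 1 2 m n \<psi>] m t by (simp add: eval_nat_numeral s_def)
  finally have "(\<Sum>q<m. \<Sum>p<q. max 0 (s p * s q - t)) = (s 0 * s 1 - t) + (s 0 * s 2 - t)" .
  thus ?thesis using ptf_family_lower[OF fin ons t0, of \<psi>] J by (simp add: s_def)
qed

lemma mult_le_half_sum_squares: "2 * (a * b) \<le> (a::real)\<^sup>2 + b\<^sup>2"
  using zero_le_power2[of "a - b"] by (simp add: power2_diff)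

lemma sv_sq_le:
  assumes unit: "ip (m*n) \<psi> \<psi> = 1" and "k \<le> m"
  shows "(\<Sum>p<k. (sv m n \<psi> p)\<^sup>2) \<le> 1"
proof -
  have "(\<Sum>p<k. (sv m n \<psi> p)\<^sup>2) \<le> (\<Sum>p<m. (sv m n \<psi> p)\<^sup>2)" using assms(2) by (intro sum_mono2) auto
  thus ?thesis using unit by (simp add: sum_sv_sq)
qed

lemma ptf_ge1:
  assumes "ip (m*n) \<psi> \<psi> = 1" "2 \<le> m" "finite J" "ons (m*n) J v" "card J = 1"
  shows "- (1/2) \<le> (\<Sum>j\<in>J. ptf m n \<psi> (v j))"
  using ptf_family1[OF assms(3-5,2), of \<psi>] sv_sq_le[OF assms(1,2)]
    mult_le_half_sum_squares[of "sv m n \<psi> 0" "sv m n \<psi> 1"] by (simp add: numeral_2_eq_2)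

text \<open>For \<open>m = 2\<close> there is a single pair of Schmidt indices. Even
  \<open>t = 0\<close> then gives the bound \<open>s 0 * s 1\<close>, uniformly in the size of the
  family.\<close>

lemma ptf_ge_two:
  assumes "ip (2*n) \<psi> \<psi> = 1" "finite J" "ons (2*n) J v"
  shows "- (1/2) \<le> (\<Sum>j\<in>J. ptf 2 n \<psi> (v j))"
  using ptf_family_lower[OF assms(2,3) order.refl, of \<psi>] sv_sq_le[OF assms(1) order.refl]
    mult_le_half_sum_squares[of "sv 2 n \<psi> 0" "sv 2 n \<psi> 1"] sv_nonneg[of 0 2 n \<psi>] sv_nonneg[of 1 2 n \<psi>]
  by (simp add: numeral_2_eq_2)

lemma ptf_ge2:
  assumes unit: "ip (m*n) \<psi> \<psi> = 1" and m: "3 \<le> m" and J: "finite J" "ons (m*n) J v" "card J = 2"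
  shows "- (sqrt 2 / 2) \<le> (\<Sum>j\<in>J. ptf m n \<psi> (v j))"
proof -
  define a b c where abc: "a = sv m n \<psi> 0" "b = sv m n \<psi> 1" "c = sv m n \<psi> 2"
  have "a\<^sup>2 + b\<^sup>2 + c\<^sup>2 \<le> 1" using sv_sq_le[OF unit m] by (simp add: abc eval_nat_numeral)
  hence "sqrt 2 * (a\<^sup>2 + b\<^sup>2 + c\<^sup>2) \<le> sqrt 2 * 1" by (intro mult_left_mono) auto
  moreover have "2 * (a * b + a * c) \<le> sqrt 2 * (a\<^sup>2 + b\<^sup>2 + c\<^sup>2)"
  proof -
    have r2: "sqrt 2 * (sqrt 2 * x) = 2 * x" for x :: real
      using real_sqrt_mult_self[of 2] by (simp flip: mult.assoc)
    \<comment> \<open>The squares vanish for \<open>a = sqrt 2 * b = sqrt 2 * c\<close>, that is, at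
      the normalised coefficients sqrt 2 / 2, 1/2, 1/2.\<close>
    have "0 \<le> (a - sqrt 2 * b)\<^sup>2 + (a - sqrt 2 * c)\<^sup>2" by simp
    also have "\<dots> = sqrt 2 * (sqrt 2 * (a\<^sup>2 + b\<^sup>2 + c\<^sup>2) - 2 * (a * b + a * c))"
      by (simp add: power2_eq_square algebra_simps r2)
    finally show ?thesis by (simp add: zero_le_mult_iff)
  qed
  ultimately have "2 * (a * b + a * c) \<le> sqrt 2" by (metis mult.right_neutral order.trans)
  hence "a * b + a * c \<le> sqrt 2 / 2" by (simp only: pos_le_divide_eq zero_less_numeral mult.commute)
  thus ?thesis using ptf_family2[OF J m, of \<psi>] by (simp add: abc)
qed

lemma ptf_ge3:
  assumes unit: "ip (m*n) \<psi> \<psi> = 1" and m: "3 \<le> m" and J: "finite J" "ons (m*n) J v" "card J = 3"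
  shows "- 1 \<le> (\<Sum>j\<in>J. ptf m n \<psi> (v j))"
proof -
  define a b c where abc: "a = sv m n \<psi> 0" "b = sv m n \<psi> 1" "c = sv m n \<psi> 2"
  \<comment> \<open>For \<open>m = 3\<close> there is no fourth Schmidt coefficient; the value 0
    lets both cases share one estimate.\<close>
  define d where "d = (if 4 \<le> m then sv m n \<psi> 3 else 0)"
  have sum: "a\<^sup>2 + b\<^sup>2 + c\<^sup>2 + d\<^sup>2 \<le> 1"
    using sv_sq_le[OF unit m] sv_sq_le[OF unit, of 4] by (simp add: abc d_def eval_nat_numeral)
  have ac: "b * c \<le> a * c" "a * d \<le> a * c" 
    using sv_mult_mono[of 0 1 2 2 m n \<psi>] sv_mult_mono[of 0 0 2 3 m n \<psi>] sv_nonneg[of 0 m n \<psi>] sv_nonneg[of 2 m n \<psi>] m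
    by (auto simp: abc d_def)
  have bd: "a * b + a * c + max (b * c) (a * d) \<le> 1"
  proof (cases "a * d \<le> b * c")
    case True
    have "2 * (a * b + a * c + b * c) \<le> 2 * (a\<^sup>2 + b\<^sup>2 + c\<^sup>2)"
      using mult_le_half_sum_squares[of a b] mult_le_half_sum_squares[of a c] mult_le_half_sum_squares[of b c]
      unfolding distrib_left by linarith
    moreover have "a\<^sup>2 + b\<^sup>2 + c\<^sup>2 \<le> 1" using sum zero_le_power2[of d] by linarith
    ultimately show ?thesis using True by simp
  next
    case False
    \<comment> \<open>Completing the squares in \<open>b\<close>, \<open>c\<close>, \<open>d\<close>
      uses only three quarters of \<open>a\<^sup>2\<close>, so the competing third product
      \<open>a * d\<close> cannot push the sum above 1.\<close>
    have "0 \<le> (a / 2 - b)\<^sup>2 + (a / 2 - c)\<^sup>2 + (a / 2 - d)\<^sup>2" by simp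
    hence "a * b + a * c + a * d \<le> 3 / 4 * a\<^sup>2 + b\<^sup>2 + c\<^sup>2 + d\<^sup>2"
      by (simp add: power2_diff power_divide)
    also have "\<dots> \<le> 1" using sum zero_le_power2[of a] by linarith
    finally show ?thesis using False by simp
  qed
  have "- (a * b + a * c + max (b * c) (a * d)) \<le> (\<Sum>j\<in>J. ptf m n \<psi> (v j))"
    unfolding abc by (rule ptf_family3[OF J m]) (use ac in \<open>auto simp: abc d_def\<close>)
  thus ?thesis using bd by linarith
qed

lemma sum_mult_triangle:
  fixes f :: "nat \<Rightarrow> real"
  shows
  "(\<Sum>q<m. \<Sum>p<q. f p * f q) = ((\<Sum>p<m. f p)\<^sup>2 - (\<Sum>p<m. (f p)\<^sup>2)) / 2"
proof -
  have "(\<Sum>p<m. f p)\<^sup>2 = (\<Sum>p<m. (f p)\<^sup>2) + (\<Sum>q<m. \<Sum>p<q. f p * f q + f q * f p)"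
    using sum_square_split[of "\<lambda>p q. f p * f q" m] by (simp add: power2_eq_square sum_product)
  also have "(\<Sum>q<m. \<Sum>p<q. f p * f q + f q * f p) = 2 * (\<Sum>q<m. \<Sum>p<q. f p * f q)"
    by (simp add: sum_distrib_left mult.commute)
  finally show ?thesis by simp
qed

text \<open>For \<open>t = 0\<close> the bound is the sum of all products, which is the negativity
  of the partially transposed projector onto \<psi> and applies to families of every size.\<close>

lemma ptf_ge_sum:
  assumes unit: "ip (m*n) \<psi> \<psi> = 1" and J: "finite J" "ons (m*n) J v"
  shows "- (((\<Sum>p<m. sv m n \<psi> p)\<^sup>2 - 1) / 2) \<le> (\<Sum>j\<in>J. ptf m n \<psi> (v j))"
proof -
  have "(\<Sum>q<m. \<Sum>p<q. max 0 (sv m n \<psi> p * sv m n \<psi> q - 0)) = (\<Sum>q<m. \<Sum>p<q. sv m n \<psi> p * sv m n \<psi> q)"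
    by (intro sum.cong refl) (auto simp: sv_nonneg)
  also have "\<dots> = ((\<Sum>p<m. sv m n \<psi> p)\<^sup>2 - 1) / 2"
    using unit by (simp add: sum_mult_triangle sum_sv_sq)
  finally have eq: "(\<Sum>q<m. \<Sum>p<q. max 0 (sv m n \<psi> p * sv m n \<psi> q - 0)) = ((\<Sum>p<m. sv m n \<psi> p)\<^sup>2 - 1) / 2" .
  show ?thesis using ptf_family_lower[OF J order.refl, of \<psi>] unfolding eq by simp
qed

text \<open>Cauchy-Schwarz against the constant vector in the form of an identity: nonnegativity of
  the left side bounds the sum by sqrt m, and its vanishing gives the equality case.\<close>

lemma sum_sq_dev:
  fixes f :: "nat \<Rightarrow> real"
  assumes "(\<Sum>p<m. (f p)\<^sup>2) = 1" "0 < m"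
  shows "(\<Sum>p<m. (f p - 1 / sqrt m)\<^sup>2) = 2 * (1 - (\<Sum>p<m. f p) / sqrt m)"
proof -
  define c where "c = 1 / sqrt m"
  have "(\<Sum>p<m. (f p - c)\<^sup>2) = (\<Sum>p<m. (f p)\<^sup>2) - 2 * c * (\<Sum>p<m. f p) + real m * c\<^sup>2"
    by (simp add: power2_diff sum.distrib sum_subtractf sum_distrib_left mult_ac)
  also have "real m * c\<^sup>2 = 1" using assms(2) by (simp add: c_def power_divide)
  finally show ?thesis using assms(1) by (simp add: c_def)
qed

lemma ptf_ge_neg:
  assumes unit: "ip (m*n) \<psi> \<psi> = 1" and J: "finite J" "ons (m*n) J v" and m: "0 < m"
  shows "- ((real m - 1) / 2) \<le> (\<Sum>j\<in>J. ptf m n \<psi> (v j))"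
    and "(\<Sum>j\<in>J. ptf m n \<psi> (v j)) \<le> - ((real m - 1) / 2) \<Longrightarrow> p < m \<Longrightarrow> sv m n \<psi> p = 1 / sqrt m"
proof -
  have sq: "(\<Sum>p<m. (sv m n \<psi> p)\<^sup>2) = 1" using unit by (simp add: sum_sv_sq)
  have dev: "(\<Sum>p<m. (sv m n \<psi> p - 1 / sqrt m)\<^sup>2) = 2 * (1 - (\<Sum>p<m. sv m n \<psi> p) / sqrt m)"
    by (rule sum_sq_dev[OF sq m])
  have "0 \<le> (\<Sum>p<m. (sv m n \<psi> p - 1 / sqrt m)\<^sup>2)" by (intro sum_nonneg) auto
  hence le: "(\<Sum>p<m. sv m n \<psi> p) \<le> sqrt m" using m unfolding dev by (simp add: field_simps)
  have s0: "0 \<le> (\<Sum>p<m. sv m n \<psi> p)" by (intro sum_nonneg) (auto simp: sv_nonneg)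
  have "(\<Sum>p<m. sv m n \<psi> p)\<^sup>2 \<le> (sqrt m)\<^sup>2" by (rule power_mono[OF le s0])
  thus "- ((real m - 1) / 2) \<le> (\<Sum>j\<in>J. ptf m n \<psi> (v j))"
    using ptf_ge_sum[OF unit J] by (simp add: field_simps)
  assume "(\<Sum>j\<in>J. ptf m n \<psi> (v j)) \<le> - ((real m - 1) / 2)" and p: "p < m"
  hence "(sqrt m)\<^sup>2 \<le> (\<Sum>p<m. sv m n \<psi> p)\<^sup>2" using ptf_ge_sum[OF unit J] by (simp add: field_simps)
  hence "sqrt m \<le> (\<Sum>p<m. sv m n \<psi> p)" using s0 by (rule power2_le_imp_le)
  hence "(\<Sum>p<m. (sv m n \<psi> p - 1 / sqrt m)\<^sup>2) = 0"
    using antisym[OF le] m unfolding dev by simp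
  thus "sv m n \<psi> p = 1 / sqrt m" using p by (simp add: sum_nonneg_eq_0_iff)
qed

text \<open>When all eigenvalues coincide, the reduced operator is a multiple of the identity
  whatever the eigenbasis; entrywise, the rows of the coefficient matrix are orthogonal and equally
  long.\<close>

lemma gram_maximally_entangled:
  assumes "\<And>p. p < m \<Longrightarrow> sv m n \<psi> p = 1 / sqrt m" and ik: "i < m" "k < m"
  shows "(\<Sum>j<n. \<psi> (i*n+j) * cnj (\<psi> (k*n+j))) = (if i = k then 1 / of_nat m else 0)"
proof -
  obtain a where a: "ons m {..<m} a"
    and ent: "\<And>i k. i < m \<Longrightarrow> k < m \<Longrightarrow> gram m n \<psi> $$ (i,k) = (\<Sum>p<m. of_real (eigvals (gram m n \<psi>) ! p) * a p i * cnj (a p k))"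
    by (rule gram_spectral[of m n \<psi>]) blast
  have "eigvals (gram m n \<psi>) ! p = 1 / m" if "p < m" for p
    using sv_sq[OF that, of n \<psi>] assms(1)[OF that] by (simp add: power_divide)
  hence "gram m n \<psi> $$ (i,k) = (\<Sum>p<m. of_real (1 / m) * (a p i * cnj (a p k)))"
    using ik by (simp add: ent mult_ac)
  also have "\<dots> = of_real (1 / m) * (if i = k then 1 else 0)"
    unfolding sum_distrib_left[symmetric] using ons_complete[OF a ik] by simp
  finally show ?thesis using ik by (simp add: gram_entry)
qed

text \<open>For Schmidt coefficients \<open>a \<ge> b\<close> the two largest eigenvalues of the
  partial transpose are \<open>a\<^sup>2\<close> and \<open>a * b\<close>. Their sum is greatest on
  the unit circle at the angle pi/8.\<close>

lemma ptf_upper_two: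
  assumes unit: "ip (2*n) \<psi> \<psi> = 1" and J: "finite J" "ons (2*n) J v" "card J = 2"
  shows "(\<Sum>j\<in>J. ptf 2 n \<psi> (v j)) \<le> (1 + sqrt 2) / 2"
proof -
  define a b where ab: "a = sv 2 n \<psi> 0" "b = sv 2 n \<psi> 1"
  obtain \<alpha> \<beta> \<delta> where eq: "(\<Sum>j\<in>J. ptf 2 n \<psi> (v j)) = (\<Sum>p<2. (sv 2 n \<psi> p)\<^sup>2 * \<delta> p)
       + (\<Sum>q<2. \<Sum>p<q. sv 2 n \<psi> p * sv 2 n \<psi> q * (\<beta> p q - \<alpha> p q))"
    and \<alpha>: "\<And>p q. p < q \<Longrightarrow> q < 2 \<Longrightarrow> 0 \<le> \<alpha> p q \<and> \<alpha> p q \<le> 1"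
    and \<beta>: "\<And>p q. p < q \<Longrightarrow> q < 2 \<Longrightarrow> 0 \<le> \<beta> p q \<and> \<beta> p q \<le> 1"
    and \<delta>: "\<And>p. p < 2 \<Longrightarrow> 0 \<le> \<delta> p \<and> \<delta> p \<le> (1::real)"
    and tot: "(\<Sum>p<2. \<delta> p) + (\<Sum>q<2. \<Sum>p<q. \<beta> p q + \<alpha> p q) \<le> real (card J)"
    by (rule ptf_family[OF J(1,2), of \<psi>]) blast
  define x y z w where xyz: "x = \<delta> 0" "y = \<delta> 1" "z = \<beta> 0 1" "w = \<alpha> 0 1"
  have r: "0 \<le> x" "x \<le> 1" "0 \<le> y" "0 \<le> z" "0 \<le> w" "x + y + z + w \<le> 2"
    using \<alpha>[of 0 1] \<beta>[of 0 1] \<delta>[of 0] \<delta>[of 1] tot J(3) by (auto simp: xyz numeral_2_eq_2)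
  have ab0: "0 \<le> b" "b \<le> a" using sv_nonneg[of 1 2 n \<psi>] sv_antimono[of 0 1 2 n \<psi>] by (auto simp: ab)
  have sum: "a\<^sup>2 + b\<^sup>2 = 1" using sum_sv_sq[of 2 n \<psi>] unit by (simp add: ab numeral_2_eq_2)
  have "(\<Sum>j\<in>J. ptf 2 n \<psi> (v j)) = a\<^sup>2 * x + b\<^sup>2 * y + a * b * (z - w)"
    unfolding eq ab xyz by (simp add: numeral_2_eq_2)
  also have "\<dots> \<le> a\<^sup>2 * x + a * b * y + a * b * z"
  proof -
    have "b\<^sup>2 * y \<le> a * b * y" using ab0 r by (intro mult_right_mono) (auto simp: power2_eq_square intro: mult_right_mono)
    moreover have "a * b * (z - w) \<le> a * b * z" using ab0 r by (intro mult_left_mono) auto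
    ultimately show ?thesis by linarith
  qed
  also have "\<dots> = a\<^sup>2 * x + a * b * (y + z)" by (simp add: algebra_simps)
  also have "\<dots> \<le> a\<^sup>2 * x + a * b * (2 - x)" using ab0 r by (intro add_left_mono mult_left_mono) auto
  also have "\<dots> = 2 * (a * b) + (a\<^sup>2 - a * b) * x" by (simp add: algebra_simps)
  also have "\<dots> \<le> 2 * (a * b) + (a\<^sup>2 - a * b) * 1"
    using ab0 r by (intro add_left_mono mult_left_mono) (auto simp: power2_eq_square intro: mult_left_mono)
  finally have "(\<Sum>j\<in>J. ptf 2 n \<psi> (v j)) \<le> a\<^sup>2 + a * b" by simp
  also have "\<dots> \<le> (1 + sqrt 2) / 2"
  proof -
    have r2: "sqrt 2 * (sqrt 2 * x) = 2 * x" for x :: real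
      using real_sqrt_mult_self[of 2] by (simp flip: mult.assoc)
    \<comment> \<open>This vanishes at the maximiser, since sqrt 2 - 1 is the tangent of
      pi/8.\<close>
    have "0 \<le> ((sqrt 2 - 1) * a - b)\<^sup>2" by simp
    also have "\<dots> = (sqrt 2 - 1) * ((1 + sqrt 2) * (a\<^sup>2 + b\<^sup>2) - 2 * (a\<^sup>2 + a * b))"
      by (simp add: power2_eq_square algebra_simps r2)
    finally have "0 \<le> (1 + sqrt 2) * (a\<^sup>2 + b\<^sup>2) - 2 * (a\<^sup>2 + a * b)"
      by (simp add: zero_le_mult_iff)
    thus ?thesis unfolding sum by simp
  qed
  finally show ?thesis .
qed

text \<open>Equality requires \<open>a * b \<ge> 1/2\<close>, and normalisation then makes
  \<open>(a - b)\<^sup>2\<close> plus the squares of the remaining coefficients nonpositive.\<close>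

lemma ptf_eq_neg_half:
  assumes unit: "ip (m*n) \<psi> \<psi> = 1" "ip (m*n) u u = 1" and m: "2 \<le> m" and le: "ptf m n \<psi> u \<le> - (1/2)"
  shows "sv m n \<psi> 0 = sqrt 2 / 2" "sv m n \<psi> 1 = sqrt 2 / 2" "\<And>p. 2 \<le> p \<Longrightarrow> p < m \<Longrightarrow> sv m n \<psi> p = 0"
proof -
  define a b where ab: "a = sv m n \<psi> 0" "b = sv m n \<psi> 1"
  have "- (a * b) \<le> ptf m n \<psi> u"
    using ptf_family1[of "{0::nat}" m n "\<lambda>_. u" \<psi>] unit m by (simp add: ons_def ab)
  hence ab1: "1 / 2 \<le> a * b" using le by simp
  have sq: "a\<^sup>2 + b\<^sup>2 + (\<Sum>p=2..<m. (sv m n \<psi> p)\<^sup>2) = 1"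
  proof -
    have "(\<Sum>p<m. (sv m n \<psi> p)\<^sup>2) = (\<Sum>p<2. (sv m n \<psi> p)\<^sup>2) + (\<Sum>p=2..<m. (sv m n \<psi> p)\<^sup>2)"
      using sum.atLeastLessThan_concat[of 0 2 m "\<lambda>p. (sv m n \<psi> p)\<^sup>2"] m by (simp add: lessThan_atLeast0)
    moreover have "(\<Sum>p<m. (sv m n \<psi> p)\<^sup>2) = 1" using unit by (simp add: sum_sv_sq)
    moreover have "(\<Sum>p<2. (sv m n \<psi> p)\<^sup>2) = a\<^sup>2 + b\<^sup>2" by (simp add: ab numeral_2_eq_2)
    ultimately show ?thesis by linarith
  qed
  have nn: "0 \<le> (\<Sum>p=2..<m. (sv m n \<psi> p)\<^sup>2)" by (intro sum_nonneg) auto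
  have "(a - b)\<^sup>2 + (\<Sum>p=2..<m. (sv m n \<psi> p)\<^sup>2) \<le> 0" using sq ab1 by (simp add: power2_diff)
  hence z: "(a - b)\<^sup>2 = 0" "(\<Sum>p=2..<m. (sv m n \<psi> p)\<^sup>2) = 0" using nn zero_le_power2[of "a - b"] by linarith+
  hence "a = b" by simp
  hence "a\<^sup>2 = 1 / 2" using sq z by simp
  moreover have "0 \<le> a" using m by (simp add: ab sv_nonneg)
  ultimately have "a = sqrt (1 / 2)" by (metis real_sqrt_unique)
  also have "\<dots> = sqrt 2 / 2" by (simp add: real_sqrt_divide real_div_sqrt field_simps)
  finally show "sv m n \<psi> 0 = sqrt 2 / 2" "sv m n \<psi> 1 = sqrt 2 / 2" using \<open>a = b\<close> by (auto simp: ab)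
  show "sv m n \<psi> p = 0" if "2 \<le> p" "p < m" for p
    using z(2) that by (simp add: sum_nonneg_eq_0_iff)
qed

text \<open>The antisymmetric vector of the two leading Schmidt vectors attains the bound.\<close>

lemma ptf_attains_neg_half:
  assumes m: "2 \<le> m" and s: "sv m n \<psi> 0 = sqrt 2 / 2" "sv m n \<psi> 1 = sqrt 2 / 2"
    and z: "\<And>p. 2 \<le> p \<Longrightarrow> p < m \<Longrightarrow> sv m n \<psi> p = 0"
  obtains u where "ip (m*n) u u = 1" "ptf m n \<psi> u = - (1/2)"
proof -
  define N where "N = m * n"
  obtain f where
    orth: "\<And>p q p' q'. p < m \<Longrightarrow> q < m \<Longrightarrow> p' < m \<Longrightarrow> q' < m \<Longrightarrow> (p,q) \<noteq> (p',q') \<Longrightarrow> ip N (f p q) (f p' q') = 0"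
    and n1: "\<And>p q. p < m \<Longrightarrow> q < m \<Longrightarrow> sv m n \<psi> q \<noteq> 0 \<Longrightarrow> ip N (f p q) (f p q) = 1"
    and form: "\<And>u. ptf m n \<psi> u = (\<Sum>p<m. \<Sum>q<m. sv m n \<psi> p * sv m n \<psi> q * Re (cnj (ip N (f p q) u) * ip N (f q p) u))"
    unfolding N_def by (rule schmidt_form[of m n \<psi>]) blast
  define c where "c = complex_of_real (sqrt 2 / 2)"
  have c2: "c * c = 1 / 2" "cnj c = c" by (auto simp: c_def simp flip: of_real_mult)
  define u where "u x = c * (f 0 1 x - f 1 0 x)" for x
  have n: "ip N (f 0 1) (f 0 1) = 1" "ip N (f 1 0) (f 1 0) = 1" "ip N (f 0 1) (f 1 0) = 0" "ip N (f 1 0) (f 0 1) = 0"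
    using m s by (auto intro: n1 orth)
  have "ip N u u = 1" unfolding u_def ip_scale_left ip_scale_right ip_diff_left ip_diff_right n
    using c2(1) by (simp add: c2(2) algebra_simps)
  moreover have fu: "ip N (f p q) u = (if p = 0 \<and> q = 1 then c else if p = 1 \<and> q = 0 then - c else 0)" if "p < m" "q < m" for p q
  proof -
    have "ip N (f p q) u = c * (ip N (f p q) (f 0 1) - ip N (f p q) (f 1 0))"
      by (simp only: u_def[abs_def] ip_scale_right ip_diff_right)
    thus ?thesis using that m orth[of p q 0 1] orth[of p q 1 0] n by auto
  qed
  have "ptf m n \<psi> u = (\<Sum>p<2. \<Sum>q<2. sv m n \<psi> p * sv m n \<psi> q * Re (cnj (ip N (f p q) u) * ip N (f q p) u))"
  proof -
    have "ptf m n \<psi> u = (\<Sum>p<m. \<Sum>q<2. sv m n \<psi> p * sv m n \<psi> q * Re (cnj (ip N (f p q) u) * ip N (f q p) u))"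
      unfolding form using m z by (intro sum.cong refl sum.mono_neutral_right) auto
    also have "\<dots> = (\<Sum>p<2. \<Sum>q<2. sv m n \<psi> p * sv m n \<psi> q * Re (cnj (ip N (f p q) u) * ip N (f q p) u))"
      using m z by (intro sum.mono_neutral_right) auto
    finally show ?thesis .
  qed
  moreover have "(\<Sum>p<2. \<Sum>q<2. sv m n \<psi> p * sv m n \<psi> q * Re (cnj (ip N (f p q) u) * ip N (f q p) u)) = - (1/2)"
    using m by (simp add: numeral_2_eq_2 fu s s(2)[unfolded One_nat_def] c2) (simp add: c_def field_simps)
  ultimately show ?thesis using that[of u] unfolding N_def by simp
qed

section \<open>Decomposable witnesses, Ky Fan sums and negativity\<close>

lemma spectral_qf:
  assumes "hermitian A" "A \<in> carrier_mat N N"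
  obtains u where "ons N {..<N} u"
    "\<And>r c. r < N \<Longrightarrow> c < N \<Longrightarrow> A $$ (r,c) = (\<Sum>i<N. of_real (eigvals A ! i) * u i r * cnj (u i c))"
    "\<And>v. qf N A v = (\<Sum>i<N. eigvals A ! i * (cmod (ip N (u i) v))\<^sup>2)"
    "\<And>i. i < N \<Longrightarrow> qf N A (u i) = eigvals A ! i"
proof -
  obtain u where u: "ons N {..<N} u"
    and ent: "\<And>r c. r < N \<Longrightarrow> c < N \<Longrightarrow> A $$ (r,c) = (\<Sum>i<N. of_real (eigvals A ! i) * u i r * cnj (u i c))"
    using spectral_theorem[OF assms] by blast
  have q: "qf N A v = (\<Sum>i<N. eigvals A ! i * (cmod (ip N (u i) v))\<^sup>2)" for v
    by (rule qf_diag[OF ent])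
  have "qf N A (u i) = eigvals A ! i" if "i < N" for i
  proof -
    have "qf N A (u i) = (\<Sum>j<N. if j = i then eigvals A ! i else 0)"
      unfolding q using that by (intro sum.cong) (auto simp: onsD[OF u])
    thus ?thesis using that by simp
  qed
  thus ?thesis using u ent q that by blast
qed

lemma trace_eigvals:
  assumes "hermitian A" "A \<in> carrier_mat N N"
  shows "trace A = of_real (\<Sum>i<N. eigvals A ! i)"
proof -
  obtain u where u: "ons N {..<N} u"
    and ent: "\<And>r c. r < N \<Longrightarrow> c < N \<Longrightarrow> A $$ (r,c) = (\<Sum>i<N. of_real (eigvals A ! i) * u i r * cnj (u i c))"
    using spectral_theorem[OF assms] by blast
  have "trace A = (\<Sum>r<N. \<Sum>i<N. of_real (eigvals A ! i) * u i r * cnj (u i r))"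
    using assms by (simp add: trace_def ent)
  also have "\<dots> = (\<Sum>i<N. \<Sum>r<N. of_real (eigvals A ! i) * u i r * cnj (u i r))" by (rule sum.swap)
  also have "\<dots> = (\<Sum>i<N. of_real (eigvals A ! i) * ip N (u i) (u i))"
    by (simp add: ip_def sum_distrib_left mult_ac)
  also have "\<dots> = of_real (\<Sum>i<N. eigvals A ! i)" by (simp add: onsD[OF u])
  finally show ?thesis .
qed

section \<open>Positive semidefinite matrices, partial transposition and the witness
  property\<close>

lemma psd_hermitian: "psd A \<Longrightarrow> hermitian A"
  by (simp add: psd_def)

lemma psd_qf_nonneg: "psd A \<Longrightarrow> A \<in> carrier_mat N N \<Longrightarrow> 0 \<le> qf N A u"
  using psd_iff by blast

lemma psd_eigvals_nonneg:
  assumes "psd A" "A \<in> carrier_mat N N" "i < N"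
  shows "0 \<le> eigvals A ! i"
  using psd_qf_nonneg[OF assms(1,2)] spectral_qf[OF psd_hermitian[OF assms(1)] assms(2)] assms(3) by metis

lemma psd_trace_nonneg:
  assumes "psd A" "A \<in> carrier_mat N N"
  shows "0 \<le> Re (trace A)"
  using psd_eigvals_nonneg[OF assms]
  by (auto simp: trace_eigvals[OF psd_hermitian[OF assms(1)] assms(2)] intro!: sum_nonneg)

lemma psd_trace_zero:
  assumes "psd A" "A \<in> carrier_mat N N" "Re (trace A) \<le> 0"
  shows "A = 0\<^sub>m N N"
proof -
  have "(\<Sum>i<N. eigvals A ! i) \<le> 0"
    using assms(3) by (simp add: trace_eigvals[OF psd_hermitian[OF assms(1)] assms(2)])
  hence "(\<Sum>i<N. eigvals A ! i) = 0"
    using psd_eigvals_nonneg[OF assms(1,2)] by (intro antisym sum_nonneg) auto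
  hence z: "eigvals A ! i = 0" if "i < N" for i
    using psd_eigvals_nonneg[OF assms(1,2)] that by (subst (asm) sum_nonneg_eq_0_iff) auto
  obtain u where
    ent: "\<And>r c. r < N \<Longrightarrow> c < N \<Longrightarrow> A $$ (r,c) = (\<Sum>i<N. of_real (eigvals A ! i) * u i r * cnj (u i c))"
    by (rule spectral_theorem[OF psd_hermitian[OF assms(1)] assms(2)]) blast
  show ?thesis using assms(2) by (intro eq_matI) (auto simp: ent z)
qed

lemma qf_add:
  assumes "A \<in> carrier_mat N N" "B \<in> carrier_mat N N"
  shows "qf N (A + B) u = qf N A u + qf N B u"
proof -
  have "(\<Sum>r<N. \<Sum>c<N. cnj (u r) * (A + B) $$ (r,c) * u c)
    = (\<Sum>r<N. \<Sum>c<N. cnj (u r) * A $$ (r,c) * u c) + (\<Sum>r<N. \<Sum>c<N. cnj (u r) * B $$ (r,c) * u c)"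
    unfolding sum.distrib[symmetric] using assms by (intro sum.cong refl) (auto simp: algebra_simps)
  thus ?thesis by (simp add: qf_def)
qed

lemma qf_smult:
  assumes "A \<in> carrier_mat N N"
  shows "qf N (of_real c \<cdot>\<^sub>m A) u = c * qf N A u"
proof -
  have "(\<Sum>r<N. \<Sum>c'<N. cnj (u r) * (of_real c \<cdot>\<^sub>m A) $$ (r,c') * u c')
    = of_real c * (\<Sum>r<N. \<Sum>c'<N. cnj (u r) * A $$ (r,c') * u c')"
    unfolding sum_distrib_left using assms by (intro sum.cong refl) (auto simp: algebra_simps)
  thus ?thesis by (simp only: qf_def Re_of_real_mult)
qed

lemma qf_zero: "qf N (0\<^sub>m N N) u = 0"
  by (simp add: qf_def)

lemma hermitian_add:
  assumes "hermitian A" "hermitian B" "A \<in> carrier_mat N N" "B \<in> carrier_mat N N"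
  shows "hermitian (A + B)"
  unfolding hermitian_iff[OF add_carrier_mat[OF assms(4)]]
proof (intro allI impI)
  fix i j assume "i < N" "j < N"
  thus "(A + B) $$ (j, i) = cnj ((A + B) $$ (i, j))"
    using assms(3,4) hermitianD[OF assms(1,3), of i j] hermitianD[OF assms(2,4), of i j] by simp
qed

lemma hermitian_smult:
  assumes "hermitian A" "A \<in> carrier_mat N N"
  shows "hermitian (of_real c \<cdot>\<^sub>m A)"
  unfolding hermitian_iff[OF smult_carrier_mat[OF assms(2)]]
proof (intro allI impI)
  fix i j assume "i < N" "j < N"
  thus "(of_real c \<cdot>\<^sub>m A) $$ (j, i) = cnj ((of_real c \<cdot>\<^sub>m A) $$ (i, j))"
    using assms(2) hermitianD[OF assms(1,2), of i j] by simp
qed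

lemma psd_smult:
  assumes "psd A" "A \<in> carrier_mat N N" "0 \<le> c"
  shows "psd (of_real c \<cdot>\<^sub>m A)"
proof -
  have "hermitian (of_real c \<cdot>\<^sub>m A)" by (rule hermitian_smult[OF psd_hermitian[OF assms(1)] assms(2)])
  thus ?thesis using assms psd_iff[of "of_real c \<cdot>\<^sub>m A" N] by (auto simp: qf_smult psd_qf_nonneg)
qed

lemma psd_zero: "psd (0\<^sub>m N N)"
  by (subst psd_iff[of _ N]) (auto simp: qf_zero hermitian_iff[of _ N])

lemma proj_carrier [simp]: "v \<in> carrier_vec N \<Longrightarrow> proj v \<in> carrier_mat N N"
  by (simp add: proj_def)

lemma qf_proj:
  assumes "v \<in> carrier_vec N"
  shows "qf N (proj v) u = (cmod (ip N (($) v) u))\<^sup>2"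
proof -
  have "qf N (proj v) u = (\<Sum>i\<in>{0::nat}. 1 * (cmod (ip N (($) v) u))\<^sup>2)"
    by (rule qf_diag) (use assms in \<open>auto simp: proj_def\<close>)
  thus ?thesis by simp
qed

lemma psd_proj:
  assumes "v \<in> carrier_vec N"
  shows "psd (proj v)"
  unfolding psd_iff[OF proj_carrier[OF assms]] hermitian_iff[OF proj_carrier[OF assms]]
proof
  show "\<forall>i<N. \<forall>j<N. proj v $$ (j, i) = cnj (proj v $$ (i, j))" using assms by (simp add: proj_def)
qed (simp add: qf_proj[OF assms])

lemma unit_vec_iff: "unit_vec N v \<longleftrightarrow> v \<in> carrier_vec N \<and> ip N (($) v) (($) v) = 1"
  by (auto simp: unit_vec_def scalar_prod_def ip_def lessThan_atLeast0 mult.commute)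

lemma trace_proj:
  assumes "unit_vec N v"
  shows "trace (proj v) = 1"
  using assms by (auto simp: unit_vec_iff trace_def proj_def ip_def mult.commute)

lemma trace_add: "A \<in> carrier_mat N N \<Longrightarrow> B \<in> carrier_mat N N \<Longrightarrow> trace (A + B) = trace A + trace B"
  by (auto simp: trace_def sum.distrib)

lemma trace_smult: "A \<in> carrier_mat N N \<Longrightarrow> trace (c \<cdot>\<^sub>m A) = c * trace A"
  by (auto simp: trace_def sum_distrib_left)

lemma ptrans_carrier [simp]: "ptrans m n Q \<in> carrier_mat (m*n) (m*n)"
  by (simp add: ptrans_def)

lemma ptrans_index:
  "i < m \<Longrightarrow> j < n \<Longrightarrow> k < m \<Longrightarrow> l < n \<Longrightarrow> ptrans m n Q $$ (i*n+j, k*n+l) = Q $$ (k*n+j, i*n+l)"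
  by (simp add: ptrans_def prod_index_less)

lemma prod_indexE:
  assumes "r < m * (n::nat)"
  obtains i j where "i < m" "j < n" "r = i * n + j"
proof -
  have "0 < n" using assms by (cases n) auto
  hence "r div n < m" "r mod n < n" "r = (r div n) * n + r mod n"
    using assms by (auto simp: less_mult_imp_div_less)
  thus ?thesis using that by blast
qed

lemma ptrans_smult:
  assumes "A \<in> carrier_mat (m*n) (m*n)"
  shows "ptrans m n (c \<cdot>\<^sub>m A) = c \<cdot>\<^sub>m ptrans m n A"
proof (rule eq_matI)
  fix r c' assume "r < dim_row (c \<cdot>\<^sub>m ptrans m n A)" "c' < dim_col (c \<cdot>\<^sub>m ptrans m n A)"
  hence "r < m*n" "c' < m*n" by (auto simp: ptrans_def)
  then obtain i j k l where "i < m" "j < n" "r = i*n+j" "k < m" "l < n" "c' = k*n+l"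
    by (metis prod_indexE)
  thus "ptrans m n (c \<cdot>\<^sub>m A) $$ (r,c') = (c \<cdot>\<^sub>m ptrans m n A) $$ (r,c')"
    using assms ptrans_carrier[of m n A] by (simp add: ptrans_index prod_index_less del: ptrans_carrier)
qed (auto simp: ptrans_def)

lemma hermitian_ptrans:
  assumes h: "hermitian Q" and Q: "Q \<in> carrier_mat (m*n) (m*n)"
  shows "hermitian (ptrans m n Q)"
  unfolding hermitian_iff[OF ptrans_carrier]
proof (intro allI impI)
  fix r c assume "r < m*n" "c < m*n"
  then obtain i j k l where "i < m" "j < n" "r = i*n+j" "k < m" "l < n" "c = k*n+l"
    by (metis prod_indexE)
  thus "ptrans m n Q $$ (c, r) = cnj (ptrans m n Q $$ (r, c))"
    using hermitianD[OF h Q, of "k*n+j" "i*n+l"] by (simp add: ptrans_index prod_index_less)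
qed

lemma trace_ptrans:
  assumes "Q \<in> carrier_mat (m*n) (m*n)"
  shows "trace (ptrans m n Q) = trace Q"
proof -
  have "trace (ptrans m n Q) = (\<Sum>i<m. \<Sum>j<n. ptrans m n Q $$ (i*n+j, i*n+j))"
    using ptrans_carrier[of m n Q] by (simp add: trace_def sum_prod_index del: ptrans_carrier)
  also have "\<dots> = trace Q" using assms by (simp add: trace_def sum_prod_index ptrans_index)
  finally show ?thesis .
qed

text \<open>Partial transposition permutes the entries. With \<open>g\<close> the squared modulus
  this is the invariance of the Hilbert-Schmidt norm.\<close>

lemma sum_ptrans:
  "(\<Sum>r<m*n. \<Sum>c<m*n. g (ptrans m n Q $$ (r,c))) = (\<Sum>r<m*n. \<Sum>c<m*n. g (Q $$ (r,c)))"
proof -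
  have "(\<Sum>r<m*n. \<Sum>c<m*n. g (ptrans m n Q $$ (r,c)))
      = (\<Sum>i<m. \<Sum>j<n. \<Sum>k<m. \<Sum>l<n. g (Q $$ (k*n+j, i*n+l)))"
    by (simp add: sum_prod_index ptrans_index)
  also have "\<dots> = (\<Sum>i<m. \<Sum>k<m. \<Sum>j<n. \<Sum>l<n. g (Q $$ (k*n+j, i*n+l)))"
    by (intro sum.cong refl sum.swap)
  also have "\<dots> = (\<Sum>k<m. \<Sum>i<m. \<Sum>j<n. \<Sum>l<n. g (Q $$ (k*n+j, i*n+l)))"
    by (rule sum.swap)
  also have "\<dots> = (\<Sum>k<m. \<Sum>j<n. \<Sum>i<m. \<Sum>l<n. g (Q $$ (k*n+j, i*n+l)))"
    by (intro sum.cong refl sum.swap)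
  finally show ?thesis by (simp add: sum_prod_index)
qed

text \<open>At a product vector the matrix of row products has rank one, and the form collapses to
  the squared overlap of \<psi> with the tensor product of the conjugate of \<open>a\<close> and
  \<open>b\<close>. This is why partial transposes of positive matrices are block-positive.\<close>

lemma ptf_product:
  assumes v: "\<And>i j. i < m \<Longrightarrow> j < n \<Longrightarrow> v (i*n+j) = a i * b j"
  shows "0 \<le> ptf m n \<psi> v"
proof -
  define \<beta> where "\<beta> i = ip n (\<lambda>l. \<psi> (i*n+l)) b" for i
  have r: "rowip n \<psi> v i k = a k * \<beta> i" if "k < m" for i k
    unfolding rowip_def \<beta>_def ip_scale_right[symmetric] using that v by (intro ip_cong) auto
  have "(\<Sum>i<m. \<Sum>k<m. cnj (rowip n \<psi> v k i) * rowip n \<psi> v i k) = (\<Sum>i<m. \<Sum>k<m. (cnj (a i) * \<beta> i) * cnj (cnj (a k) * \<beta> k))"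
    by (intro sum.cong refl) (simp add: r)
  also have "\<dots> = (\<Sum>i<m. cnj (a i) * \<beta> i) * cnj (\<Sum>i<m. cnj (a i) * \<beta> i)"
    unfolding cnj_sum sum_product ..
  finally show ?thesis unfolding ptf_def cnj_mult_cmod(2) by simp
qed

lemma kron_vec_index:
  assumes "a \<in> carrier_vec m" "b \<in> carrier_vec n" "i < m" "j < n"
  shows "kron_vec a b $ (i*n+j) = a $ i * b $ j"
  using assms prod_index_less[OF assms(3,4)] by (simp add: kron_vec_def)

lemma qf_ptrans_spectral:
  assumes "hermitian Q" and Q: "Q \<in> carrier_mat (m*n) (m*n)"
  obtains \<psi> where "ons (m*n) {..<m*n} \<psi>"
    "\<And>r c. r < m*n \<Longrightarrow> c < m*n \<Longrightarrow> Q $$ (r,c) = (\<Sum>a<m*n. of_real (eigvals Q ! a) * \<psi> a r * cnj (\<psi> a c))"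
    "\<And>u. qf (m*n) (ptrans m n Q) u = (\<Sum>a<m*n. eigvals Q ! a * ptf m n (\<psi> a) u)"
proof -
  obtain \<psi> where "ons (m*n) {..<m*n} \<psi>" and ent:
    "\<And>r c. r < m*n \<Longrightarrow> c < m*n \<Longrightarrow> Q $$ (r,c) = (\<Sum>a<m*n. of_real (eigvals Q ! a) * \<psi> a r * cnj (\<psi> a c))"
    using spectral_theorem[OF assms] by blast
  moreover have "qf (m*n) (ptrans m n Q) u = (\<Sum>a<m*n. eigvals Q ! a * ptf m n (\<psi> a) u)" for u
    by (rule qf_ptrans_sum[OF ent])
  ultimately show ?thesis using that by blast
qed

lemma block_positive_decomposable:
  assumes P: "psd P" "P \<in> carrier_mat (m*n) (m*n)" and Q: "psd Q" "Q \<in> carrier_mat (m*n) (m*n)"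
  shows "block_positive m n (P + ptrans m n Q)"
  unfolding block_positive_def
proof (intro conjI ballI)
  show car: "P + ptrans m n Q \<in> carrier_mat (m*n) (m*n)" by simp
  show "hermitian (P + ptrans m n Q)"
    by (rule hermitian_add[OF psd_hermitian[OF P(1)] hermitian_ptrans[OF psd_hermitian[OF Q(1)] Q(2)] P(2) ptrans_carrier])
  fix a b :: "complex vec" assume ab: "a \<in> carrier_vec m" "b \<in> carrier_vec n"
  obtain \<psi> where q: "\<And>u. qf (m*n) (ptrans m n Q) u = (\<Sum>a<m*n. eigvals Q ! a * ptf m n (\<psi> a) u)"
    by (rule qf_ptrans_spectral[OF psd_hermitian[OF Q(1)] Q(2)]) blast
  have k: "kron_vec a b \<in> carrier_vec (m*n)" using ab by (auto simp: kron_vec_def)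
  have "0 \<le> qf (m*n) P (($) (kron_vec a b)) + qf (m*n) (ptrans m n Q) (($) (kron_vec a b))"
    unfolding q using ab
    by (intro add_nonneg_nonneg psd_qf_nonneg[OF P] sum_nonneg mult_nonneg_nonneg psd_eigvals_nonneg[OF Q]
          ptf_product[where a="($) a" and b="($) b"]) (auto simp: kron_vec_index)
  thus "0 \<le> Re (conjugate (kron_vec a b) \<bullet> ((P + ptrans m n Q) *\<^sub>v kron_vec a b))"
    unfolding Re_scalar_prod_qf[OF car k] qf_add[OF P(2) ptrans_carrier] .
qed

lemma eigenvalue_eigvals:
  assumes "hermitian A" "A \<in> carrier_mat N N" "i < N"
  shows "eigenvalue A (of_real (eigvals A ! i))"
proof -
  obtain u where u: "ons N {..<N} u"
    and ent: "\<And>r c. r < N \<Longrightarrow> c < N \<Longrightarrow> A $$ (r,c) = (\<Sum>i<N. of_real (eigvals A ! i) * u i r * cnj (u i c))"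
    using spectral_theorem[OF assms(1,2)] by blast
  have "poly (char_poly A) (of_real (eigvals A ! i)) = 0"
    using proots_char_poly_diag(1)[OF u assms(2) ent] assms(3) by (auto simp: poly_prod_list prod_list_zero_iff o_def)
  thus ?thesis using eigenvalue_root_char_poly[OF assms(2)] by simp
qed

lemma eigenvalue_in_eigvals:
  assumes A: "A \<in> carrier_mat N N" and e: "eigenvalue A (of_real l)"
  shows "l \<in> set (eigvals A)"
proof -
  have "poly (char_poly A) (of_real l) = 0" using e eigenvalue_root_char_poly[OF A] by simp
  moreover have "char_poly A \<noteq> 0" using degree_monic_char_poly[OF A] by auto
  ultimately have "of_real l \<in># proots (char_poly A)" by simp
  hence "Re (of_real l) \<in># mset (eigvals A)" unfolding mset_eigvals by (metis imageI set_image_mset)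
  thus ?thesis by simp
qed

lemma last_eigval_le:
  assumes "A \<in> carrier_mat N N" "i < N"
  shows "eigvals A ! (N - 1) \<le> eigvals A ! i"
  using assms by (intro eigvals_antimono) (auto simp: length_eigvals)

text \<open>One vector of negative expectation suffices: if all eigenvalues were nonnegative, the
  spectral form of the expectation would be a sum of nonnegative terms.\<close>

lemma DEWs_intro:
  assumes P: "psd P" "P \<in> carrier_mat (m*n) (m*n)" and Q: "psd Q" "Q \<in> carrier_mat (m*n) (m*n)"
    and tr: "trace P + trace Q = 1" and neg: "qf (m*n) (P + ptrans m n Q) v < 0"
  shows "P + ptrans m n Q \<in> DEWs m n"
proof -
  define W where "W = P + ptrans m n Q"
  have bp: "block_positive m n W" unfolding W_def by (rule block_positive_decomposable[OF P Q])
  hence W: "hermitian W" "W \<in> carrier_mat (m*n) (m*n)" by (auto simp: block_positive_def)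
  obtain u where q: "qf (m*n) W v = (\<Sum>i<m*n. eigvals W ! i * (cmod (ip (m*n) (u i) v))\<^sup>2)"
    by (rule spectral_qf[OF W]) blast
  have "\<exists>i<m*n. eigvals W ! i < 0"
  proof (rule ccontr)
    assume "\<not> ?thesis"
    hence "0 \<le> eigvals W ! i" if "i < m*n" for i using that by (meson not_less)
    hence "0 \<le> qf (m*n) W v" unfolding q by (intro sum_nonneg mult_nonneg_nonneg) auto
    thus False using neg by (simp add: W_def)
  qed
  then obtain i where "i < m*n" "eigvals W ! i < 0" by blast
  hence "\<exists>l::real. eigenvalue W (of_real l) \<and> l < 0" using eigenvalue_eigvals[OF W] by blast
  moreover have "trace W = 1" using tr P Q by (simp add: W_def trace_add[of _ "m*n"] trace_ptrans)
  ultimately show ?thesis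
    unfolding DEWs_def decomposable_EW_def entanglement_witness_def using bp P Q W_def by blast
qed

lemma DEWsE:
  assumes "W \<in> DEWs m n"
  obtains P Q where "psd P" "P \<in> carrier_mat (m*n) (m*n)" "psd Q" "Q \<in> carrier_mat (m*n) (m*n)"
    "W = P + ptrans m n Q" "hermitian W" "W \<in> carrier_mat (m*n) (m*n)" "trace W = 1"
    "Re (trace P) + Re (trace Q) = 1" "eigvals W ! (m*n-1) < 0" "0 < m*n"
proof -
  obtain P Q where PQ: "psd P" "P \<in> carrier_mat (m*n) (m*n)" "psd Q" "Q \<in> carrier_mat (m*n) (m*n)"
    "W = P + ptrans m n Q"
    using assms unfolding DEWs_def decomposable_EW_def by blast
  have W: "hermitian W" "W \<in> carrier_mat (m*n) (m*n)" "trace W = 1"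
    using assms unfolding DEWs_def decomposable_EW_def entanglement_witness_def block_positive_def by auto
  obtain l :: real where l: "eigenvalue W (of_real l)" "l < 0"
    using assms unfolding DEWs_def decomposable_EW_def entanglement_witness_def by blast
  obtain i where i: "i < m*n" "eigvals W ! i = l"
    using eigenvalue_in_eigvals[OF W(2) l(1)] length_eigvals[OF W(2)] by (auto simp: in_set_conv_nth)
  have "eigvals W ! (m*n-1) < 0" using last_eigval_le[OF W(2) i(1)] i l by simp
  moreover have "Re (trace P) + Re (trace Q) = 1"
    using W(3) PQ by (simp add: trace_add[of _ "m*n"] trace_ptrans flip: plus_complex.simps)
  moreover have "0 < m*n" using i(1) by linarith
  ultimately show ?thesis using that[OF PQ W] by blast
qed

text \<open>Ky Fan's principle: the \<open>w i\<close> below are the diagonal entries, in an eigenbasis, of the projection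
  onto an orthonormal family.\<close>

lemma weighted_sum_le:
  fixes d w :: "nat \<Rightarrow> real"
  assumes I: "I \<subseteq> {..<N}" and w: "\<And>i. i < N \<Longrightarrow> 0 \<le> w i \<and> w i \<le> 1" and sum: "(\<Sum>i<N. w i) = card I"
    and ge: "\<And>i. i \<in> I \<Longrightarrow> t \<le> d i" and le: "\<And>i. i < N \<Longrightarrow> i \<notin> I \<Longrightarrow> d i \<le> t"
  shows "(\<Sum>i<N. d i * w i) \<le> (\<Sum>i\<in>I. d i)"
proof -
  have "(\<Sum>i<N. (d i - t) * w i) \<le> (\<Sum>i<N. if i \<in> I then d i - t else 0)"
  proof (rule sum_mono)
    fix i assume "i \<in> {..<N}"
    hence i: "i < N" by simp
    show "(d i - t) * w i \<le> (if i \<in> I then d i - t else 0)"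
    proof (cases "i \<in> I")
      case True
      thus ?thesis using mult_left_mono[of "w i" 1 "d i - t"] w[OF i] ge by simp
    next
      case False
      thus ?thesis using w[OF i] le[OF i] by (simp add: mult_nonpos_nonneg)
    qed
  qed
  also have "\<dots> = (\<Sum>i\<in>I. d i - t)" using I by (simp add: sum.If_cases Int_absorb1)
  finally have "(\<Sum>i<N. d i * w i) - t * (\<Sum>i<N. w i) \<le> (\<Sum>i\<in>I. d i) - t * card I"
    by (simp add: algebra_simps sum_subtractf sum_distrib_left)
  thus ?thesis by (simp add: sum)
qed

lemma family_weights:
  assumes u: "ons N {..<N} u" and J: "finite J" "ons N J v"
  defines "w \<equiv> \<lambda>i. \<Sum>j\<in>J. (cmod (ip N (u i) (v j)))\<^sup>2"
  shows "i < N \<Longrightarrow> 0 \<le> w i \<and> w i \<le> 1" "(\<Sum>i<N. w i) = card J"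
proof -
  show "0 \<le> w i \<and> w i \<le> 1" if "i < N"
    using bessel_family[OF J, of "u i"] onsD[OF u, of i i] that by (simp add: w_def sum_nonneg)
  have "(\<Sum>i<N. w i) = (\<Sum>j\<in>J. \<Sum>i<N. (cmod (ip N (u i) (v j)))\<^sup>2)"
    unfolding w_def by (rule sum.swap)
  also have "\<dots> = (\<Sum>j\<in>J. 1)" by (intro sum.cong refl) (simp add: parseval[OF u] onsD[OF J(2)])
  finally show "(\<Sum>i<N. w i) = card J" by simp
qed

lemma sum_qf_weights:
  assumes "\<And>v. qf N A v = (\<Sum>i<N. d i * (cmod (ip N (u i) v))\<^sup>2)"
  shows "(\<Sum>j\<in>J. qf N A (v j)) = (\<Sum>i<N. d i * (\<Sum>j\<in>J. (cmod (ip N (u i) (v j)))\<^sup>2))"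
  unfolding assms sum_distrib_left by (rule sum.swap)

lemma ky_fan_upper:
  assumes A: "hermitian A" "A \<in> carrier_mat N N" and J: "finite J" "ons N J v" and k: "card J = k" "1 \<le> k" "k \<le> N"
  shows "(\<Sum>j\<in>J. qf N A (v j)) \<le> (\<Sum>i<k. eigvals A ! i)"
proof -
  obtain u where u: "ons N {..<N} u" and q: "\<And>v. qf N A v = (\<Sum>i<N. eigvals A ! i * (cmod (ip N (u i) v))\<^sup>2)"
    by (rule spectral_qf[OF A]) blast
  show ?thesis unfolding sum_qf_weights[OF q]
  proof (rule weighted_sum_le)
    show "{..<k} \<subseteq> {..<N}" using k by auto
    show "(\<Sum>i<N. \<Sum>j\<in>J. (cmod (ip N (u i) (v j)))\<^sup>2) = card {..<k}" using family_weights(2)[OF u J] k by simp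
    \<comment> \<open>The threshold separating the chosen indices from the others is the k-th
      largest eigenvalue, at list position \<open>k - 1\<close>.\<close>
    show "eigvals A ! (k - 1) \<le> eigvals A ! i" if "i \<in> {..<k}" for i
      using that k by (intro eigvals_antimono) (auto simp: length_eigvals[OF A(2)])
    show "eigvals A ! i \<le> eigvals A ! (k - 1)" if "i < N" "i \<notin> {..<k}" for i
      using that k by (intro eigvals_antimono) (auto simp: length_eigvals[OF A(2)])
  qed (rule family_weights(1)[OF u J])
qed

lemma ky_fan_lower:
  assumes A: "hermitian A" "A \<in> carrier_mat N N" and J: "finite J" "ons N J v" and k: "card J = k" "1 \<le> k" "k \<le> N"
  shows "(\<Sum>i=N-k..<N. eigvals A ! i) \<le> (\<Sum>j\<in>J. qf N A (v j))"
proof -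
  obtain u where u: "ons N {..<N} u" and q: "\<And>v. qf N A v = (\<Sum>i<N. eigvals A ! i * (cmod (ip N (u i) v))\<^sup>2)"
    by (rule spectral_qf[OF A]) blast
  \<comment> \<open>The lower bound is the upper one for the negated eigenvalues, with the last
    \<open>k\<close> indices selected and position \<open>N - k\<close> as threshold.\<close>
  have "(\<Sum>i<N. - eigvals A ! i * (\<Sum>j\<in>J. (cmod (ip N (u i) (v j)))\<^sup>2)) \<le> (\<Sum>i=N-k..<N. - eigvals A ! i)"
  proof (rule weighted_sum_le)
    show "(\<Sum>i<N. \<Sum>j\<in>J. (cmod (ip N (u i) (v j)))\<^sup>2) = card {N-k..<N}" using family_weights(2)[OF u J] k by simp
    show "- eigvals A ! (N - k) \<le> - eigvals A ! i" if "i \<in> {N-k..<N}" for i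
      using that k eigvals_antimono[of "N-k" i A] by (auto simp: length_eigvals[OF A(2)])
    show "- eigvals A ! i \<le> - eigvals A ! (N - k)" if "i < N" "i \<notin> {N-k..<N}" for i
      using that k eigvals_antimono[of i "N-k" A] by (auto simp: length_eigvals[OF A(2)])
  qed (auto simp: family_weights(1)[OF u J])
  thus ?thesis unfolding sum_qf_weights[OF q] by (simp add: sum_negf)
qed

text \<open>Two expressions for the Hilbert-Schmidt norm: the entrywise one is suited to partial
  transposition and to sums of matrices, the spectral one to estimates for eigenvalues.\<close>

lemma sum_sq_entries:
  assumes "hermitian A" "A \<in> carrier_mat N N"
  shows "Re (trace (A * A)) = (\<Sum>r<N. \<Sum>c<N. (cmod (A $$ (r,c)))\<^sup>2)"
    and "Re (trace (A * A)) = (\<Sum>i<N. (eigvals A ! i)\<^sup>2)"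
proof -
  have AA: "(A * A) $$ (r,c) = (\<Sum>k<N. A $$ (r,k) * A $$ (k,c))" if "r < N" "c < N" for r c
    using assms that by (simp add: scalar_prod_def lessThan_atLeast0)
  have dAA: "dim_row (A * A) = N" using assms by simp
  have "trace (A * A) = (\<Sum>r<N. \<Sum>c<N. A $$ (r,c) * A $$ (c,r))"
    by (simp add: trace_def AA dAA del: index_mult_mat)
  also have "\<dots> = (\<Sum>r<N. \<Sum>c<N. of_real ((cmod (A $$ (r,c)))\<^sup>2))"
    by (intro sum.cong refl) (metis assms cnj_mult_cmod(2) hermitianD lessThan_iff)
  finally show "Re (trace (A * A)) = (\<Sum>r<N. \<Sum>c<N. (cmod (A $$ (r,c)))\<^sup>2)" by simp
  obtain u where u: "ons N {..<N} u"
    and ent: "\<And>r c. r < N \<Longrightarrow> c < N \<Longrightarrow> A $$ (r,c) = (\<Sum>i<N. of_real (eigvals A ! i) * u i r * cnj (u i c))"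
    using spectral_theorem[OF assms] by blast
  have "trace (A * A) = (\<Sum>r<N. \<Sum>c<N. A $$ (r,c) * A $$ (c,r))"
    by (simp add: trace_def AA dAA del: index_mult_mat)
  also have "\<dots> = (\<Sum>r<N. \<Sum>c<N. \<Sum>i<N. of_real (eigvals A ! i) * (cnj (u i c) * A $$ (c,r) * u i r))"
  proof (intro sum.cong refl)
    fix r c assume "r \<in> {..<N}" "c \<in> {..<N}"
    hence "A $$ (r,c) = (\<Sum>i<N. of_real (eigvals A ! i) * u i r * cnj (u i c))" using ent by simp
    thus "A $$ (r,c) * A $$ (c,r) = (\<Sum>i<N. of_real (eigvals A ! i) * (cnj (u i c) * A $$ (c,r) * u i r))"
      by (simp add: sum_distrib_left sum_distrib_right mult_ac)
  qed
  also have "\<dots> = (\<Sum>i<N. \<Sum>r<N. \<Sum>c<N. of_real (eigvals A ! i) * (cnj (u i c) * A $$ (c,r) * u i r))"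
    by (rule sum_swap3[symmetric])
  also have "\<dots> = (\<Sum>i<N. of_real (eigvals A ! i) * (\<Sum>c<N. \<Sum>r<N. cnj (u i c) * A $$ (c,r) * u i r))"
    unfolding sum_distrib_left by (intro sum.cong refl sum.swap)
  finally have "Re (trace (A * A)) = (\<Sum>i<N. eigvals A ! i * qf N A (u i))"
    unfolding qf_def by (simp only: Re_sum Re_of_real_mult)
  also have "\<dots> = (\<Sum>i<N. eigvals A ! i * eigvals A ! i)"
  proof (intro sum.cong refl)
    fix i assume i: "i \<in> {..<N}"
    have "qf N A (u i) = (\<Sum>j<N. eigvals A ! j * (cmod (ip N (u j) (u i)))\<^sup>2)" by (rule qf_diag[OF ent])
    also have "\<dots> = (\<Sum>j<N. if j = i then eigvals A ! i else 0)"
      using i by (intro sum.cong) (auto simp: onsD[OF u])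
    finally show "eigvals A ! i * qf N A (u i) = eigvals A ! i * eigvals A ! i" using i by simp
  qed
  finally show "Re (trace (A * A)) = (\<Sum>i<N. (eigvals A ! i)\<^sup>2)" by (simp add: power2_eq_square)
qed

text \<open>For a Hermitian matrix the trace norm is computed from the square of the matrix, which
  is diagonal in the same basis with squared eigenvalues.\<close>

lemma trace_norm_eigvals:
  assumes "hermitian A" "A \<in> carrier_mat N N"
  shows "trace_norm A = (\<Sum>i<N. \<bar>eigvals A ! i\<bar>)"
proof -
  obtain u where u: "ons N {..<N} u"
    and ent: "\<And>r c. r < N \<Longrightarrow> c < N \<Longrightarrow> A $$ (r,c) = (\<Sum>i<N. of_real (eigvals A ! i) * u i r * cnj (u i c))"
    using spectral_theorem[OF assms] by blast
  have ad: "mat_adjoint A = A" using assms(1) by (simp add: hermitian_def)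
  have mAu: "(\<Sum>k<N. A $$ (r,k) * u i k) = of_real (eigvals A ! i) * u i r" if "r < N" "i < N" for r i
  proof -
    have "(\<Sum>k<N. A $$ (r,k) * u i k) = (\<Sum>k<N. \<Sum>j<N. of_real (eigvals A ! j) * u j r * (cnj (u j k) * u i k))"
      using that by (intro sum.cong refl) (simp add: ent sum_distrib_left sum_distrib_right mult_ac)
    also have "\<dots> = (\<Sum>j<N. \<Sum>k<N. of_real (eigvals A ! j) * u j r * (cnj (u j k) * u i k))" by (rule sum.swap)
    also have "\<dots> = (\<Sum>j<N. of_real (eigvals A ! j) * u j r * ip N (u j) (u i))"
      by (simp add: ip_def sum_distrib_left)
    also have "\<dots> = (\<Sum>j<N. if j = i then of_real (eigvals A ! i) * u i r else 0)"
      using that by (intro sum.cong) (auto simp: onsD[OF u])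
    finally show ?thesis using that by simp
  qed
  have "mset (eigvals (A * A)) = mset (map (\<lambda>i. (eigvals A ! i)\<^sup>2) [0..<N])"
  proof (rule mset_eigvals_diag[OF u])
    show "A * A \<in> carrier_mat N N" using assms by simp
    fix r c assume rc: "r < N" "c < N"
    have "(A * A) $$ (r,c) = (\<Sum>k<N. A $$ (r,k) * A $$ (k,c))"
      using assms rc by (simp add: scalar_prod_def lessThan_atLeast0)
    also have "\<dots> = (\<Sum>k<N. \<Sum>i<N. A $$ (r,k) * u i k * (of_real (eigvals A ! i) * cnj (u i c)))"
      using rc by (intro sum.cong refl) (simp add: ent[of _ c] sum_distrib_left mult_ac)
    also have "\<dots> = (\<Sum>i<N. (\<Sum>k<N. A $$ (r,k) * u i k) * (of_real (eigvals A ! i) * cnj (u i c)))"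
      unfolding sum_distrib_right by (rule sum.swap)
    also have "\<dots> = (\<Sum>i<N. of_real ((eigvals A ! i)\<^sup>2) * u i r * cnj (u i c))"
    proof (intro sum.cong refl)
      fix i assume "i \<in> {..<N}"
      thus "(\<Sum>k<N. A $$ (r,k) * u i k) * (of_real (eigvals A ! i) * cnj (u i c))
          = of_real ((eigvals A ! i)\<^sup>2) * u i r * cnj (u i c)"
        using mAu[OF rc(1), of i] by (simp only: lessThan_iff power2_eq_square of_real_mult mult_ac)
    qed
    finally show "(A * A) $$ (r,c) = (\<Sum>i<N. of_real ((eigvals A ! i)\<^sup>2) * u i r * cnj (u i c))" .
  qed
  hence "mset (map sqrt (eigvals (A * A))) = mset (map (\<lambda>i. \<bar>eigvals A ! i\<bar>) [0..<N])"
    unfolding mset_map by (simp add: multiset.map_comp o_def)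
  hence "sum_list (map sqrt (eigvals (A * A))) = sum_list (map (\<lambda>i. \<bar>eigvals A ! i\<bar>) [0..<N])"
    by (metis sum_mset_sum_list)
  thus ?thesis unfolding trace_norm_def ad by (simp add: sum_list_sum_nth lessThan_atLeast0)
qed

lemma negativity_eigvals:
  assumes "hermitian A" "A \<in> carrier_mat N N" "trace A = 1"
  shows "negativity A = - (\<Sum>i | i < N \<and> eigvals A ! i < 0. eigvals A ! i)"
proof -
  have s: "(\<Sum>i<N. eigvals A ! i) = 1" using trace_eigvals[OF assms(1,2)] assms(3) by (metis of_real_eq_1_iff)
  have "(\<Sum>i<N. \<bar>eigvals A ! i\<bar>) = (\<Sum>i<N. eigvals A ! i - 2 * (if eigvals A ! i < 0 then eigvals A ! i else 0))"
    by (intro sum.cong) auto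
  also have "\<dots> = 1 - 2 * (\<Sum>i<N. if eigvals A ! i < 0 then eigvals A ! i else 0)"
    by (simp add: sum_subtractf s sum_distrib_left)
  also have "(\<Sum>i<N. if eigvals A ! i < 0 then eigvals A ! i else 0) = (\<Sum>i | i < N \<and> eigvals A ! i < 0. eigvals A ! i)"
    by (simp add: sum.If_cases Collect_conj_eq lessThan_def)
  finally show ?thesis by (simp add: negativity_def trace_norm_eigvals[OF assms(1,2)])
qed

text \<open>The weights of an orthonormal family lie between 0 and 1, so its total expectation is
  lowest when exactly the negative eigenvalues are selected. Any family is therefore a witness for a
  lower bound on the negativity.\<close>

lemma negativity_ge:
  assumes A: "hermitian A" "A \<in> carrier_mat N N" "trace A = 1" and J: "finite J" "ons N J v"
  shows "- (\<Sum>j\<in>J. qf N A (v j)) \<le> negativity A"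
proof -
  obtain u where u: "ons N {..<N} u" and q: "\<And>v. qf N A v = (\<Sum>i<N. eigvals A ! i * (cmod (ip N (u i) v))\<^sup>2)"
    by (rule spectral_qf[OF A(1,2)]) blast
  have "(\<Sum>i | i < N \<and> eigvals A ! i < 0. eigvals A ! i) = (\<Sum>i<N. if eigvals A ! i < 0 then eigvals A ! i else 0)"
    by (simp add: sum.If_cases Collect_conj_eq lessThan_def)
  also have "\<dots> \<le> (\<Sum>i<N. eigvals A ! i * (\<Sum>j\<in>J. (cmod (ip N (u i) (v j)))\<^sup>2))"
  proof (rule sum_mono)
    fix i assume "i \<in> {..<N}"
    hence w: "0 \<le> (\<Sum>j\<in>J. (cmod (ip N (u i) (v j)))\<^sup>2)" "(\<Sum>j\<in>J. (cmod (ip N (u i) (v j)))\<^sup>2) \<le> 1"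
      using family_weights(1)[OF u J] by auto
    show "(if eigvals A ! i < 0 then eigvals A ! i else 0) \<le> eigvals A ! i * (\<Sum>j\<in>J. (cmod (ip N (u i) (v j)))\<^sup>2)"
      using w mult_left_mono_neg[OF w(2), of "eigvals A ! i"] by auto
  qed
  also have "\<dots> = (\<Sum>j\<in>J. qf N A (v j))" by (rule sum_qf_weights[OF q, symmetric])
  finally show ?thesis unfolding negativity_eigvals[OF A] by simp
qed

section \<open>Trial vectors and mixed examples\<close>

text \<open>\<open>P\<close> contributes nonnegatively, and the partial transpose of
  \<open>Q\<close> is a combination of pure ones with total weight \<open>tr Q\<close>. The factor
  \<open>tr Q\<close> is kept because the mixed examples need the exact value.\<close>

lemma decomposable_family_lower:
  assumes P: "psd P" "P \<in> carrier_mat (m*n) (m*n)" and Q: "psd Q" "Q \<in> carrier_mat (m*n) (m*n)"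
    and c: "\<And>\<psi>. ip (m*n) \<psi> \<psi> = 1 \<Longrightarrow> - c \<le> (\<Sum>j\<in>J. ptf m n \<psi> (v j))"
  shows "- (c * Re (trace Q)) \<le> (\<Sum>j\<in>J. qf (m*n) (P + ptrans m n Q) (v j))"
proof -
  obtain \<psi> where o: "ons (m*n) {..<m*n} \<psi>"
    and q: "\<And>u. qf (m*n) (ptrans m n Q) u = (\<Sum>a<m*n. eigvals Q ! a * ptf m n (\<psi> a) u)"
    by (rule qf_ptrans_spectral[OF psd_hermitian[OF Q(1)] Q(2)]) blast
  have "- (c * Re (trace Q)) = (\<Sum>a<m*n. eigvals Q ! a * (- c))"
    by (simp add: trace_eigvals[OF psd_hermitian[OF Q(1)] Q(2)] sum_distrib_left mult.commute sum_negf)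
  also have "\<dots> \<le> (\<Sum>a<m*n. eigvals Q ! a * (\<Sum>j\<in>J. ptf m n (\<psi> a) (v j)))"
    using c onsD[OF o] by (intro sum_mono mult_left_mono psd_eigvals_nonneg[OF Q]) auto
  also have "\<dots> = (\<Sum>j\<in>J. qf (m*n) (ptrans m n Q) (v j))"
    unfolding q sum_distrib_left by (rule sum.swap)
  also have "\<dots> \<le> (\<Sum>j\<in>J. qf (m*n) (P + ptrans m n Q) (v j))"
    by (intro sum_mono) (simp add: qf_add[OF P(2) ptrans_carrier] psd_qf_nonneg[OF P])
  finally show ?thesis .
qed

lemma decomposable_eigvals_lower:
  assumes P: "psd P" "P \<in> carrier_mat (m*n) (m*n)" and Q: "psd Q" "Q \<in> carrier_mat (m*n) (m*n)"
    and I: "I \<subseteq> {..<m*n}"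
    and c: "\<And>\<psi> v. ip (m*n) \<psi> \<psi> = 1 \<Longrightarrow> ons (m*n) I v \<Longrightarrow> - c \<le> (\<Sum>i\<in>I. ptf m n \<psi> (v i))"
  shows "- (c * Re (trace Q)) \<le> (\<Sum>i\<in>I. eigvals (P + ptrans m n Q) ! i)"
proof -
  define W where "W = P + ptrans m n Q"
  have W: "hermitian W" "W \<in> carrier_mat (m*n) (m*n)"
    using block_positive_decomposable[OF P Q] by (auto simp: W_def block_positive_def)
  obtain u where u: "ons (m*n) {..<m*n} u" and e: "\<And>i. i < m*n \<Longrightarrow> qf (m*n) W (u i) = eigvals W ! i"
    by (rule spectral_qf[OF W]) blast
  have "- (c * Re (trace Q)) \<le> (\<Sum>i\<in>I. qf (m*n) W (u i))"
    unfolding W_def by (rule decomposable_family_lower[OF P Q c]) (use ons_subset[OF u I] in auto)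
  also have "\<dots> = (\<Sum>i\<in>I. eigvals W ! i)" using e I by (intro sum.cong) auto
  finally show ?thesis by (simp add: W_def)
qed

lemma DEWs_eigvals_lower:
  assumes W: "W \<in> DEWs m n" and I: "I \<subseteq> {..<m*n}" and c0: "0 \<le> c"
    and c: "\<And>\<psi> v. ip (m*n) \<psi> \<psi> = 1 \<Longrightarrow> ons (m*n) I v \<Longrightarrow> - c \<le> (\<Sum>i\<in>I. ptf m n \<psi> (v i))"
  shows "- c \<le> (\<Sum>i\<in>I. eigvals W ! i)"
proof -
  obtain P Q where P: "psd P" "P \<in> carrier_mat (m*n) (m*n)" and Q: "psd Q" "Q \<in> carrier_mat (m*n) (m*n)"
    and WPQ: "W = P + ptrans m n Q" and tr: "Re (trace P) + Re (trace Q) = 1"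
    by (rule DEWsE[OF W]) blast
  have "c * Re (trace Q) \<le> c * 1" using tr psd_trace_nonneg[OF P] by (intro mult_left_mono c0) auto
  thus ?thesis using decomposable_eigvals_lower[OF P Q I c] by (simp add: WPQ)
qed

lemma sum_qf_le_trace:
  assumes P: "psd P" "P \<in> carrier_mat N N" and J: "finite J" "ons N J v"
  shows "(\<Sum>j\<in>J. qf N P (v j)) \<le> Re (trace P)"
proof -
  obtain u where u: "ons N {..<N} u" and q: "\<And>v. qf N P v = (\<Sum>i<N. eigvals P ! i * (cmod (ip N (u i) v))\<^sup>2)"
    by (rule spectral_qf[OF psd_hermitian[OF P(1)] P(2)]) blast
  have "(\<Sum>j\<in>J. qf N P (v j)) \<le> (\<Sum>i<N. eigvals P ! i * 1)"
    unfolding sum_qf_weights[OF q] using family_weights(1)[OF u J]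
    by (intro sum_mono mult_left_mono psd_eigvals_nonneg[OF P]) auto
  thus ?thesis by (simp add: trace_eigvals[OF psd_hermitian[OF P(1)] P(2)])
qed

section \<open>Vectors in Schmidt form and their antisymmetric trial vectors\<close>

definition ket :: "nat \<Rightarrow> nat \<Rightarrow> complex" where
  "ket r x = (if x = r then 1 else 0)"

lemma ip_ket: "r < N \<Longrightarrow> ip N (ket r) g = g r"
  by (simp add: ip_def ket_def if_distrib[of cnj] if_distrib[of "\<lambda>x. x * _"] cong: if_cong)

lemma index_eq_iff: "j < n \<Longrightarrow> l < n \<Longrightarrow> i * n + j = k * n + l \<longleftrightarrow> i = k \<and> j = (l::nat)"
proof
  assume jl: "j < n" "l < n" and eq: "i * n + j = k * n + l"
  have "(i * n + j) div n = i" "(i * n + j) mod n = j" "(k * n + l) div n = k" "(k * n + l) mod n = l"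
    using jl by simp_all
  thus "i = k \<and> j = l" using eq by metis
qed simp

text \<open>The vector with coefficients \<open>x i\<close> at |i> (x) |i + c>. For nonnegative
  \<open>x\<close> and \<open>m + c \<le> n\<close> it is in Schmidt form; the shift
  \<open>c\<close> is 0 in the examples and \<open>(j-1)*m\<close> for
  \<open>Phi m n j\<close>.\<close>

definition dvec :: "nat \<Rightarrow> nat \<Rightarrow> nat \<Rightarrow> (nat \<Rightarrow> real) \<Rightarrow> complex vec" where
  "dvec m n c x = vec (m*n) (\<lambda>r. if r mod n = r div n + c then of_real (x (r div n)) else 0)"

lemma dvec_carrier [simp]: "dvec m n c x \<in> carrier_vec (m*n)"
  by (simp add: dvec_def)

lemma dvec_index: "i < m \<Longrightarrow> j < n \<Longrightarrow> dvec m n c x $ (i*n+j) = (if j = i + c then of_real (x i) else 0)"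
  by (simp add: dvec_def prod_index_less)

lemma ip_dvec:
  assumes "m + c \<le> n" 
  shows "ip (m*n) (($) (dvec m n c x)) (($) (dvec m n c x)) = of_real (\<Sum>i<m. (x i)\<^sup>2)"
proof -
  have "ip n (\<lambda>j. dvec m n c x $ (i*n+j)) (\<lambda>j. dvec m n c x $ (i*n+j)) = of_real ((x i)\<^sup>2)" if "i < m" for i
  proof -
    have "ip n (\<lambda>j. dvec m n c x $ (i*n+j)) (\<lambda>j. dvec m n c x $ (i*n+j))
        = (\<Sum>j<n. if j = i + c then of_real ((x i)\<^sup>2) else 0)"
      unfolding ip_def using that by (intro sum.cong) (auto simp: dvec_index power2_eq_square)
    thus ?thesis using that assms by simp
  qed
  thus ?thesis by (simp add: ip_prod_index)
qed

lemma unit_dvec: "m + c \<le> n \<Longrightarrow> (\<Sum>i<m. (x i)\<^sup>2) = 1 \<Longrightarrow> unit_vec (m*n) (dvec m n c x)"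
  by (simp add: unit_vec_iff ip_dvec)

lemma ptf_dvec:
  assumes "m + c \<le> n"
  shows "ptf m n (($) (dvec m n c x)) u = (\<Sum>i<m. \<Sum>k<m. x i * x k * Re (cnj (u (i*n+(k+c))) * u (k*n+(i+c))))"
proof -
  have r: "rowip n (($) (dvec m n c x)) u i k = of_real (x i) * u (k*n+(i+c))" if "i < m" for i k
  proof -
    have "rowip n (($) (dvec m n c x)) u i k = (\<Sum>j<n. if j = i + c then of_real (x i) * u (k*n+(i+c)) else 0)"
      unfolding rowip_def ip_def using that by (intro sum.cong) (auto simp: dvec_index)
    thus ?thesis using that assms by simp
  qed
  have "(\<Sum>i<m. \<Sum>k<m. cnj (rowip n (($) (dvec m n c x)) u k i) * rowip n (($) (dvec m n c x)) u i k)
    = (\<Sum>i<m. \<Sum>k<m. of_real (x i * x k) * (cnj (u (i*n+(k+c))) * u (k*n+(i+c))))"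
    by (intro sum.cong refl) (simp add: r mult_ac)
  thus ?thesis unfolding ptf_def by (simp only: Re_sum Re_of_real_mult)
qed

text \<open>The singlet of levels \<open>p\<close> and \<open>q\<close>, shifted by \<open>c\<close>
  in the second factor. It is an eigenvector of the partial transpose belonging to
  \<open>dvec m n c x\<close>, with eigenvalue \<open>- (x p * x q)\<close>.\<close>

definition antisymv :: "nat \<Rightarrow> nat \<Rightarrow> nat \<Rightarrow> nat \<Rightarrow> nat \<Rightarrow> complex" where
  "antisymv n c p q = (\<lambda>x. of_real (1 / sqrt 2) * (ket (p*n+(q+c)) x - ket (q*n+(p+c)) x))"

lemma sqrt_half_sq: "of_real (1 / sqrt 2) * (of_real (1 / sqrt 2) :: complex) = 1 / 2"
proof -
  have h: "1 / sqrt 2 * (1 / sqrt 2) = (1 / 2 :: real)" by simp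
  show ?thesis unfolding of_real_mult[symmetric] h by simp
qed

lemma ip_antisymv:
  assumes "p < m" "q < m" "p + c < n" "q + c < n"
  shows "ip (m*n) (antisymv n c p q) g = of_real (1 / sqrt 2) * (g (p*n+(q+c)) - g (q*n+(p+c)))"
  using prod_index_less[of p m "q+c" n] prod_index_less[of q m "p+c" n] assms
  unfolding antisymv_def ip_scale_left ip_diff_left by (simp add: ip_ket del: of_real_divide)

text \<open>Shifts that differ by at least \<open>m\<close> occupy disjoint blocks of the second
  basis. With truncated subtraction, the two inequalities express this for the two possible orders
  of the shifts.\<close>

lemma ip_antisymv_antisymv:
  assumes "p < q" "q < m" "q + c < n" "p' < q'" "q' < m" "q' + c' < n" "c = c' \<or> m \<le> c - c' \<or> m \<le> c' - c"
  shows "ip (m*n) (antisymv n c p q) (antisymv n c' p' q') = (if p = p' \<and> q = q' \<and> c = c' then 1 else 0)"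
proof -
  have "ip (m*n) (antisymv n c p q) (antisymv n c' p' q')
     = of_real (1 / sqrt 2) * of_real (1 / sqrt 2) * ((ket (p'*n+(q'+c')) (p*n+(q+c)) - ket (q'*n+(p'+c')) (p*n+(q+c)))
       - (ket (p'*n+(q'+c')) (q*n+(p+c)) - ket (q'*n+(p'+c')) (q*n+(p+c))))"
    using assms by (subst ip_antisymv) (auto simp: antisymv_def algebra_simps)
  also have "\<dots> = (if p = p' \<and> q = q' \<and> c = c' then 1 else 0)"
  proof -
    have "p*n+(q+c) = p'*n+(q'+c') \<longleftrightarrow> p = p' \<and> q = q' \<and> c = c'"
      by (subst index_eq_iff) (use assms in auto)
    moreover have "q*n+(p+c) = q'*n+(p'+c') \<longleftrightarrow> p = p' \<and> q = q' \<and> c = c'"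
      by (subst index_eq_iff) (use assms in auto)
    moreover have "p*n+(q+c) \<noteq> q'*n+(p'+c')" "q*n+(p+c) \<noteq> p'*n+(q'+c')"
      by (subst index_eq_iff; use assms in auto)+
    ultimately show ?thesis unfolding sqrt_half_sq ket_def by simp
  qed
  finally show ?thesis .
qed

lemma ptf_dvec_antisymv:
  assumes c: "m + c \<le> n" and pq: "p < q" "q < m"
  shows "ptf m n (($) (dvec m n c x)) (antisymv n c p q) = - (x p * x q)"
proof -
  define h where "h = complex_of_real (1 / sqrt 2)"
  have h: "Re h * Re h = 1 / 2" "Im h = 0" by (auto simp: h_def)
  have a: "antisymv n c p q (i*n+(k+c)) = (if i = p \<and> k = q then h else if i = q \<and> k = p then - h else 0)"
    if "i < m" "k < m" for i k
    using that assms by (auto simp: antisymv_def ket_def index_eq_iff h_def)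
  have "ptf m n (($) (dvec m n c x)) (antisymv n c p q)
     = (\<Sum>i<m. \<Sum>k<m. if (i = p \<and> k = q) \<or> (i = q \<and> k = p) then - (x p * x q) / 2 else 0)"
    unfolding ptf_dvec[OF c] using pq by (intro sum.cong refl) (auto simp: a h)
  also have "\<dots> = (\<Sum>i<m. (if i = p then - (x p * x q) / 2 else 0) + (if i = q then - (x p * x q) / 2 else 0))"
  proof (intro sum.cong refl)
    fix i assume "i \<in> {..<m}"
    have "(\<Sum>k<m. if (i = p \<and> k = q) \<or> (i = q \<and> k = p) then - (x p * x q) / 2 else 0)
       = (\<Sum>k<m. (if k = q then if i = p then - (x p * x q) / 2 else 0 else 0) + (if k = p then if i = q then - (x p * x q) / 2 else 0 else 0))"
      using pq by (intro sum.cong) auto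
    thus "(\<Sum>k<m. if (i = p \<and> k = q) \<or> (i = q \<and> k = p) then - (x p * x q) / 2 else 0)
       = (if i = p then - (x p * x q) / 2 else 0) + (if i = q then - (x p * x q) / 2 else 0)"
      using pq by (simp add: sum.distrib)
  qed
  also have "\<dots> = - (x p * x q)" using pq by (simp add: sum.distrib)
  finally show ?thesis .
qed

lemma ptf_dvec_antisymv_other:
  assumes c: "m + c \<le> n" "m + c' \<le> n" "m \<le> c - c' \<or> m \<le> c' - c" and pq: "p < q" "q < m"
  shows "ptf m n (($) (dvec m n c x)) (antisymv n c' p q) = 0"
proof -
  have "antisymv n c' p q (i*n+(k+c)) = 0" if "i < m" "k < m" for i k
    using that assms by (auto simp: antisymv_def ket_def index_eq_iff)
  thus ?thesis unfolding ptf_dvec[OF c(1)] by simp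
qed

lemma ptf_two:
  assumes mn: "2 \<le> m" "m \<le> n" and x: "\<And>i. 2 \<le> i \<Longrightarrow> x i = 0"
  shows "ptf m n (($) (dvec m n 0 x)) u = (x 0)\<^sup>2 * (cmod (u 0))\<^sup>2 + (x 1)\<^sup>2 * (cmod (u (n+1)))\<^sup>2
    + 2 * (x 0 * x 1) * Re (cnj (u 1) * u n)"
proof -
  have "ptf m n (($) (dvec m n 0 x)) u = (\<Sum>i<m. \<Sum>k<2. x i * x k * Re (cnj (u (i*n+k)) * u (k*n+i)))"
  proof -
    have "ptf m n (($) (dvec m n 0 x)) u = (\<Sum>i<m. \<Sum>k<m. x i * x k * Re (cnj (u (i*n+k)) * u (k*n+i)))"
      using ptf_dvec[of m 0 n x u] mn by simp
    also have "\<dots> = (\<Sum>i<m. \<Sum>k<2. x i * x k * Re (cnj (u (i*n+k)) * u (k*n+i)))"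
      using mn x by (intro sum.cong refl sum.mono_neutral_right) auto
    finally show ?thesis .
  qed
  also have "\<dots> = (\<Sum>i<2. \<Sum>k<2. x i * x k * Re (cnj (u (i*n+k)) * u (k*n+i)))"
    using mn x by (intro sum.mono_neutral_right) auto
  also have "\<dots> = (x 0)\<^sup>2 * Re (cnj (u 0) * u 0) + (x 1)\<^sup>2 * Re (cnj (u (n+1)) * u (n+1))
    + 2 * (x 0 * x 1) * Re (cnj (u 1) * u n)"
    by (simp add: numeral_2_eq_2 power2_eq_square algebra_simps)
  finally show ?thesis by (simp only: cnj_mult_cmod Re_complex_of_real)
qed

lemma sum_two:
  fixes x :: "nat \<Rightarrow> real"
  assumes "2 \<le> m" "\<And>i. 2 \<le> i \<Longrightarrow> x i = 0"
  shows "(\<Sum>i<m. (x i)\<^sup>2) = (x 0)\<^sup>2 + (x 1)\<^sup>2"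
proof -
  have "(\<Sum>i<m. (x i)\<^sup>2) = (\<Sum>i<2. (x i)\<^sup>2)" using assms by (intro sum.mono_neutral_right) auto
  also have "\<dots> = (x 0)\<^sup>2 + (x 1)\<^sup>2" by (simp add: numeral_2_eq_2)
  finally show ?thesis .
qed

text \<open>Vanishing on the singlet is what keeps mixtures witnesses: the expectation of
  \<open>mixed_ew\<close> at the singlet depends only on the share of the pure example and is
  negative as soon as that share is positive.\<close>

definition co_singlet :: "nat \<Rightarrow> nat \<Rightarrow> complex mat" where
  "co_singlet m n = mat (m*n) (m*n) (\<lambda>(r,c). (if r = c then 1 else 0) - antisymv n 0 0 1 r * cnj (antisymv n 0 0 1 c))"

text \<open>The normalised complement of the negative eigenvector has the limiting spectrum
  \<open>(1/(mn-1), \<dots>, 1/(mn-1), 0)\<close>; mixing it with a pure example reaches all values in between.\<close>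

definition mixed_ew :: "nat \<Rightarrow> nat \<Rightarrow> (nat \<Rightarrow> real) \<Rightarrow> real \<Rightarrow> complex mat" where
  "mixed_ew m n x t = of_real ((1 - t) / (real (m*n) - 1)) \<cdot>\<^sub>m co_singlet m n
     + ptrans m n (of_real t \<cdot>\<^sub>m proj (dvec m n 0 x))"

context
  fixes m n :: nat
  assumes mn: "2 \<le> m" "m \<le> n"
begin

lemma mn4: "4 \<le> m * n"
  using mult_le_mono[of 2 m 2 n] mn by simp

lemma mn_pos: "0 < m" "0 < n"
  using mn by auto

lemma mn_real: "3 \<le> real m * real n - 1"
  using mn4 by (simp flip: of_nat_mult)

lemma singlet_unit: "ip (m*n) (antisymv n 0 0 1) (antisymv n 0 0 1) = 1"
  using ip_antisymv_antisymv[of 0 1 m 0 n 0 1 0] mn by simp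

lemma co_singlet_carrier [simp]: "co_singlet m n \<in> carrier_mat (m*n) (m*n)"
  by (simp add: co_singlet_def)

lemma qf_co_singlet:
  "qf (m*n) (co_singlet m n) u = Re (ip (m*n) u u) - (cmod (ip (m*n) (antisymv n 0 0 1) u))\<^sup>2"
proof -
  define s where "s = antisymv n 0 0 1"
  have "(\<Sum>r<m*n. \<Sum>c<m*n. cnj (u r) * co_singlet m n $$ (r,c) * u c)
     = (\<Sum>r<m*n. \<Sum>c<m*n. (if r = c then cnj (u r) * u c else 0) - (cnj (u r) * s r) * (cnj (s c) * u c))"
    by (intro sum.cong refl) (simp add: co_singlet_def s_def algebra_simps)
  also have "\<dots> = ip (m*n) u u - ip (m*n) u s * ip (m*n) s u"
    by (simp add: sum_subtractf ip_def sum_product)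
  finally show ?thesis by (simp add: qf_def ip_mult_swap cmod_ip_commute[of _ u] s_def del: of_real_power)
qed

lemma psd_co_singlet: "psd (co_singlet m n)"
  unfolding psd_iff[OF co_singlet_carrier]
proof
  show "hermitian (co_singlet m n)"
    unfolding hermitian_iff[OF co_singlet_carrier] by (auto simp: co_singlet_def mult.commute)
  show "\<forall>u. 0 \<le> qf (m*n) (co_singlet m n) u"
  proof
    fix u
    have "ons (m*n) {0::nat} (\<lambda>_. antisymv n 0 0 1)" using singlet_unit by (simp add: ons_def)
    from bessel_ons[OF _ this, of u] show "0 \<le> qf (m*n) (co_singlet m n) u" by (simp add: qf_co_singlet)
  qed
qed

lemma trace_co_singlet: "trace (co_singlet m n) = of_nat (m*n) - 1"
  using singlet_unit by (simp add: trace_def co_singlet_def sum_subtractf ip_def mult.commute)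

lemma sum_sq_co_singlet: "(\<Sum>r<m*n. \<Sum>c<m*n. (cmod (co_singlet m n $$ (r,c)))\<^sup>2) = real (m*n) - 1"
proof -
  define s where "s = antisymv n 0 0 1"
  have s1: "(\<Sum>r<m*n. (cmod (s r))\<^sup>2) = 1"
    using singlet_unit by (simp add: ip_self s_def flip: of_real_power)
      (metis of_real_eq_1_iff of_real_sum)
  have "(\<Sum>r<m*n. \<Sum>c<m*n. (cmod (co_singlet m n $$ (r,c)))\<^sup>2)
     = (\<Sum>r<m*n. \<Sum>c<m*n. (if r = c then 1 - 2 * (cmod (s r))\<^sup>2 else 0) + (cmod (s r))\<^sup>2 * (cmod (s c))\<^sup>2)"
  proof (intro sum.cong refl)
    fix r c assume "r \<in> {..<m*n}" "c \<in> {..<m*n}"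
    hence e: "co_singlet m n $$ (r,c) = (if r = c then 1 else 0) - s r * cnj (s c)"
      by (simp add: co_singlet_def s_def)
    have "(cmod (1 - s c * cnj (s c)))\<^sup>2 = (1 - (cmod (s c))\<^sup>2)\<^sup>2"
    proof -
      have "1 - s c * cnj (s c) = of_real (1 - (cmod (s c))\<^sup>2)" unfolding cnj_mult_cmod(2) by simp
      hence "cmod (1 - s c * cnj (s c)) = \<bar>1 - (cmod (s c))\<^sup>2\<bar>" by (metis norm_of_real)
      thus ?thesis by simp
    qed
    also have "\<dots> = 1 - 2 * (cmod (s c))\<^sup>2 + (cmod (s c))\<^sup>2 * (cmod (s c))\<^sup>2"
      by (simp add: power2_diff flip: power2_eq_square)
    finally show "(cmod (co_singlet m n $$ (r,c)))\<^sup>2 = (if r = c then 1 - 2 * (cmod (s r))\<^sup>2 else 0) + (cmod (s r))\<^sup>2 * (cmod (s c))\<^sup>2"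
      by (simp add: e norm_mult power_mult_distrib)
  qed
  also have "\<dots> = real (m*n) - 2 * (\<Sum>r<m*n. (cmod (s r))\<^sup>2) + (\<Sum>r<m*n. (cmod (s r))\<^sup>2) * (\<Sum>c<m*n. (cmod (s c))\<^sup>2)"
    unfolding sum_product by (simp add: sum.distrib sum_subtractf sum_distrib_left)
  finally show ?thesis by (simp add: s1)
qed

context
  fixes x :: "nat \<Rightarrow> real"
  assumes x: "\<And>i. 2 \<le> i \<Longrightarrow> x i = 0" "(x 0)\<^sup>2 + (x 1)\<^sup>2 = 1" "0 < x 1" "x 1 \<le> x 0"
begin

lemma unit_example: "unit_vec (m*n) (dvec m n 0 x)"
  using sum_two[of m x] mn x by (intro unit_dvec) auto

lemma qf_mixed_ew:
  "qf (m*n) (mixed_ew m n x t) u = (1 - t) / (real (m*n) - 1) * (Re (ip (m*n) u u) - (cmod (ip (m*n) (antisymv n 0 0 1) u))\<^sup>2)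
     + t * ptf m n (($) (dvec m n 0 x)) u"
  unfolding mixed_ew_def ptrans_smult[OF proj_carrier[OF dvec_carrier]]
  by (simp add: qf_add[of _ "m*n"] qf_smult[of _ "m*n"] qf_co_singlet qf_ptrans_proj del: of_real_divide)

lemma mixed_ew_parts:
  assumes "0 \<le> t" "t \<le> 1"
  shows "psd (of_real ((1 - t) / (real (m*n) - 1)) \<cdot>\<^sub>m co_singlet m n)"
    "of_real ((1 - t) / (real (m*n) - 1)) \<cdot>\<^sub>m co_singlet m n \<in> carrier_mat (m*n) (m*n)"
    "psd (of_real t \<cdot>\<^sub>m proj (dvec m n 0 x))" "of_real t \<cdot>\<^sub>m proj (dvec m n 0 x) \<in> carrier_mat (m*n) (m*n)"
    "trace (of_real ((1 - t) / (real (m*n) - 1)) \<cdot>\<^sub>m co_singlet m n) = of_real (1 - t)"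
    "trace (of_real t \<cdot>\<^sub>m proj (dvec m n 0 x)) = of_real t"
proof -
  have "0 \<le> (1 - t) / (real (m*n) - 1)" using assms mn_real by simp
  thus "psd (of_real ((1 - t) / (real (m*n) - 1)) \<cdot>\<^sub>m co_singlet m n)"
    by (rule psd_smult[OF psd_co_singlet co_singlet_carrier])
  show "psd (of_real t \<cdot>\<^sub>m proj (dvec m n 0 x))"
    by (rule psd_smult[OF psd_proj[OF dvec_carrier] proj_carrier[OF dvec_carrier] assms(1)])
  have "trace (of_real ((1 - t) / (real (m*n) - 1)) \<cdot>\<^sub>m co_singlet m n) = of_real ((1 - t) / (real (m*n) - 1)) * of_real (real (m*n) - 1)"
    by (simp add: trace_smult[of _ "m*n"] trace_co_singlet del: of_real_divide)
  also have "\<dots> = of_real ((1 - t) / (real (m*n) - 1) * (real (m*n) - 1))" by (rule of_real_mult[symmetric])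
  also have "(1 - t) / (real (m*n) - 1) * (real (m*n) - 1) = 1 - t" using mn_real by simp
  finally show "trace (of_real ((1 - t) / (real (m*n) - 1)) \<cdot>\<^sub>m co_singlet m n) = of_real (1 - t)" .
  show "trace (of_real t \<cdot>\<^sub>m proj (dvec m n 0 x)) = of_real t"
    by (simp add: trace_smult[OF proj_carrier[OF dvec_carrier]] trace_proj[OF unit_example])
qed auto

lemma qf_mixed_ew_singlet: "qf (m*n) (mixed_ew m n x t) (antisymv n 0 0 1) = - (t * (x 0 * x 1))"
  unfolding qf_mixed_ew singlet_unit using ptf_dvec_antisymv[of m 0 n 0 1 x] mn by simp

lemma mixed_ew_DEWs:
  assumes "0 < t" "t \<le> 1"
  shows "mixed_ew m n x t \<in> DEWs m n"
proof -
  have "0 < t * (x 0 * x 1)" using assms x by simp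
  hence "qf (m*n) (mixed_ew m n x t) (antisymv n 0 0 1) < 0" unfolding qf_mixed_ew_singlet by simp
  thus ?thesis unfolding mixed_ew_def
    using mixed_ew_parts[of t] assms by (intro DEWs_intro) auto
qed

text \<open>The singlet gives the expectation \<open>- t / 2\<close>, and the bound -1/2 for pure
  states, scaled by \<open>tr Q = t\<close>, says that nothing lower is possible.\<close>

lemma mixed_ew_last_eigval:
  assumes t: "0 < t" "t \<le> 1" and h: "x 0 * x 1 = 1 / 2"
  shows "eigvals (mixed_ew m n x t) ! (m*n-1) = - t / 2"
proof (rule antisym)
  have W: "hermitian (mixed_ew m n x t)" "mixed_ew m n x t \<in> carrier_mat (m*n) (m*n)"
    using mixed_ew_DEWs[OF t] by (auto elim: DEWsE)
  have "ons (m*n) {0::nat} (\<lambda>_. antisymv n 0 0 1)" using singlet_unit by (simp add: ons_def)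
  moreover have "{m*n-1..<m*n} = {m*n-1}" using mn4 by auto
  ultimately show "eigvals (mixed_ew m n x t) ! (m*n-1) \<le> - t / 2"
    using ky_fan_lower[OF W, of "{0::nat}" "\<lambda>_. antisymv n 0 0 1" 1] mn4 by (simp add: qf_mixed_ew_singlet h del: One_nat_def)
  have "- (1/2 * Re (trace (of_real t \<cdot>\<^sub>m proj (dvec m n 0 x)))) \<le> (\<Sum>i\<in>{m*n-1}. eigvals (mixed_ew m n x t) ! i)"
    unfolding mixed_ew_def
    using mixed_ew_parts(1-4)[of t] t mn4 mn
    by (intro decomposable_eigvals_lower) (auto intro!: ptf_ge1[where J="{m*n-1}", simplified])
  thus "- t / 2 \<le> eigvals (mixed_ew m n x t) ! (m*n-1)" using mixed_ew_parts(6)[of t] t by simp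
qed

text \<open>The vector |00> is orthogonal to the singlet and maximises both summands at once: the
  projection has eigenvalue 1 there, and the partial transpose its largest eigenvalue
  \<open>(x 0)\<^sup>2\<close>.\<close>

lemma mixed_ew_first_eigval:
  assumes t: "0 < t" "t \<le> 1"
  shows "eigvals (mixed_ew m n x t) ! 0 = (1 - t) / (real (m*n) - 1) + t * (x 0)\<^sup>2"
proof (rule antisym)
  have W: "hermitian (mixed_ew m n x t)" "mixed_ew m n x t \<in> carrier_mat (m*n) (m*n)"
    using mixed_ew_DEWs[OF t] by (auto elim: DEWsE)
  have k0: "ip (m*n) (ket 0) (ket 0) = 1" using mn_pos by (subst ip_ket) (auto simp: ket_def)
  have "ons (m*n) {0::nat} (\<lambda>_. ket 0)" using k0 by (simp add: ons_def)
  moreover have "qf (m*n) (mixed_ew m n x t) (ket 0) = (1 - t) / (real (m*n) - 1) + t * (x 0)\<^sup>2"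
  proof -
    have "ip (m*n) (antisymv n 0 0 1) (ket 0) = 0" using mn by (subst ip_antisymv) (auto simp: ket_def)
    thus ?thesis unfolding qf_mixed_ew k0 using mn by (simp add: ptf_two[OF mn x(1)] ket_def)
  qed
  ultimately show "(1 - t) / (real (m*n) - 1) + t * (x 0)\<^sup>2 \<le> eigvals (mixed_ew m n x t) ! 0"
    using ky_fan_upper[OF W, of "{0::nat}" "\<lambda>_. ket 0" 1] mn_pos by (simp add: Suc_le_eq)
  obtain u where u: "ons (m*n) {..<m*n} u" "\<And>i. i < m*n \<Longrightarrow> qf (m*n) (mixed_ew m n x t) (u i) = eigvals (mixed_ew m n x t) ! i"
    by (rule spectral_qf[OF W]) blast
  define v where "v = u 0"
  have v1: "ip (m*n) v v = 1" using onsD[OF u(1), of 0 0] mn_pos by (simp add: v_def)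
  have "eigvals (mixed_ew m n x t) ! 0 = qf (m*n) (mixed_ew m n x t) v" using u(2)[of 0] mn_pos by (simp add: v_def)
  also have "\<dots> \<le> (1 - t) / (real (m*n) - 1) * 1 + t * (x 0)\<^sup>2"
    unfolding qf_mixed_ew v1
  proof (intro add_mono mult_left_mono)
    have idx: "0 < m*n" "1 < m*n" "n < m*n" "n + 1 < m*n"
      using mn4 prod_index_less[of 1 m 0 n] prod_index_less[of 1 m 1 n] mn by auto
    \<comment> \<open>The positions 0, n+1, 1, n are those of |00>, |11>, |01>, |10>, the only ones
      that the pure part sees.\<close>
    have four: "(cmod (v 0))\<^sup>2 + (cmod (v (n+1)))\<^sup>2 + (cmod (v 1))\<^sup>2 + (cmod (v n))\<^sup>2 \<le> 1"
    proof -
      have "(\<Sum>r\<in>{0,n+1,1,n}. (cmod (v r))\<^sup>2) \<le> (\<Sum>r<m*n. (cmod (v r))\<^sup>2)"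
        using idx by (intro sum_mono2) auto
      also have "\<dots> = 1" using v1 by (metis Re_complex_of_real ip_self one_complex.sel(1))
      finally show ?thesis using mn by simp
    qed
    have e: "ptf m n (($) (dvec m n 0 x)) v = (x 0)\<^sup>2 * (cmod (v 0))\<^sup>2 + (x 1)\<^sup>2 * (cmod (v (n+1)))\<^sup>2
      + 2 * (x 0 * x 1) * Re (cnj (v 1) * v n)"
      using mn x(1) by (intro ptf_two) auto
    have "ptf m n (($) (dvec m n 0 x)) v \<le> (x 0)\<^sup>2 * (cmod (v 0))\<^sup>2 + (x 0)\<^sup>2 * (cmod (v (n+1)))\<^sup>2
       + (x 0)\<^sup>2 * ((cmod (v 1))\<^sup>2 + (cmod (v n))\<^sup>2)"
      unfolding e
    proof (intro add_mono order.refl mult_right_mono)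
      show "(x 1)\<^sup>2 \<le> (x 0)\<^sup>2" using x by (intro power_mono) auto
      have "2 * Re (cnj (v 1) * v n) \<le> (cmod (v 1))\<^sup>2 + (cmod (v n))\<^sup>2"
        using cmod_polar(2)[of "v 1" "v n"] zero_le_power2[of "cmod (v 1 - v n)"] by linarith
      hence "(x 0 * x 1) * (2 * Re (cnj (v 1) * v n)) \<le> (x 0 * x 1) * ((cmod (v 1))\<^sup>2 + (cmod (v n))\<^sup>2)"
        using x by (intro mult_left_mono) auto
      also have "\<dots> \<le> (x 0 * x 0) * ((cmod (v 1))\<^sup>2 + (cmod (v n))\<^sup>2)"
        using x by (intro mult_right_mono mult_left_mono) auto
      finally show "2 * (x 0 * x 1) * Re (cnj (v 1) * v n) \<le> (x 0)\<^sup>2 * ((cmod (v 1))\<^sup>2 + (cmod (v n))\<^sup>2)"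
        by (simp only: power2_eq_square mult_ac)
    qed auto
    also have "\<dots> = (x 0)\<^sup>2 * ((cmod (v 0))\<^sup>2 + (cmod (v (n+1)))\<^sup>2 + (cmod (v 1))\<^sup>2 + (cmod (v n))\<^sup>2)"
      by (simp only: distrib_left add.assoc)
    also have "\<dots> \<le> (x 0)\<^sup>2 * 1" using four by (intro mult_left_mono) auto
    finally show "ptf m n (($) (dvec m n 0 x)) v \<le> (x 0)\<^sup>2" by simp
  qed (use t mn_real in auto)
  finally show "eigvals (mixed_ew m n x t) ! 0 \<le> (1 - t) / (real (m*n) - 1) + t * (x 0)\<^sup>2" by simp
qed

text \<open>The purity is continuous in \<open>t\<close>, equals \<open>1 / (mn - 1)\<close> at
  \<open>t = 0\<close> and 1 at \<open>t = 1\<close>. The strict lower bound on \<open>y\<close>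
  excludes \<open>t = 0\<close>, where the matrix is not a witness.\<close>

lemma mixed_ew_purity:
  assumes y: "1 / (real (m*n) - 1) < y" "y \<le> 1"
  obtains t where "0 < t" "t \<le> 1" "Re (trace (mixed_ew m n x t * mixed_ew m n x t)) = y"
proof -
  define A where "A = co_singlet m n"
  define B where "B = ptrans m n (proj (dvec m n 0 x))"
  define k where "k = 1 / (real (m*n) - 1)"
  define p where "p t = (\<Sum>r<m*n. \<Sum>c<m*n. (cmod (of_real ((1 - t) * k) * A $$ (r,c) + of_real t * B $$ (r,c)))\<^sup>2)" for t
  have cont: "continuous_on {0..1} p" unfolding p_def
    by (intro continuous_intros)
  have "p 0 = (\<Sum>r<m*n. \<Sum>c<m*n. k\<^sup>2 * (cmod (A $$ (r,c)))\<^sup>2)"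
    by (simp add: p_def norm_mult power_mult_distrib)
  also have "\<dots> = k\<^sup>2 * (real (m*n) - 1)"
    unfolding sum_distrib_left[symmetric] A_def sum_sq_co_singlet ..
  also have "\<dots> = 1 / (real (m*n) - 1)" by (simp add: k_def power2_eq_square)
  finally have p0: "p 0 = 1 / (real (m*n) - 1)" .
  have "p 1 = (\<Sum>r<m*n. \<Sum>c<m*n. (cmod (proj (dvec m n 0 x) $$ (r,c)))\<^sup>2)"
  proof -
    have "p 1 = (\<Sum>r<m*n. \<Sum>c<m*n. (cmod (B $$ (r,c)))\<^sup>2)" by (simp add: p_def)
    thus ?thesis unfolding B_def sum_ptrans[where g="\<lambda>z. (cmod z)\<^sup>2"] .
  qed
  also have "\<dots> = (\<Sum>r<m*n. (cmod (dvec m n 0 x $ r))\<^sup>2) * (\<Sum>r<m*n. (cmod (dvec m n 0 x $ r))\<^sup>2)"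
    unfolding sum_product by (intro sum.cong refl) (simp add: proj_def dvec_def norm_mult power_mult_distrib)
  also have "\<dots> = 1"
    using unit_example unfolding unit_vec_iff by (metis Re_complex_of_real ip_self one_complex.sel(1) mult_1)
  finally have p1: "p 1 = 1" .
  obtain t where t: "0 \<le> t" "t \<le> 1" "p t = y"
    using IVT'[of p 0 y 1] cont p0 p1 y by auto
  have "t \<noteq> 0" using t p0 y by auto
  hence t0: "0 < t" using t by simp
  have W: "hermitian (mixed_ew m n x t)" "mixed_ew m n x t \<in> carrier_mat (m*n) (m*n)"
    using mixed_ew_DEWs[OF t0 t(2)] by (auto elim: DEWsE)
  have "Re (trace (mixed_ew m n x t * mixed_ew m n x t)) = p t"
    unfolding sum_sq_entries(1)[OF W] p_def
  proof (intro sum.cong refl arg_cong[where f="\<lambda>z. (cmod z)\<^sup>2"])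
    fix r c assume "r \<in> {..<m*n}" "c \<in> {..<m*n}"
    thus "mixed_ew m n x t $$ (r,c) = of_real ((1 - t) * k) * A $$ (r,c) + of_real t * B $$ (r,c)"
      unfolding mixed_ew_def ptrans_smult[OF proj_carrier[OF dvec_carrier]]
      using carrier_matD[OF ptrans_carrier[of m n "proj (dvec m n 0 x)"]] carrier_matD[OF co_singlet_carrier]
      by (simp add: A_def B_def k_def)
  qed
  thus ?thesis using that t t0 by simp
qed

end

end

section \<open>Extremal witnesses\<close>

lemma is_inf_open:
  assumes "\<And>y. y \<in> S \<Longrightarrow> c < y" "\<And>x. c < x \<Longrightarrow> x \<le> d \<Longrightarrow> x \<in> S" "c < d"
  shows "is_inf S c"
  unfolding is_inf_def
proof (intro conjI ballI allI impI)
  fix y assume y: "\<forall>x\<in>S. y \<le> x"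
  show "y \<le> c"
  proof (rule ccontr)
    assume "\<not> y \<le> c"
    hence "c < min y d" using assms(3) by simp
    hence "(c + min y d) / 2 \<in> S" by (intro assms(2)) auto
    hence "2 * y \<le> c + min y d" using y by fastforce
    thus False using \<open>c < min y d\<close> min.cobounded1[of y d] by linarith
  qed
qed (use assms(1) in \<open>auto intro: less_imp_le\<close>)

lemma is_sup_open:
  assumes "\<And>y. y \<in> S \<Longrightarrow> y < c" "\<And>x. d \<le> x \<Longrightarrow> x < c \<Longrightarrow> x \<in> S" "d < c"
  shows "is_sup S c"
  unfolding is_sup_def
proof (intro conjI ballI allI impI)
  fix y assume y: "\<forall>x\<in>S. x \<le> y"
  show "c \<le> y"
  proof (rule ccontr)
    assume "\<not> c \<le> y"
    hence "max y d < c" using assms(3) by simp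
    hence "(c + max y d) / 2 \<in> S" by (intro assms(2)) auto
    hence "c + max y d \<le> 2 * y" using y by fastforce
    thus False using \<open>max y d < c\<close> max.cobounded1[of y d] by linarith
  qed
qed (use assms(1) in \<open>auto intro: less_imp_le\<close>)

lemma DEWs_basic:
  assumes "W \<in> DEWs m n"
  shows "hermitian W" "W \<in> carrier_mat (m*n) (m*n)" "trace W = 1" "eigvals W ! (m*n-1) < 0" "0 < m*n"
    "(\<Sum>i<m*n. eigvals W ! i) = 1"
proof -
  show *: "hermitian W" "W \<in> carrier_mat (m*n) (m*n)" "trace W = 1" "eigvals W ! (m*n-1) < 0" "0 < m*n"
    using assms by (auto elim!: DEWsE)
  show "(\<Sum>i<m*n. eigvals W ! i) = 1"
    using trace_eigvals[OF *(1,2)] *(3) by (metis of_real_eq_1_iff)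
qed

lemma DEWs_not_nonneg:
  assumes "W \<in> DEWs m n"
  obtains u where "qf (m*n) W u < 0"
proof -
  note W = DEWs_basic[OF assms]
  obtain u where "\<And>i. i < m*n \<Longrightarrow> qf (m*n) W (u i) = eigvals W ! i"
    by (rule spectral_qf[OF W(1,2)]) blast
  thus ?thesis using that[of "u (m*n-1)"] W(4,5) by simp
qed

lemma sum_butlast:
  fixes f :: "nat \<Rightarrow> real"
  assumes "0 < N" shows "(\<Sum>i<N. f i) = (\<Sum>i<N-1. f i) + f (N - 1)"
  using assms by (cases N) auto

lemma real_pred: "1 \<le> N \<Longrightarrow> real (N - 1) = real N - 1"
  by (simp add: of_nat_diff)

lemma filter_mset_empty_iff: "filter_mset P M = {#} \<longleftrightarrow> (\<forall>x\<in>#M. \<not> P x)"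
  by (induction M) auto

text \<open>The last eigenvalue is negative, so the other mn - 1 sum to more than 1 and the largest
  exceeds their mean.\<close>

lemma DEWs_first_eigval_gt:
  assumes "W \<in> DEWs m n" and N: "2 \<le> m*n"
  shows "1 / (real (m*n) - 1) < eigvals W ! 0"
proof -
  note W = DEWs_basic[OF assms(1)]
  have "1 < (\<Sum>i<m*n-1. eigvals W ! i)"
    using sum_butlast[OF W(5), of "\<lambda>i. eigvals W ! i"] W(4,6) by linarith
  also have "\<dots> \<le> (\<Sum>i<m*n-1. eigvals W ! 0)"
    by (intro sum_mono eigvals_antimono) (auto simp: length_eigvals[OF W(2)])
  also have "\<dots> = (real (m*n) - 1) * eigvals W ! 0" using real_pred[OF order.trans[OF one_le_numeral N]] by simp
  finally have "1 < (real (m*n) - 1) * eigvals W ! 0" .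
  moreover have "0 < real (m*n) - 1" using N by linarith
  ultimately show ?thesis by (simp only: pos_divide_less_eq mult.commute)
qed

lemma DEWs_purity_gt:
  assumes "W \<in> DEWs m n" and N: "2 \<le> m*n"
  shows "1 / (real (m*n) - 1) < Re (trace (W * W))"
proof -
  note W = DEWs_basic[OF assms(1)]
  define k where "k = real (m*n) - 1"
  have k: "0 < k" "real (m*n-1) = k" using real_pred[of "m*n"] N unfolding k_def by linarith+
  define S where "S = (\<Sum>i<m*n-1. eigvals W ! i)"
  have S: "1 < S"
    using sum_butlast[OF W(5), of "\<lambda>i. eigvals W ! i"] W(4,6) unfolding S_def by linarith
  \<comment> \<open>The eigenvalues except the last, whose sum \<open>S\<close> exceeds 1, are
    compared with the flat spectrum \<open>1 / k\<close>; this is the spectrum that the infimum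
    approaches.\<close>
  have "0 \<le> (\<Sum>i<m*n-1. (eigvals W ! i - 1 / k)\<^sup>2)" by (intro sum_nonneg) auto
  also have "\<dots> = (\<Sum>i<m*n-1. (eigvals W ! i)\<^sup>2) - 2 / k * S + k * (1 / k)\<^sup>2"
    by (simp add: power2_diff sum.distrib sum_subtractf S_def sum_distrib_left k(2)[unfolded One_nat_def] mult_ac)
  also have "k * (1 / k)\<^sup>2 = 1 / k" using k by (simp add: power2_eq_square)
  finally have "2 / k * S - 1 / k \<le> (\<Sum>i<m*n-1. (eigvals W ! i)\<^sup>2)" by simp
  moreover have "1 / k < 2 / k * S - 1 / k" using S k by (simp add: field_simps)
  moreover have "(\<Sum>i<m*n-1. (eigvals W ! i)\<^sup>2) \<le> Re (trace (W * W))"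
    unfolding sum_sq_entries(2)[OF W(1,2)] sum_butlast[OF W(5), of "\<lambda>i. (eigvals W ! i)\<^sup>2"] by simp
  ultimately show ?thesis by (simp add: k_def)
qed

lemma sum_sq_le_sq_sum:
  fixes f :: "nat \<Rightarrow> real"
  assumes "\<And>i. i < N \<Longrightarrow> 0 \<le> f i"
  shows "(\<Sum>i<N. (f i)\<^sup>2) \<le> (\<Sum>i<N. f i)\<^sup>2"
proof -
  have "0 \<le> (\<Sum>q<N. \<Sum>p<q. f p * f q)" using assms by (intro sum_nonneg mult_nonneg_nonneg) auto
  thus ?thesis unfolding sum_mult_triangle by simp
qed

lemma psd_purity_le:
  assumes "psd A" "A \<in> carrier_mat N N"
  shows "(\<Sum>r<N. \<Sum>c<N. (cmod (A $$ (r,c)))\<^sup>2) \<le> (Re (trace A))\<^sup>2"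
  using sum_sq_le_sq_sum[of N "\<lambda>i. eigvals A ! i"] psd_eigvals_nonneg[OF assms]
    sum_sq_entries[OF psd_hermitian[OF assms(1)] assms(2)] trace_eigvals[OF psd_hermitian[OF assms(1)] assms(2)]
  by simp

lemma rank_one_from_eigvals:
  assumes Q: "psd Q" "Q \<in> carrier_mat N N" and o: "ons N {..<N} \<psi>"
    and ent: "\<And>r c. r < N \<Longrightarrow> c < N \<Longrightarrow> Q $$ (r,c) = (\<Sum>a<N. of_real (eigvals Q ! a) * \<psi> a r * cnj (\<psi> a c))"
    and a: "a < N" "eigvals Q ! a = 1" "\<And>b. b < N \<Longrightarrow> b \<noteq> a \<Longrightarrow> eigvals Q ! b = 0"
  shows "unit_vec N (vec N (\<psi> a))" "Q = proj (vec N (\<psi> a))"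
proof -
  have "ip N (($) (vec N (\<psi> a))) (($) (vec N (\<psi> a))) = ip N (\<psi> a) (\<psi> a)" by (intro ip_cong) auto
  thus "unit_vec N (vec N (\<psi> a))" using onsD[OF o, of a a] a(1) by (simp add: unit_vec_iff)
  show "Q = proj (vec N (\<psi> a))"
  proof (rule eq_matI)
    fix r c assume "r < dim_row (proj (vec N (\<psi> a)))" "c < dim_col (proj (vec N (\<psi> a)))"
    hence rc: "r < N" "c < N" by (auto simp: proj_def)
    have "Q $$ (r,c) = (\<Sum>b<N. if b = a then \<psi> a r * cnj (\<psi> a c) else 0)"
      unfolding ent[OF rc] using a by (intro sum.cong) auto
    thus "Q $$ (r,c) = proj (vec N (\<psi> a)) $$ (r,c)" using a(1) rc by (simp add: proj_def)
  qed (use Q(2) in \<open>auto simp: proj_def\<close>)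
qed

text \<open>The eigenvalues lie between 0 and 1, and both they and their squares sum to 1. Hence
  each \<open>q a * (1 - q a)\<close> vanishes, every eigenvalue is 0 or 1, and exactly one is
  1.\<close>

lemma pure_from_purity:
  assumes Q: "psd Q" "Q \<in> carrier_mat N N" and tr: "trace Q = 1"
    and pur: "(\<Sum>r<N. \<Sum>c<N. (cmod (Q $$ (r,c)))\<^sup>2) = 1"
  obtains \<psi> where "unit_vec N \<psi>" "Q = proj \<psi>"
proof -
  note h = psd_hermitian[OF Q(1)]
  obtain \<psi> where o: "ons N {..<N} \<psi>" and
    ent: "\<And>r c. r < N \<Longrightarrow> c < N \<Longrightarrow> Q $$ (r,c) = (\<Sum>a<N. of_real (eigvals Q ! a) * \<psi> a r * cnj (\<psi> a c))"
    using spectral_theorem[OF h Q(2)] by blast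
  define q where "q a = eigvals Q ! a" for a
  have q0: "0 \<le> q a" if "a < N" for a using psd_eigvals_nonneg[OF Q that] by (simp add: q_def)
  have s1: "(\<Sum>a<N. q a) = 1" using trace_eigvals[OF h Q(2)] tr unfolding q_def by (metis of_real_eq_1_iff)
  have s2: "(\<Sum>a<N. (q a)\<^sup>2) = 1" using sum_sq_entries[OF h Q(2)] pur by (simp add: q_def)
  have q1: "q a \<le> 1" if "a < N" for a
    using member_le_sum[of a "{..<N}" q] that q0 s1 by simp
  have "(\<Sum>a<N. q a * (1 - q a)) = 0" using s1 s2 by (simp add: algebra_simps sum_subtractf power2_eq_square)
  hence q01: "q a = 0 \<or> q a = 1" if "a < N" for a
    using that q0 q1 by (subst (asm) sum_nonneg_eq_0_iff) auto
  obtain a where a: "a < N" "q a = 1"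
    using q01 s1 by (metis lessThan_iff sum.neutral zero_neq_one)
  have "q b = 0" if "b < N" "b \<noteq> a" for b
  proof -
    have "q a + q b = (\<Sum>c\<in>{a,b}. q c)" using that by simp
    also have "\<dots> \<le> 1" unfolding s1[symmetric] using that a q0 by (intro sum_mono2) auto
    finally show ?thesis using a q0[OF that(1)] by simp
  qed
  thus ?thesis using rank_one_from_eigvals[OF Q o ent, of a] a that by (auto simp: q_def)
qed

text \<open>The Hilbert-Schmidt norm is invariant under partial transposition and bounded by the trace on
  positive matrices; in the equality case of the triangle inequality the two summands are proportional,
  which is impossible for a witness unless the positive part vanishes.\<close>

lemma DEWs_purity:
  assumes W: "W \<in> DEWs m n"
  shows "Re (trace (W * W)) \<le> 1"
    and "Re (trace (W * W)) = 1 \<Longrightarrow>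
      \<exists>\<psi>. unit_vec (m*n) \<psi> \<and> entangled m n \<psi> \<and> W = ptrans m n (proj \<psi>)"
proof -
  define N where "N = m * n"
  obtain P Q where P: "psd P" "P \<in> carrier_mat N N" and Q: "psd Q" "Q \<in> carrier_mat N N"
    and WPQ: "W = P + ptrans m n Q" and tr: "Re (trace P) + Re (trace Q) = 1"
    unfolding N_def by (rule DEWsE[OF W]) blast
  note Wb = DEWs_basic[OF W, folded N_def]
  define G where "G = ptrans m n Q"
  have G: "G \<in> carrier_mat N N" by (simp add: G_def N_def)
  define x y where "x = Re (trace P)" and "y = Re (trace Q)"
  have xy: "0 \<le> x" "0 \<le> y" "x + y = 1" using psd_trace_nonneg[OF P] psd_trace_nonneg[OF Q] tr by (auto simp: x_def y_def)
  define hp hg hx where "hp = (\<Sum>r<N. \<Sum>c<N. (cmod (P $$ (r,c)))\<^sup>2)"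
    and "hg = (\<Sum>r<N. \<Sum>c<N. (cmod (G $$ (r,c)))\<^sup>2)"
    and "hx = (\<Sum>r<N. \<Sum>c<N. Re (cnj (P $$ (r,c)) * G $$ (r,c)))"
  have hp: "hp \<le> x\<^sup>2" unfolding hp_def x_def by (rule psd_purity_le[OF P])
  have hgQ: "hg = (\<Sum>r<N. \<Sum>c<N. (cmod (Q $$ (r,c)))\<^sup>2)"
    unfolding hg_def G_def N_def by (rule sum_ptrans[where g="\<lambda>z. (cmod z)\<^sup>2"])
  hence hg: "hg \<le> y\<^sup>2" unfolding y_def using psd_purity_le[OF Q] by simp
  have comb: "(\<Sum>r<N. \<Sum>c<N. (cmod (of_real \<alpha> * P $$ (r,c) - of_real \<beta> * G $$ (r,c)))\<^sup>2) = \<alpha>\<^sup>2 * hp + \<beta>\<^sup>2 * hg - 2 * \<alpha> * \<beta> * hx" for \<alpha> \<beta>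
  proof -
    have "(cmod (of_real \<alpha> * P $$ (r,c) - of_real \<beta> * G $$ (r,c)))\<^sup>2
      = \<alpha>\<^sup>2 * (cmod (P $$ (r,c)))\<^sup>2 + \<beta>\<^sup>2 * (cmod (G $$ (r,c)))\<^sup>2 - 2 * \<alpha> * \<beta> * Re (cnj (P $$ (r,c)) * G $$ (r,c))" for r c
      unfolding cmod_polar(2) by (simp add: norm_mult power_mult_distrib algebra_simps)
    thus ?thesis by (simp add: hp_def hg_def hx_def sum.distrib sum_subtractf flip: sum_distrib_left)
  qed
  have pur: "Re (trace (W * W)) = hp + hg + 2 * hx"
  proof -
    have "Re (trace (W * W)) = (\<Sum>r<N. \<Sum>c<N. (cmod (of_real 1 * P $$ (r,c) - of_real (-1) * G $$ (r,c)))\<^sup>2)"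
      unfolding sum_sq_entries(1)[OF Wb(1,2)] using P(2) G by (intro sum.cong refl) (auto simp: WPQ G_def)
    thus ?thesis unfolding comb by simp
  qed
  have x0: "x = 0 \<Longrightarrow> P = 0\<^sub>m N N" using psd_trace_zero[OF P] by (simp add: x_def)
  have y0: "y = 0 \<Longrightarrow> Q = 0\<^sub>m N N" using psd_trace_zero[OF Q] by (simp add: y_def)
  \<comment> \<open>Expanding this square gives the Cauchy-Schwarz bound
    \<open>hx \<le> x * y\<close> after division by \<open>x * y\<close>, and its vanishing is the
    proportionality used in the equality case.\<close>
  have nn: "0 \<le> (\<Sum>r<N. \<Sum>c<N. (cmod (of_real y * P $$ (r,c) - of_real x * G $$ (r,c)))\<^sup>2)"
    by (intro sum_nonneg) auto
  have b1: "y\<^sup>2 * hp \<le> y\<^sup>2 * x\<^sup>2" "x\<^sup>2 * hg \<le> x\<^sup>2 * y\<^sup>2" using hp hg by (auto intro: mult_left_mono)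
  have hx: "hx \<le> x * y"
  proof (cases "x = 0 \<or> y = 0")
    case True
    have "hx = 0"
    proof (cases "x = 0")
      case True
      thus ?thesis using x0 by (simp add: hx_def)
    next
      case False
      hence "Q = 0\<^sub>m N N" using True y0 by simp
      hence "hg = 0" unfolding hgQ by simp
      hence "G $$ (r,c) = 0" if "r < N" "c < N" for r c
        using that unfolding hg_def by (simp add: sum_nonneg sum_nonneg_eq_0_iff)
      thus ?thesis by (simp add: hx_def)
    qed
    thus ?thesis using xy by simp
  next
    case False
    hence "0 < x * y" using xy by simp
    moreover have "(x * y) * (2 * hx) \<le> (x * y) * (2 * (x * y))"
      using nn b1 unfolding comb by (simp add: power2_eq_square algebra_simps)
    ultimately show ?thesis by (simp only: mult_le_cancel_left_pos)
  qed
  have one: "x\<^sup>2 + y\<^sup>2 + 2 * (x * y) = 1" using xy(3) by (metis mult.assoc one_power2 power2_sum)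
  show "Re (trace (W * W)) \<le> 1" using hp hg hx one unfolding pur by linarith
  assume "Re (trace (W * W)) = 1"
  hence eq: "hp = x\<^sup>2" "hg = y\<^sup>2" "hx = x * y" using hp hg hx one unfolding pur by linarith+
  obtain u where u: "qf N W u < 0" using DEWs_not_nonneg[OF W] unfolding N_def by blast
  have qW: "qf N W v = qf N P v + qf N G v" for v
    unfolding WPQ G_def[symmetric] by (rule qf_add[OF P(2) G])
  have "x = 0"
  proof (rule ccontr)
    assume "x \<noteq> 0"
    hence xp: "0 < x" using xy by simp
    have "(\<Sum>r<N. \<Sum>c<N. (cmod (of_real y * P $$ (r,c) - of_real x * G $$ (r,c)))\<^sup>2) = 0"
      unfolding comb eq by (simp add: power2_eq_square algebra_simps)
    hence proportional: "of_real x * G $$ (r,c) = of_real y * P $$ (r,c)" if "r < N" "c < N" for r c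
      using that by (simp add: sum_nonneg sum_nonneg_eq_0_iff)
    have "x * qf N G u = qf N (of_real x \<cdot>\<^sub>m G) u" by (rule qf_smult[OF G, symmetric])
    \<comment> \<open>With \<open>x > 0\<close> this makes the partially transposed part positive
      along with \<open>P\<close>, which contradicts the vector \<open>u\<close> of negative
      expectation.\<close>
    also have "of_real x \<cdot>\<^sub>m G = of_real y \<cdot>\<^sub>m P"
      using proportional P(2) G by (intro eq_matI) auto
    also have "qf N (of_real y \<cdot>\<^sub>m P) u = y * qf N P u" by (rule qf_smult[OF P(2)])
    finally have "0 \<le> x * qf N G u" using xy psd_qf_nonneg[OF P] by simp
    hence "0 \<le> qf N G u" using xp by (simp add: zero_le_mult_iff)
    thus False using u psd_qf_nonneg[OF P, of u] unfolding qW by simp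
  qed
  hence WG: "W = G" using x0 G unfolding WPQ G_def[symmetric] by simp
  have y1: "y = 1" using xy \<open>x = 0\<close> by simp
  have trQ: "trace Q = 1" using Wb(3) Q(2) unfolding WG G_def N_def by (simp add: trace_ptrans)
  obtain \<psi> where \<psi>: "unit_vec N \<psi>" "Q = proj \<psi>"
    using pure_from_purity[OF Q trQ] eq(2) y1 hgQ by auto
  have c: "\<psi> \<in> carrier_vec (m*n)" using \<psi>(1) by (simp add: unit_vec_iff N_def)
  have "entangled m n \<psi>"
    unfolding entangled_def
  proof
    assume "\<exists>a\<in>carrier_vec m. \<exists>b\<in>carrier_vec n. \<psi> = kron_vec a b"
    then obtain a b where "a \<in> carrier_vec m" "b \<in> carrier_vec n" "\<psi> = kron_vec a b" by blast
    \<comment> \<open>Positivity at product trial vectors becomes, by symmetry of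
      \<open>ptf\<close>, positivity of the partial transpose of a product state.\<close>
    hence "0 \<le> ptf m n u (($) \<psi>)" by (intro ptf_product[where a="($) a" and b="($) b"]) (auto simp: kron_vec_index)
    hence "0 \<le> qf N W u" unfolding WG G_def \<psi>(2) N_def qf_ptrans_proj[OF c] by (simp add: ptf_commute)
    thus False using u by simp
  qed
  thus "\<exists>\<psi>. unit_vec (m*n) \<psi> \<and> entangled m n \<psi> \<and> W = ptrans m n (proj \<psi>)"
    using \<psi> WG unfolding G_def N_def by blast
qed

lemma purity_ptrans_proj:
  assumes "unit_vec (m*n) \<psi>" and W: "hermitian (ptrans m n (proj \<psi>))"
  shows "Re (trace (ptrans m n (proj \<psi>) * ptrans m n (proj \<psi>))) = 1"
proof -
  have c: "\<psi> \<in> carrier_vec (m*n)" "ip (m*n) (($) \<psi>) (($) \<psi>) = 1" using assms by (auto simp: unit_vec_iff)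
  have "(\<Sum>r<m*n. (cmod (\<psi> $ r))\<^sup>2) = 1" using c(2) by (metis Re_complex_of_real ip_self one_complex.sel(1))
  moreover have "(\<Sum>r<m*n. \<Sum>k<m*n. (cmod (proj \<psi> $$ (r,k)))\<^sup>2) = (\<Sum>r<m*n. (cmod (\<psi> $ r))\<^sup>2) * (\<Sum>r<m*n. (cmod (\<psi> $ r))\<^sup>2)"
    unfolding sum_product using c(1) by (intro sum.cong refl) (auto simp: proj_def norm_mult power_mult_distrib)
  ultimately show ?thesis
    unfolding sum_sq_entries(1)[OF W ptrans_carrier] sum_ptrans[where g="\<lambda>z. (cmod z)\<^sup>2"] by simp
qed

section \<open>The smallest eigenvalue and its extremal witnesses\<close>

lemma DEWs_last_eigval_ge:
  assumes W: "W \<in> DEWs m n" and m: "2 \<le> m"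
  shows "- (1/2) \<le> eigvals W ! (m*n-1)"
proof -
  have "- (1/2) \<le> (\<Sum>i\<in>{m*n-1}. eigvals W ! i)"
    using DEWs_basic(5)[OF W] m
    by (intro DEWs_eigvals_lower[OF W]) (auto intro!: ptf_ge1[where J="{m*n-1}", simplified])
  thus ?thesis by simp
qed

lemma sv_vec: "sv m n (($) (vec (m*n) \<psi>)) = sv m n \<psi>"
proof -
  have "vec (m*n) (($) (vec (m*n) \<psi>)) = vec (m*n) \<psi>" by (intro eq_vecI) auto
  thus ?thesis by (simp add: sv_def gram_def fun_eq_iff)
qed

lemma nonzero_schmidt_split:
  assumes "\<psi> \<in> carrier_vec (m*n)" "2 \<le> m"
  shows "nonzero_schmidt m n \<psi> = filter_mset (\<lambda>z. z \<noteq> 0) {#sv m n (($) \<psi>) 0#}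
    + filter_mset (\<lambda>z. z \<noteq> 0) {#sv m n (($) \<psi>) 1#} + filter_mset (\<lambda>z. z \<noteq> 0) (mset (map (sv m n (($) \<psi>)) [2..<m]))"
proof -
  have "[0..<m] = 0 # 1 # [2..<m]" using assms(2) by (simp add: upt_conv_Cons numeral_2_eq_2)
  thus ?thesis unfolding nonzero_schmidt_def schmidt_coeffs_sv[OF assms(1)] by (simp del: upt_Suc)
qed

text \<open>A multiset forgets positions; monotonicity restores them, since nonzero coefficients
  must precede zero ones. Two nonzero entries therefore sit at positions 0 and 1.\<close>

lemma nonzero_schmidt_half:
  assumes c: "\<psi> \<in> carrier_vec (m*n)" and m: "2 \<le> m"
  shows "nonzero_schmidt m n \<psi> = {#sqrt 2 / 2, sqrt 2 / 2#} \<longleftrightarrow>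
    sv m n (($) \<psi>) 0 = sqrt 2 / 2 \<and> sv m n (($) \<psi>) 1 = sqrt 2 / 2 \<and> (\<forall>p. 2 \<le> p \<and> p < m \<longrightarrow> sv m n (($) \<psi>) p = 0)"
    (is "?L = ?R")
proof
  define s where "s = sv m n (($) \<psi>)"
  note split = nonzero_schmidt_split[OF c m, folded s_def]
  show ?L if ?R
  proof -
    have "filter_mset (\<lambda>z. z \<noteq> 0) (mset (map s [2..<m])) = {#}"
      using that by (auto simp: filter_mset_empty_iff s_def)
    moreover have "s 0 = sqrt 2 / 2" "s 1 = sqrt 2 / 2" using that by (auto simp: s_def)
    ultimately have "nonzero_schmidt m n \<psi> = filter_mset (\<lambda>z. z \<noteq> 0) {#sqrt 2 / 2#}
        + filter_mset (\<lambda>z. z \<noteq> 0) {#sqrt 2 / 2#} + {#}" unfolding split by (simp only:)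
    thus ?thesis by simp
  qed
  assume L: ?L
  have nn: "0 \<le> s p" if "p < m" for p unfolding s_def by (rule sv_nonneg[OF that])
  have anti: "s q \<le> s p" if "p \<le> q" "q < m" for p q unfolding s_def by (rule sv_antimono[OF that])
  have s1: "s 1 \<noteq> 0"
  proof
    assume z: "s 1 = 0"
    have "s p = 0" if "2 \<le> p" "p < m" for p using anti[of 1 p] nn[of p] z that by simp
    hence fe: "filter_mset (\<lambda>z. z \<noteq> 0) (mset (map s [2..<m])) = {#}" by (auto simp: filter_mset_empty_iff)
    have "size (nonzero_schmidt m n \<psi>) \<le> 1" unfolding split z fe by simp
    thus False using L by simp
  qed
  hence s0: "s 0 \<noteq> 0" using anti[of 0 1] nn[of 1] m by force
  have "{#s 0#} + {#s 1#} + filter_mset (\<lambda>z. z \<noteq> 0) (mset (map s [2..<m])) = nonzero_schmidt m n \<psi>"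
    using s0 s1 unfolding split by simp
  hence e: "add_mset (s 0) (add_mset (s 1) (filter_mset (\<lambda>z. z \<noteq> 0) (mset (map s [2..<m])))) = {#sqrt 2 / 2, sqrt 2 / 2#}"
    unfolding L by (metis add_mset_add_single union_mset_add_mset_left empty_neutral(1) add.commute)
  have "s 0 \<in># {#sqrt 2 / 2, sqrt 2 / 2#}" "s 1 \<in># {#sqrt 2 / 2, sqrt 2 / 2#}" unfolding e[symmetric] by auto
  hence 01: "s 0 = sqrt 2 / 2" "s 1 = sqrt 2 / 2" by auto
  hence "filter_mset (\<lambda>z. z \<noteq> 0) (mset (map s [2..<m])) = {#}"
    using e by (simp only: add_mset_add_mset_same_iff)
  hence "s p = 0" if "2 \<le> p" "p < m" for p using that by (auto simp: filter_mset_empty_iff)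
  thus ?R using 01 unfolding s_def by blast
qed

lemma DEWs_last_eigval_eq:
  assumes W: "W \<in> DEWs m n" and m: "2 \<le> m"
  shows "eigvals W ! (m*n-1) = - (1/2) \<longleftrightarrow>
    (\<exists>\<psi>. unit_vec (m*n) \<psi> \<and> nonzero_schmidt m n \<psi> = {#sqrt 2 / 2, sqrt 2 / 2#} \<and> W = ptrans m n (proj \<psi>))"
proof
  assume "\<exists>\<psi>. unit_vec (m*n) \<psi> \<and> nonzero_schmidt m n \<psi> = {#sqrt 2 / 2, sqrt 2 / 2#} \<and> W = ptrans m n (proj \<psi>)"
  then obtain \<psi> where \<psi>: "unit_vec (m*n) \<psi>" "nonzero_schmidt m n \<psi> = {#sqrt 2 / 2, sqrt 2 / 2#}" "W = ptrans m n (proj \<psi>)"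
    by blast
  have c: "\<psi> \<in> carrier_vec (m*n)" using \<psi>(1) by (simp add: unit_vec_iff)
  obtain u where u: "ip (m*n) u u = 1" "ptf m n (($) \<psi>) u = - (1/2)"
    using ptf_attains_neg_half[OF m, of n "($) \<psi>"] \<psi>(2) nonzero_schmidt_half[OF c m] by blast
  note Wb = DEWs_basic[OF W]
  have "ons (m*n) {0::nat} (\<lambda>_. u)" using u by (simp add: ons_def)
  moreover have "{m*n-1..<m*n} = {m*n-1}" using Wb(5) by auto
  ultimately have "eigvals W ! (m*n-1) \<le> qf (m*n) W u"
    using ky_fan_lower[OF Wb(1,2), of "{0::nat}" "\<lambda>_. u" 1] Wb(5) by (simp add: Suc_le_eq)
  also have "\<dots> = - (1/2)" unfolding \<psi>(3) qf_ptrans_proj[OF c] by (rule u(2))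
  finally show "eigvals W ! (m*n-1) = - (1/2)" using DEWs_last_eigval_ge[OF W m] by simp
next
  assume eq: "eigvals W ! (m*n-1) = - (1/2)"
  define N where "N = m * n"
  obtain P Q where P: "psd P" "P \<in> carrier_mat N N" and Q: "psd Q" "Q \<in> carrier_mat N N"
    and WPQ: "W = P + ptrans m n Q" and tr: "Re (trace P) + Re (trace Q) = 1"
    unfolding N_def by (rule DEWsE[OF W]) blast
  note Wb = DEWs_basic[OF W, folded N_def]
  obtain \<psi> where o: "ons N {..<N} \<psi>"
    and ent: "\<And>r c. r < N \<Longrightarrow> c < N \<Longrightarrow> Q $$ (r,c) = (\<Sum>a<N. of_real (eigvals Q ! a) * \<psi> a r * cnj (\<psi> a c))"
    and qG: "\<And>u. qf N (ptrans m n Q) u = (\<Sum>a<N. eigvals Q ! a * ptf m n (\<psi> a) u)"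
    using qf_ptrans_spectral[OF psd_hermitian[OF Q(1)] Q(2)[unfolded N_def]] unfolding N_def by blast
  obtain u where u: "ons N {..<N} u" "\<And>i. i < N \<Longrightarrow> qf N W (u i) = eigvals W ! i"
    by (rule spectral_qf[OF Wb(1,2)]) blast
  define v where "v = u (N - 1)"
  have v: "ip N v v = 1" "qf N W v = - (1/2)"
    using u(2)[of "N-1"] onsD[OF u(1), of "N-1" "N-1"] Wb(5) eq by (auto simp: v_def N_def)
  define q where "q a = eigvals Q ! a" for a
  have q0: "0 \<le> q a" if "a < N" for a using psd_eigvals_nonneg[OF Q that] by (simp add: q_def)
  have trQ: "Re (trace Q) = (\<Sum>a<N. q a)" by (simp add: q_def trace_eigvals[OF psd_hermitian[OF Q(1)] Q(2)])
  have ge: "- (1/2) \<le> ptf m n (\<psi> a) v" if "a < N" for a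
    using ptf_ge1[of m n "\<psi> a" "{0::nat}" "\<lambda>_. v"] onsD[OF o, of a a] that v m by (simp add: N_def ons_def)
  \<comment> \<open>The minimal value -1/2 is moved to one side and split with weights
    \<open>tr P\<close> and \<open>tr Q\<close>. What remains is a sum of three nonnegative slacks,
    each of which must vanish.\<close>
  have "qf N P v + Re (trace P) / 2 + (\<Sum>a<N. q a * (ptf m n (\<psi> a) v + 1 / 2)) = 0"
  proof -
    have "(\<Sum>a<N. q a * (ptf m n (\<psi> a) v + 1 / 2)) = qf N (ptrans m n Q) v + Re (trace Q) / 2"
      unfolding qG trQ by (simp add: algebra_simps sum.distrib q_def sum_divide_distrib)
    moreover have "qf N P v + qf N (ptrans m n Q) v = - (1/2)"
      using v(2) unfolding WPQ N_def qf_add[OF P(2)[unfolded N_def] ptrans_carrier] .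
    ultimately show ?thesis using tr by simp
  qed
  moreover have "0 \<le> qf N P v" "0 \<le> Re (trace P)" by (rule psd_qf_nonneg[OF P] psd_trace_nonneg[OF P])+
  moreover have s0: "0 \<le> (\<Sum>a<N. q a * (ptf m n (\<psi> a) v + 1 / 2))"
  proof (intro sum_nonneg mult_nonneg_nonneg)
    fix a assume "a \<in> {..<N}"
    thus "0 \<le> q a" "0 \<le> ptf m n (\<psi> a) v + 1 / 2" using q0 ge[of a] by auto
  qed
  ultimately have z: "Re (trace P) = 0" "(\<Sum>a<N. q a * (ptf m n (\<psi> a) v + 1 / 2)) = 0" by linarith+
  have P0: "P = 0\<^sub>m N N" using psd_trace_zero[OF P] z by simp
  have WG: "W = ptrans m n Q" unfolding WPQ P0 N_def by simp
  have s1: "(\<Sum>a<N. q a) = 1" using z tr trQ by simp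
  have term0: "q a * (ptf m n (\<psi> a) v + 1 / 2) = 0" if "a < N" for a
  proof -
    have nn: "\<forall>a\<in>{..<N}. 0 \<le> q a * (ptf m n (\<psi> a) v + 1 / 2)"
    proof
      fix a assume "a \<in> {..<N}"
      thus "0 \<le> q a * (ptf m n (\<psi> a) v + 1 / 2)" using q0[of a] ge[of a] by (intro mult_nonneg_nonneg) auto
    qed
    thus ?thesis using z(2) that sum_nonneg_eq_0_iff[OF finite_lessThan, of N "\<lambda>a. q a * (ptf m n (\<psi> a) v + 1 / 2)"] by auto
  qed
  have half: "ptf m n (\<psi> a) v = - (1/2)" if "a < N" "q a \<noteq> 0" for a
    using term0[OF that(1)] that(2) by simp
  obtain a where a: "a < N" "q a \<noteq> 0" using s1 by (metis lessThan_iff sum.neutral zero_neq_one)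
  \<comment> \<open>Here \<open>v\<close> acts as the state and the eigenvectors of \<open>Q\<close>
    as trial vectors: two of them would give a total of -1, below the bound for two orthonormal
    vectors.\<close>
  have uniq: "q b = 0" if b: "b < N" "b \<noteq> a" for b
  proof (rule ccontr)
    assume nz: "q b \<noteq> 0"
    have J: "finite {a,b}" "ons N {a,b} \<psi>" "card {a,b} = 2"
      using ons_subset[OF o, of "{a,b}"] a b by auto
    have "(\<Sum>j\<in>{a,b}. ptf m n v (\<psi> j)) = - 1"
      using half[OF a] half[OF b(1) nz] b by (simp add: ptf_commute[of m n v])
    moreover have "- (sqrt 2 / 2) \<le> (\<Sum>j\<in>{a,b}. ptf m n v (\<psi> j))"
    proof (cases "m = 2")
      case True
      have "1 / 2 \<le> sqrt 2 / 2" by simp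
      thus ?thesis using ptf_ge_two[of n v "{a,b}" \<psi>] J v(1) True unfolding N_def by (metis minus_le_iff minus_minus order.trans)
    next
      case False
      thus ?thesis using ptf_ge2[of m n v "{a,b}" \<psi>] J v(1) m by (simp add: N_def)
    qed
    moreover have "sqrt 2 < 2" using real_sqrt_less_iff[of 2 4] by simp
    ultimately show False by linarith
  qed
  have "(\<Sum>b<N. q b) = (\<Sum>b<N. if b = a then q a else 0)" using uniq by (intro sum.cong) auto
  hence qa: "q a = 1" using s1 a(1) by simp
  define w where "w = vec N (\<psi> a)"
  have w: "unit_vec N w" "Q = proj w"
    using rank_one_from_eigvals[OF Q o ent a(1)] qa uniq by (auto simp: q_def w_def)
  have "nonzero_schmidt m n w = {#sqrt 2 / 2, sqrt 2 / 2#}"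
    using nonzero_schmidt_half[of w m n] ptf_eq_neg_half[of m n "\<psi> a" v] half[OF a] m v(1) onsD[OF o, of a a] a(1)
    by (auto simp: w_def N_def sv_vec)
  thus "\<exists>\<psi>. unit_vec (m*n) \<psi> \<and> nonzero_schmidt m n \<psi> = {#sqrt 2 / 2, sqrt 2 / 2#} \<and> W = ptrans m n (proj \<psi>)"
    using w WG unfolding N_def by blast
qed

section \<open>Bounds and examples for the negativity\<close>

lemma DEWs_negativity_pos:
  assumes W: "W \<in> DEWs m n"
  shows "0 < negativity W"
proof -
  note Wb = DEWs_basic[OF W]
  obtain u where u': "\<And>i. i < m*n \<Longrightarrow> qf (m*n) W (u i) = eigvals W ! i" and u'': "ons (m*n) {..<m*n} u"
    by (rule spectral_qf[OF Wb(1,2)]) blast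
  have u: "qf (m*n) W (u (m*n-1)) = eigvals W ! (m*n-1)" "ons (m*n) {..<m*n} u"
    using u' u'' Wb(5) by auto
  have "ons (m*n) {0::nat} (\<lambda>_. u (m*n-1))" using onsD[OF u(2), of "m*n-1" "m*n-1"] Wb(5) by (simp add: ons_def)
  from negativity_ge[OF Wb(1-3) _ this] show ?thesis using u(1) Wb(4) by simp
qed

lemma decomposable_negativity_le:
  assumes P: "psd P" "P \<in> carrier_mat (m*n) (m*n)" and Q: "psd Q" "Q \<in> carrier_mat (m*n) (m*n)"
    and tr: "trace P + trace Q = 1" and m: "0 < m"
  shows "negativity (P + ptrans m n Q) \<le> (real m - 1) / 2 * Re (trace Q)"
proof -
  define W where "W = P + ptrans m n Q"
  have W: "hermitian W" "W \<in> carrier_mat (m*n) (m*n)"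
    using block_positive_decomposable[OF P Q] by (auto simp: W_def block_positive_def)
  have t: "trace W = 1" using tr P Q by (simp add: W_def trace_add[of _ "m*n"] trace_ptrans)
  have "- ((real m - 1) / 2 * Re (trace Q)) \<le> (\<Sum>i | i < m*n \<and> eigvals W ! i < 0. eigvals W ! i)"
    unfolding W_def by (rule decomposable_eigvals_lower[OF P Q]) (auto intro!: ptf_ge_neg(1) m)
  thus ?thesis using negativity_eigvals[OF W t] by (simp add: W_def)
qed

lemma DEWs_negativity_le:
  assumes W: "W \<in> DEWs m n" and m: "0 < m"
  shows "negativity W \<le> (real m - 1) / 2"
proof -
  obtain P Q where P: "psd P" "P \<in> carrier_mat (m*n) (m*n)" and Q: "psd Q" "Q \<in> carrier_mat (m*n) (m*n)"
    and WPQ: "W = P + ptrans m n Q" and tr: "Re (trace P) + Re (trace Q) = 1" and t: "trace W = 1"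
    by (rule DEWsE[OF W]) blast
  have "trace P + trace Q = 1" using t P Q by (simp add: WPQ trace_add[of _ "m*n"] trace_ptrans)
  note decomposable_negativity_le[OF P Q this m, folded WPQ]
  also have "(real m - 1) / 2 * Re (trace Q) \<le> (real m - 1) / 2 * 1"
    using tr psd_trace_nonneg[OF P] m by (intro mult_left_mono) auto
  finally show ?thesis by simp
qed

text \<open>The positive part is |00><00|, which vanishes on all antisymmetric vectors and not only
  on one singlet. Each of the m(m-1)/2 vectors then has expectation \<open>- (t / m)\<close>, and
  their total meets the upper bound scaled by \<open>tr Q = t\<close>.\<close>

lemma negativity_example:
  assumes mn: "2 \<le> m" "m \<le> n" and t: "0 < t" "t \<le> 1"
  obtains W where "W \<in> DEWs m n" "negativity W = t * ((real m - 1) / 2)"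
proof -
  define N where "N = m * n"
  define x where "x = (\<lambda>_::nat. 1 / sqrt (real m))"
  define P where "P = of_real (1 - t) \<cdot>\<^sub>m proj (vec N (ket 0))"
  define Q where "Q = of_real t \<cdot>\<^sub>m proj (dvec m n 0 x)"
  have N0: "0 < N" using mn by (auto simp: N_def)
  have P: "psd P" "P \<in> carrier_mat N N" unfolding P_def using psd_smult[OF psd_proj[of "vec N (ket 0)" N] proj_carrier[of "vec N (ket 0)" N], of "1 - t"] t by (auto simp del: of_real_diff)
  have Q: "psd Q" "Q \<in> carrier_mat N N" unfolding Q_def using psd_smult[OF psd_proj[OF dvec_carrier] proj_carrier[OF dvec_carrier], of t m n 0 x] t by (auto simp: N_def)
  have uk: "unit_vec N (vec N (ket 0))"
  proof -
    have "ip N (($) (vec N (ket 0))) (($) (vec N (ket 0))) = ip N (ket 0) (ket 0)" by (intro ip_cong) auto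
    thus ?thesis using N0 by (simp add: unit_vec_iff ip_ket) (simp add: ket_def)
  qed
  have ud: "unit_vec N (dvec m n 0 x)" unfolding N_def using mn by (intro unit_dvec) (auto simp: x_def power_divide)
  have tr: "trace P = of_real (1 - t)" "trace Q = of_real t"
    unfolding P_def Q_def using trace_proj[OF uk] trace_proj[OF ud] 
    by (simp_all add: trace_smult[of _ N] N_def)
  define W where "W = P + ptrans m n Q"
  have q: "qf N W (antisymv n 0 p q) = - (t / real m)" if pq: "p < q" "q < m" for p q
  proof -
    have "0 < q * n" using pq mn by simp
    hence "antisymv n 0 p q 0 = 0" using pq by (auto simp: antisymv_def ket_def)
    moreover have "ip N (($) (vec N (ket 0))) (antisymv n 0 p q) = ip N (ket 0) (antisymv n 0 p q)" by (intro ip_cong) auto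
    ultimately have "qf N P (antisymv n 0 p q) = 0"
      unfolding P_def using N0 by (simp add: qf_smult[of _ N] qf_proj ip_ket del: of_real_diff)
    moreover have "qf N (ptrans m n Q) (antisymv n 0 p q) = - (t / real m)"
      unfolding Q_def N_def ptrans_smult[OF proj_carrier[OF dvec_carrier]] qf_smult[OF ptrans_carrier] qf_ptrans_proj[OF dvec_carrier]
      using ptf_dvec_antisymv[of m 0 n p q x] pq mn by (simp add: x_def)
    ultimately show ?thesis
      unfolding W_def N_def qf_add[OF P(2)[unfolded N_def] ptrans_carrier] by simp
  qed
  have "0 < t / real m" using t mn by simp
  hence "qf N W (antisymv n 0 0 1) < 0" using q[of 0 1] mn by simp
  hence WD: "W \<in> DEWs m n"
    unfolding W_def using P Q tr by (intro DEWs_intro) (auto simp: N_def)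
  note Wb = DEWs_basic[OF WD, folded N_def]
  define J where "J = (SIGMA q:{..<m}. {..<q})"
  have J: "finite J" "ons N J (\<lambda>(q,p). antisymv n 0 p q)"
    unfolding J_def ons_def N_def using mn by (auto simp: ip_antisymv_antisymv[where m=m])
  have "(\<Sum>j\<in>J. qf N W (case j of (q,p) \<Rightarrow> antisymv n 0 p q)) = (\<Sum>q<m. \<Sum>p<q. - (t / real m))"
  proof -
    have "(\<Sum>j\<in>J. qf N W (case j of (q,p) \<Rightarrow> antisymv n 0 p q)) = (\<Sum>(q,p)\<in>J. qf N W (antisymv n 0 p q))"
      by (simp add: split_def)
    also have "\<dots> = (\<Sum>q<m. \<Sum>p<q. qf N W (antisymv n 0 p q))"
      unfolding J_def by (rule sum.Sigma[symmetric]) auto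
    finally show ?thesis by (simp add: q)
  qed
  also have "\<dots> = - (t * (\<Sum>q<m. \<Sum>p<q. x p * x q))"
    using mn by (simp add: x_def sum_distrib_left sum_negf mult.commute)
  also have "(\<Sum>q<m. \<Sum>p<q. x p * x q) = (real m - 1) / 2"
    unfolding sum_mult_triangle using mn by (simp add: x_def power_divide real_div_sqrt)
  finally have "t * ((real m - 1) / 2) \<le> negativity W"
    using negativity_ge[OF Wb(1-3) J] by simp
  moreover have "negativity W \<le> (real m - 1) / 2 * t"
    using decomposable_negativity_le[of P m n Q] P Q tr mn unfolding W_def N_def by simp
  ultimately show ?thesis using that[OF WD] by (simp add: mult.commute)
qed

text \<open>Translates 1-based positions of eigenvalues into list indices.\<close>

lemma sum_lam:
  fixes k N :: nat
  assumes "1 \<le> k"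
  shows "(\<Sum>i=k..N. f (i - 1)) = (\<Sum>i=k-1..<N. f i)"
  using assms by (intro sum.reindex_bij_witness[where i=Suc and j="\<lambda>i. i - 1"]) auto

text \<open>In an upper bound \<open>P\<close> is no longer harmless. It contributes at most
  \<open>tr P\<close>, and since the constant for pure states is at least 1, both parts are bounded
  by that constant times their trace.\<close>

lemma DEWs_two_largest_le:
  assumes W: "W \<in> DEWs 2 n" and n: "2 \<le> n"
  shows "eigvals W ! 0 + eigvals W ! 1 \<le> (1 + sqrt 2) / 2"
proof -
  obtain P Q where P: "psd P" "P \<in> carrier_mat (2*n) (2*n)" and Q: "psd Q" "Q \<in> carrier_mat (2*n) (2*n)"
    and WPQ: "W = P + ptrans 2 n Q" and tr: "Re (trace P) + Re (trace Q) = 1"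
    by (rule DEWsE[OF W]) blast
  note Wb = DEWs_basic[OF W]
  obtain \<psi> where o: "ons (2*n) {..<2*n} \<psi>"
    and qG: "\<And>u. qf (2*n) (ptrans 2 n Q) u = (\<Sum>a<2*n. eigvals Q ! a * ptf 2 n (\<psi> a) u)"
    by (rule qf_ptrans_spectral[OF psd_hermitian[OF Q(1)] Q(2)]) blast
  obtain u where u: "ons (2*n) {..<2*n} u" "\<And>i. i < 2*n \<Longrightarrow> qf (2*n) W (u i) = eigvals W ! i"
    by (rule spectral_qf[OF Wb(1,2)]) blast
  have J: "finite {0,1::nat}" "ons (2*n) {0,1} u" "card {0,1::nat} = 2"
    using ons_subset[OF u(1), of "{0,1}"] n by auto
  have "eigvals W ! 0 + eigvals W ! 1 = (\<Sum>j\<in>{0,1}. qf (2*n) W (u j))" using u(2)[of 0] u(2)[of 1] n by simp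
  also have "\<dots> = (\<Sum>j\<in>{0,1}. qf (2*n) P (u j)) + (\<Sum>j\<in>{0,1}. qf (2*n) (ptrans 2 n Q) (u j))"
    unfolding WPQ by (simp add: qf_add[OF P(2) ptrans_carrier])
  also have "(\<Sum>j\<in>{0,1}. qf (2*n) P (u j)) \<le> Re (trace P) * ((1 + sqrt 2) / 2)"
  proof -
    have "(\<Sum>j\<in>{0,1}. qf (2*n) P (u j)) \<le> Re (trace P) * 1" using sum_qf_le_trace[OF P J(1,2)] by simp
    also have "\<dots> \<le> Re (trace P) * ((1 + sqrt 2) / 2)" using psd_trace_nonneg[OF P] by (intro mult_left_mono) auto
    finally show ?thesis .
  qed
  also have "(\<Sum>j\<in>{0,1}. qf (2*n) (ptrans 2 n Q) (u j)) = (\<Sum>a<2*n. eigvals Q ! a * (\<Sum>j\<in>{0,1}. ptf 2 n (\<psi> a) (u j)))"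
    unfolding qG sum_distrib_left by (rule sum.swap)
  also have "\<dots> \<le> (\<Sum>a<2*n. eigvals Q ! a * ((1 + sqrt 2) / 2))"
    using onsD[OF o] by (intro sum_mono mult_left_mono psd_eigvals_nonneg[OF Q] ptf_upper_two J) auto
  also have "\<dots> = Re (trace Q) * ((1 + sqrt 2) / 2)"
    unfolding sum_distrib_right[symmetric] by (simp add: trace_eigvals[OF psd_hermitian[OF Q(1)] Q(2)])
  also have "Re (trace P) * ((1 + sqrt 2) / 2) + Re (trace Q) * ((1 + sqrt 2) / 2) = (1 + sqrt 2) / 2"
    unfolding distrib_right[symmetric] tr by simp
  finally show ?thesis by simp
qed

lemma ptrans_proj_DEWs:
  assumes u: "unit_vec (m*n) \<psi>" and neg: "ptf m n (($) \<psi>) v < 0"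
  shows "ptrans m n (proj \<psi>) \<in> DEWs m n"
proof -
  have c: "\<psi> \<in> carrier_vec (m*n)" using u by (simp add: unit_vec_iff)
  have "0\<^sub>m (m*n) (m*n) + ptrans m n (proj \<psi>) \<in> DEWs m n"
    by (rule DEWs_intro[where v=v])
       (use c neg trace_proj[OF u] in \<open>auto simp: psd_zero psd_proj trace_def qf_ptrans_proj\<close>)
  thus ?thesis by simp
qed

lemma schmidt_dvec:
  assumes mn: "m \<le> n" and x: "\<And>i. i < m \<Longrightarrow> 0 \<le> x i"
  shows "schmidt_coeffs m n (dvec m n 0 x) = mset (map x [0..<m])"
proof -
  define \<psi> where "\<psi> = dvec m n 0 x"
  have e: "vec (m*n) (($) \<psi>) = \<psi>" by (intro eq_vecI) (auto simp: \<psi>_def dvec_def)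
  have k: "ons m {..<m} ket" by (auto simp: ons_def ip_ket) (auto simp: ket_def)
  have "mset (eigvals (gram m n (($) \<psi>))) = mset (map (\<lambda>i. (x i)\<^sup>2) [0..<m])"
  proof (rule mset_eigvals_diag[OF k gram_carrier])
    fix i l assume il: "i < m" "l < m"
    have "gram m n (($) \<psi>) $$ (i,l) = (\<Sum>j<n. if j = i then if i = l then of_real ((x i)\<^sup>2) else 0 else 0)"
      unfolding gram_entry[OF il] using il by (intro sum.cong) (auto simp: \<psi>_def dvec_index power2_eq_square)
    also have "\<dots> = (if i = l then of_real ((x i)\<^sup>2) else 0)" using il mn by simp
    also have "\<dots> = (\<Sum>p<m. if p = i then if i = l then of_real ((x i)\<^sup>2) else 0 else 0)" using il by simp
    also have "\<dots> = (\<Sum>p<m. of_real ((x p)\<^sup>2) * ket p i * cnj (ket p l))"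
      by (intro sum.cong) (auto simp: ket_def)
    finally show "gram m n (($) \<psi>) $$ (i,l) = (\<Sum>p<m. of_real ((x p)\<^sup>2) * ket p i * cnj (ket p l))" .
  qed
  hence "mset (map sqrt (eigvals (gram m n (($) \<psi>)))) = image_mset sqrt (mset (map (\<lambda>i. (x i)\<^sup>2) [0..<m]))" by simp
  also have "\<dots> = mset (map (\<lambda>i. sqrt ((x i)\<^sup>2)) [0..<m])" by (simp add: multiset.map_comp o_def)
  also have "map (\<lambda>i. sqrt ((x i)\<^sup>2)) [0..<m] = map x [0..<m]" using x by auto
  finally show ?thesis unfolding schmidt_coeffs_def \<psi>_def[symmetric] gram_def e Let_def .
qed

lemma nonzero_schmidt_dvec:
  assumes mn: "k \<le> m" "m \<le> n" and x: "\<And>i. i < k \<Longrightarrow> 0 < x i" "\<And>i. k \<le> i \<Longrightarrow> x i = 0"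
  shows "nonzero_schmidt m n (dvec m n 0 x) = mset (map x [0..<k])"
proof -
  have nn: "0 \<le> x i" for i using x by (cases "i < k") (auto intro: less_imp_le)
  have "[0..<m] = [0..<k] @ [k..<m]" using mn by (metis le0 le_add_diff_inverse upt_add_eq_append)
  moreover have "filter_mset (\<lambda>z. z \<noteq> 0) (mset (map x [0..<k])) = mset (map x [0..<k])"
    using x(1) by (subst filter_mset_eq_conv) force
  moreover have "filter_mset (\<lambda>z. z \<noteq> 0) (mset (map x [k..<m])) = {#}"
    using x(2) by (auto simp: filter_mset_empty_iff)
  ultimately show ?thesis
    unfolding nonzero_schmidt_def schmidt_dvec[OF mn(2) nn] by (simp del: mset_map mset_upt)
qed

text \<open>Each pair in \<open>J\<close> selects one negative eigenvector of the partial transpose;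
  Ky Fan's principle compares their eigenvalues with the \<open>k\<close> smallest.\<close>

lemma trial_lower:
  assumes mn: "m \<le> n" and x: "(\<Sum>i<m. (x i)\<^sup>2) = 1" and J: "finite J" "\<And>p q. (p,q) \<in> J \<Longrightarrow> p < q \<and> q < m"
    and D: "ptrans m n (proj (dvec m n 0 x)) \<in> DEWs m n" and k: "card J = k" "1 \<le> k" "k \<le> m*n"
  shows "(\<Sum>i=m*n-k..<m*n. eigvals (ptrans m n (proj (dvec m n 0 x))) ! i) \<le> - (\<Sum>(p,q)\<in>J. x p * x q)"
proof -
  define W where "W = ptrans m n (proj (dvec m n 0 x))"
  note Wb = DEWs_basic[OF D, folded W_def]
  have "ons (m*n) J (\<lambda>(p,q). antisymv n 0 p q)"
    unfolding ons_def
  proof (intro ballI)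
    fix i j assume ij: "i \<in> J" "j \<in> J"
    obtain p q p' q' where e: "i = (p,q)" "j = (p',q')" by (cases i, cases j)
    thus "ip (m*n) (case i of (p,q) \<Rightarrow> antisymv n 0 p q) (case j of (p,q) \<Rightarrow> antisymv n 0 p q) = (if i = j then 1 else 0)"
      using ij J(2)[of p q] J(2)[of p' q'] mn by (simp add: ip_antisymv_antisymv[where m=m])
  qed
  from ky_fan_lower[OF Wb(1,2) J(1) this k]
  have "(\<Sum>i=m*n-k..<m*n. eigvals W ! i) \<le> (\<Sum>j\<in>J. qf (m*n) W (case j of (p,q) \<Rightarrow> antisymv n 0 p q))" .
  also have "\<dots> = (\<Sum>(p,q)\<in>J. - (x p * x q))"
    using J(2) mn unfolding W_def by (intro sum.cong refl) (auto simp: qf_ptrans_proj ptf_dvec_antisymv)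
  finally show ?thesis by (simp add: W_def sum_negf split_def)
qed

section \<open>Maximal negativity\<close>

text \<open>In the equality case of the negativity bound, the span of the family contains all antisymmetric
  vectors and is orthogonal to all symmetric ones.\<close>

lemma maximal_negativity_structure:
  fixes \<psi> :: "nat \<Rightarrow> complex" and m n :: nat
  defines "c \<equiv> \<lambda>i j. of_real (sqrt (real m)) * \<psi> (i*n+j)"
  defines "f \<equiv> \<lambda>p q x. if x div n = p then c q (x mod n) else 0"
  assumes m: "0 < m" and J: "finite J" "ons (m*n) J v"
    and gram: "\<And>i k. i < m \<Longrightarrow> k < m \<Longrightarrow> (\<Sum>j<n. \<psi> (i*n+j) * cnj (\<psi> (k*n+j))) = (if i = k then 1 / of_nat m else 0)"
    and eq: "(\<Sum>j\<in>J. ptf m n \<psi> (v j)) = - ((real m - 1) / 2)"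
  shows "\<And>p j. p < m \<Longrightarrow> j \<in> J \<Longrightarrow> ip (m*n) (v j) (f p p) = 0"
    and "\<And>p q j. p < q \<Longrightarrow> q < m \<Longrightarrow> j \<in> J \<Longrightarrow> ip (m*n) (v j) (\<lambda>x. f p q x + f q p x) = 0"
    and "\<And>p q x. p < q \<Longrightarrow> q < m \<Longrightarrow> x < m*n \<Longrightarrow> f p q x - f q p x = (\<Sum>j\<in>J. ip (m*n) (v j) (\<lambda>x. f p q x - f q p x) * v j x)"
proof -
  define N where "N = m * n"
  note J = J[folded N_def]
  have cc: "ip n (c i) (c k) = (if i = k then 1 else 0)" if "i < m" "k < m" for i k
  proof -
    have "ip n (c i) (c k) = of_real (sqrt (real m)) * of_real (sqrt (real m)) * (\<Sum>j<n. \<psi> (k*n+j) * cnj (\<psi> (i*n+j)))"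
      unfolding c_def ip_scale_left ip_scale_right by (simp add: ip_def mult_ac)
    also have "of_real (sqrt (real m)) * of_real (sqrt (real m)) = (of_nat m :: complex)"
      unfolding of_real_mult[symmetric] by simp
    finally show ?thesis using gram[OF that(2,1)] m by auto
  qed
  have ff: "ip N (f p q) g = ip n (c q) (\<lambda>l. g (p*n+l))" if "p < m" for p q g
  proof -
    have "ip N (f p q) g = (\<Sum>i<m. if i = p then ip n (c q) (\<lambda>l. g (p*n+l)) else 0)"
      unfolding N_def ip_prod_index by (intro sum.cong refl) (auto simp: f_def ip_def)
    thus ?thesis using that by simp
  qed
  have fo: "ip N (f p q) (f p' q') = (if p = p' \<and> q = q' then 1 else 0)"
    if "p < m" "q < m" "p' < m" "q' < m" for p q p' q'
  proof -
    have "ip N (f p q) (f p' q') = (if p = p' then ip n (c q) (c q') else 0)"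
      unfolding ff[OF that(1)] by (auto simp: f_def ip_def)
    thus ?thesis using cc that by simp
  qed
  define X where "X p q j = ip N (f p q) (v j)" for p q j
  have row: "of_real (sqrt (real m)) * rowip n \<psi> u i k = ip N (f k i) u" if "k < m" for i k u
    unfolding ff[OF that] unfolding rowip_def c_def ip_scale_left by simp
  have form: "real m * ptf m n \<psi> u = (\<Sum>p<m. \<Sum>q<m. Re (cnj (ip N (f p q) u) * ip N (f q p) u))" for u
  proof -
    have mm: "complex_of_real (real m) = of_real (sqrt (real m)) * of_real (sqrt (real m))"
      unfolding of_real_mult[symmetric] by simp
    have "of_real (real m) * (\<Sum>i<m. \<Sum>k<m. cnj (rowip n \<psi> u k i) * rowip n \<psi> u i k)
       = (\<Sum>i<m. \<Sum>k<m. cnj (of_real (sqrt (real m)) * rowip n \<psi> u k i) * (of_real (sqrt (real m)) * rowip n \<psi> u i k))"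
      unfolding mm by (simp add: sum_distrib_left mult_ac)
    also have "\<dots> = (\<Sum>i<m. \<Sum>k<m. cnj (ip N (f i k) u) * ip N (f k i) u)"
      by (intro sum.cong refl) (simp add: row)
    finally have "Re (of_real (real m) * (\<Sum>i<m. \<Sum>k<m. cnj (rowip n \<psi> u k i) * rowip n \<psi> u i k))
       = (\<Sum>p<m. \<Sum>q<m. Re (cnj (ip N (f p q) u) * ip N (f q p) u))" by simp
    thus ?thesis unfolding Re_of_real_mult ptf_def .
  qed
  define \<delta> where "\<delta> p = (\<Sum>j\<in>J. (cmod (X p p j))\<^sup>2)" for p
  define \<beta> where "\<beta> p q = (\<Sum>j\<in>J. (cmod (X p q j + X q p j))\<^sup>2)" for p q
  define \<alpha> where "\<alpha> p q = (\<Sum>j\<in>J. (cmod (X p q j - X q p j))\<^sup>2)" for p q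
  have nn: "0 \<le> \<delta> p" "0 \<le> \<beta> p q" for p q by (auto simp: \<delta>_def \<beta>_def intro: sum_nonneg)
  have \<alpha>2: "\<alpha> p q \<le> 2" if "p < q" "q < m" for p q
  proof -
    have "\<alpha> p q \<le> Re (ip N (\<lambda>x. f p q x - f q p x) (\<lambda>x. f p q x - f q p x))"
      using bessel_family[OF J, of "\<lambda>x. f p q x - f q p x"] unfolding \<alpha>_def X_def by (simp add: ip_diff_left)
    also have "\<dots> = 2" using that by (simp add: ip_diff_left ip_diff_right fo)
    finally show ?thesis .
  qed
  have "real m * (\<Sum>j\<in>J. ptf m n \<psi> (v j)) = (\<Sum>p<m. \<Sum>q<m. \<Sum>j\<in>J. Re (cnj (X p q j) * X q p j))"
    unfolding sum_distrib_left form X_def by (rule sum_swap3)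
  also have "\<dots> = (\<Sum>p<m. \<delta> p) + (\<Sum>q<m. \<Sum>p<q. (\<Sum>j\<in>J. Re (cnj (X p q j) * X q p j)) + (\<Sum>j\<in>J. Re (cnj (X q p j) * X p q j)))"
    unfolding sum_square_split by (simp add: \<delta>_def cnj_mult_cmod(1) del: of_real_power)
  \<comment> \<open>Here \<alpha> and \<beta> are not halved and range up to 2. The form chosen
    exhibits two nonnegative slacks; the subtracted ones add up to m(m-1)/2 and cancel against
    \<open>m\<close> times the assumed total.\<close>
  also have "(\<Sum>q<m. \<Sum>p<q. (\<Sum>j\<in>J. Re (cnj (X p q j) * X q p j)) + (\<Sum>j\<in>J. Re (cnj (X q p j) * X p q j)))
      = (\<Sum>q<m. \<Sum>p<q. \<beta> p q / 2 + (2 - \<alpha> p q) / 2 - 1)"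
  proof (intro sum.cong refl)
    fix p q
    have "Re (cnj (X q p j) * X p q j) = Re (cnj (X p q j) * X q p j)" for j by (simp add: mult.commute)
    moreover have "\<beta> p q - \<alpha> p q = 4 * (\<Sum>j\<in>J. Re (cnj (X p q j) * X q p j))"
      unfolding \<alpha>_def \<beta>_def sum_subtractf[symmetric] sum_distrib_left
      by (intro sum.cong refl) (unfold cmod_polar, linarith)
    ultimately show "(\<Sum>j\<in>J. Re (cnj (X p q j) * X q p j)) + (\<Sum>j\<in>J. Re (cnj (X q p j) * X p q j)) = \<beta> p q / 2 + (2 - \<alpha> p q) / 2 - 1"
      by (simp add: field_simps)
  qed
  also have "\<dots> = (\<Sum>q<m. \<Sum>p<q. \<beta> p q / 2 + (2 - \<alpha> p q) / 2) - (\<Sum>q<m. \<Sum>p<q. 1 * 1)"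
    by (simp add: sum_subtractf)
  also have "(\<Sum>q<m. \<Sum>p<q. 1 * 1 :: real) = real m * (real m - 1) / 2"
    using sum_mult_triangle[of "\<lambda>_. 1" m] by (simp add: power2_eq_square algebra_simps)
  finally have z: "(\<Sum>p<m. \<delta> p) + (\<Sum>q<m. \<Sum>p<q. \<beta> p q / 2 + (2 - \<alpha> p q) / 2) = 0"
    unfolding eq by simp
  have n2: "0 \<le> (\<Sum>p<m. \<delta> p)" "0 \<le> (\<Sum>q<m. \<Sum>p<q. \<beta> p q / 2 + (2 - \<alpha> p q) / 2)"
    using nn \<alpha>2 by (auto intro!: sum_nonneg add_nonneg_nonneg)
  hence z1: "(\<Sum>p<m. \<delta> p) = 0" and z2: "(\<Sum>q<m. \<Sum>p<q. \<beta> p q / 2 + (2 - \<alpha> p q) / 2) = 0"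
    using z by linarith+
  have d0: "\<delta> p = 0" if "p < m" for p using z1 nn that by (simp add: sum_nonneg_eq_0_iff)
  have ba: "\<beta> p q = 0 \<and> \<alpha> p q = 2" if pq: "p < q" "q < m" for p q
  proof -
    have t: "0 \<le> \<beta> p q / 2 + (2 - \<alpha> p q) / 2" if "p < q" "q < m" for p q using nn(2)[of p q] \<alpha>2[OF that] by simp
    have "(\<Sum>p<q. \<beta> p q / 2 + (2 - \<alpha> p q) / 2) = 0"
    proof -
      have "\<forall>q\<in>{..<m}. 0 \<le> (\<Sum>p<q. \<beta> p q / 2 + (2 - \<alpha> p q) / 2)"
        by (intro ballI sum_nonneg t) auto
      thus ?thesis
        using z2 pq sum_nonneg_eq_0_iff[OF finite_lessThan, of m "\<lambda>q. \<Sum>p<q. \<beta> p q / 2 + (2 - \<alpha> p q) / 2"] by blast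
    qed
    hence "\<beta> p q / 2 + (2 - \<alpha> p q) / 2 = 0"
      using pq t by (subst (asm) sum_nonneg_eq_0_iff) auto
    hence "\<beta> p q + (2 - \<alpha> p q) = 0" by (simp add: field_simps)
    thus ?thesis using nn(2)[of p q] \<alpha>2[OF pq] by auto
  qed
  show "ip (m*n) (v j) (f p p) = 0" if "p < m" "j \<in> J" for p j
  proof -
    have "X p p j = 0" using d0[OF that(1)] that(2) J(1) unfolding \<delta>_def by (simp add: sum_nonneg_eq_0_iff)
    thus ?thesis unfolding X_def N_def by (metis cnj_ip complex_cnj_zero)
  qed
  show "ip (m*n) (v j) (\<lambda>x. f p q x + f q p x) = 0" if "p < q" "q < m" "j \<in> J" for p q j
  proof -
    have "X p q j + X q p j = 0" using ba[OF that(1,2)] that(3) J(1) unfolding \<beta>_def by (simp add: sum_nonneg_eq_0_iff)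
    hence "ip N (\<lambda>x. f p q x + f q p x) (v j) = 0" by (simp add: X_def ip_add_left)
    thus ?thesis unfolding N_def by (metis cnj_ip complex_cnj_zero)
  qed
  \<comment> \<open>Since \<alpha> equals the full squared norm 2 of this vector, the equality case
    of Bessel's inequality puts it into the span of the family.\<close>
  show "f p q x - f q p x = (\<Sum>j\<in>J. ip (m*n) (v j) (\<lambda>x. f p q x - f q p x) * v j x)" if "p < q" "q < m" "x < m*n" for p q x
  proof (rule bessel_eq[OF J(1) J(2)[unfolded N_def] _ that(3)])
    have "(\<Sum>j\<in>J. (cmod (ip (m*n) (v j) (\<lambda>x. f p q x - f q p x)))\<^sup>2) = \<alpha> p q"
      unfolding \<alpha>_def X_def ip_diff_left[symmetric] N_def by (simp add: cmod_ip_commute)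
    also have "\<dots> = 2" using ba[OF that(1,2)] by simp
    also have "2 = Re (ip (m*n) (\<lambda>x. f p q x - f q p x) (\<lambda>x. f p q x - f q p x))"
      using that fo unfolding N_def by (simp add: ip_diff_left ip_diff_right)
    finally show "(\<Sum>j\<in>J. (cmod (ip (m*n) (v j) (\<lambda>x. f p q x - f q p x)))\<^sup>2)
      = Re (ip (m*n) (\<lambda>x. f p q x - f q p x) (\<lambda>x. f p q x - f q p x))" .
  qed
qed

text \<open>Antisymmetric vectors of one maximally entangled vector are thus orthogonal to the symmetric vectors
  of another one, which makes the overlap matrix of the two isometries a multiple of the identity.\<close>

lemma maximal_negativity_orthogonal:
  assumes m: "2 \<le> m" and J: "finite J" "ons (m*n) J v"
    and g1: "\<And>i k. i < m \<Longrightarrow> k < m \<Longrightarrow> (\<Sum>j<n. \<psi> (i*n+j) * cnj (\<psi> (k*n+j))) = (if i = k then 1 / of_nat m else 0)"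
    and e1: "(\<Sum>j\<in>J. ptf m n \<psi> (v j)) = - ((real m - 1) / 2)"
    and g2: "\<And>i k. i < m \<Longrightarrow> k < m \<Longrightarrow> (\<Sum>j<n. \<phi> (i*n+j) * cnj (\<phi> (k*n+j))) = (if i = k then 1 / of_nat m else 0)"
    and e2: "(\<Sum>j\<in>J. ptf m n \<phi> (v j)) = - ((real m - 1) / 2)"
    and orth: "ip (m*n) \<psi> \<phi> = 0" and ik: "i < m" "k < m"
  shows "ip n (\<lambda>j. \<psi> (i*n+j)) (\<lambda>j. \<phi> (k*n+j)) = 0"
proof -
  define N where "N = m * n"
  define s where "s = complex_of_real (sqrt (real m))"
  have s0: "s \<noteq> 0" using m by (simp add: s_def)
  define c where "c i j = s * \<psi> (i*n+j)" for i j
  define d where "d i j = s * \<phi> (i*n+j)" for i j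
  define f where "f p q x = (if x div n = p then c q (x mod n) else 0)" for p q x
  define h where "h p q x = (if x div n = p then d q (x mod n) else 0)" for p q x
  have m0: "0 < m" using m by simp
  have S1: "f p q x - f q p x = (\<Sum>j\<in>J. ip (m*n) (v j) (\<lambda>x. f p q x - f q p x) * v j x)"
    if "p < q" "q < m" "x < m*n" for p q x
    by (rule maximal_negativity_structure(3)[OF m0 J _ e1 that, folded s_def, folded c_def, folded f_def]) (rule g1)
  have S2: "ip (m*n) (v j) (h p p) = 0" if "p < m" "j \<in> J" for p j
    by (rule maximal_negativity_structure(1)[OF m0 J _ e2 that, folded s_def, folded d_def, folded h_def]) (rule g2)
  have S3: "ip (m*n) (v j) (\<lambda>x. h p q x + h q p x) = 0" if "p < q" "q < m" "j \<in> J" for p q j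
    by (rule maximal_negativity_structure(2)[OF m0 J _ e2 that, folded s_def, folded d_def, folded h_def]) (rule g2)
  \<comment> \<open>Both states share the family \<open>v\<close>: its span contains the
    antisymmetric vectors of the first state, while the symmetric vectors of the second are
    orthogonal to it.\<close>
  have anti: "ip N (\<lambda>x. f p q x - f q p x) w = 0" if pq: "p < q" "q < m" and w: "\<And>j. j \<in> J \<Longrightarrow> ip N (v j) w = 0" for p q w
  proof -
    have "ip N (\<lambda>x. f p q x - f q p x) w = ip N (\<lambda>x. \<Sum>j\<in>J. ip N (v j) (\<lambda>x. f p q x - f q p x) * v j x) w"
      using S1[OF pq] unfolding N_def by (intro ip_cong) auto
    also have "\<dots> = 0" unfolding ip_sum_left by (simp add: w)
    finally show ?thesis .
  qed
  have fh: "ip N (f p q) (h p' q') = (if p = p' then ip n (c q) (d q') else 0)" if "p < m" for p q p' q'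
  proof -
    have "ip N (f p q) (h p' q') = (\<Sum>i<m. if i = p then (if p = p' then ip n (c q) (d q') else 0) else 0)"
      unfolding N_def ip_prod_index by (intro sum.cong refl) (auto simp: f_def h_def ip_def)
    thus ?thesis using that by simp
  qed
  \<comment> \<open>Testing against \<open>h p p\<close> isolates off-diagonal entries of the
    overlap matrix; testing against \<open>h p q + h q p\<close> below compares two diagonal
    ones.\<close>
  have off: "ip n (c q) (d p) = 0" "ip n (c p) (d q) = 0" if pq: "p < q" "q < m" for p q
  proof -
    have "ip N (\<lambda>x. f p q x - f q p x) (h p p) = 0" using anti[OF pq] S2[of p] pq unfolding N_def by simp
    thus "ip n (c q) (d p) = 0" using pq by (simp add: ip_diff_left fh)
    have "ip N (\<lambda>x. f p q x - f q p x) (h q q) = 0" using anti[OF pq] S2[of q] pq unfolding N_def by simp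
    thus "ip n (c p) (d q) = 0" using pq by (simp add: ip_diff_left fh)
  qed
  have dg: "ip n (c q) (d q) = ip n (c p) (d p)" if pq: "p < q" "q < m" for p q
  proof -
    have "ip N (\<lambda>x. f p q x - f q p x) (\<lambda>x. h p q x + h q p x) = 0" using anti[OF pq] S3[OF pq] unfolding N_def by simp
    thus ?thesis using pq by (simp add: ip_diff_left ip_add_right fh)
  qed
  have cd: "ip n (c i) (d k) = cnj s * s * ip n (\<lambda>j. \<psi> (i*n+j)) (\<lambda>j. \<phi> (k*n+j))" for i k
    unfolding c_def d_def ip_scale_left ip_scale_right by (simp add: mult_ac)
  \<comment> \<open>The trace of the overlap matrix is a multiple of the inner product of the two
    states, which is 0; so the common diagonal entry is 0 as well.\<close>
  have "(\<Sum>i<m. ip n (c i) (d i)) = cnj s * s * ip (m*n) \<psi> \<phi>"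
    unfolding cd ip_prod_index sum_distrib_left ..
  also have "\<dots> = 0" by (simp add: orth)
  finally have "(\<Sum>i<m. ip n (c 0) (d 0)) = 0"
    using dg[of 0] by (metis (no_types, lifting) gr_zeroI lessThan_iff sum.cong)
  hence "ip n (c 0) (d 0) = 0" using m by simp
  hence "ip n (c i) (d k) = 0"
    using dg[of 0] off ik by (metis gr_zeroI linorder_neqE_nat)
  thus ?thesis unfolding cd using s0 by simp
qed

lemma Phi_dvec:
  assumes "1 \<le> j" "j \<le> n div m"
  shows "Phi m n j = dvec m n ((j-1)*m) (\<lambda>_. 1 / sqrt (real m))" "m + (j-1)*m \<le> n"
proof -
  have "j * m \<le> n" using assms(2) by (metis div_times_less_eq_dividend dual_order.trans mult_le_mono1)
  moreover have "j * m = m + (j - 1) * m" using assms(1) by (cases j) auto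
  ultimately show le: "m + (j-1)*m \<le> n" by simp
  show "Phi m n j = dvec m n ((j-1)*m) (\<lambda>_. 1 / sqrt (real m))"
  proof (rule eq_vecI)
    fix r assume "r < dim_vec (dvec m n ((j-1)*m) (\<lambda>_. 1 / sqrt (real m)))"
    hence "r < m * n" by (simp add: dvec_def)
    then obtain i l where il: "i < m" "l < n" "r = i * n + l" by (rule prod_indexE)
    have "(\<exists>i'<m. r = i'*n + (i' + (j-1)*m)) \<longleftrightarrow> l = i + (j-1)*m"
    proof
      assume "\<exists>i'<m. r = i'*n + (i' + (j-1)*m)"
      then obtain i' where i': "i' < m" "r = i'*n + (i' + (j-1)*m)" by blast
      have "i' + (j-1)*m < n" using i' le by linarith
      thus "l = i + (j-1)*m" using index_eq_iff[of l n "i' + (j-1)*m" i i'] il i' by auto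
    qed (use il in auto)
    thus "Phi m n j $ r = dvec m n ((j-1)*m) (\<lambda>_. 1 / sqrt (real m)) $ r"
      using il prod_index_less[OF il(1,2)] by (simp add: Phi_def dvec_index)
  qed (simp add: Phi_def dvec_def)
qed

section \<open>Conjugation by local unitaries\<close>

lemma index_mult_sum:
  assumes "A \<in> carrier_mat N N" "B \<in> carrier_mat N N" "r < N" "c < N"
  shows "(A * B) $$ (r,c) = (\<Sum>k<N. A $$ (r,k) * B $$ (k,c))"
  using assms by (simp add: scalar_prod_def lessThan_atLeast0)

lemma index_conjugation:
  assumes K: "K \<in> carrier_mat N N" and W: "W \<in> carrier_mat N N" and rc: "r < N" "c < N"
  shows "(K * W * mat_adjoint K) $$ (r,c) = (\<Sum>x<N. \<Sum>y<N. K $$ (r,x) * W $$ (x,y) * cnj (K $$ (c,y)))"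
proof -
  have aK: "mat_adjoint K \<in> carrier_mat N N" by (rule adjoint_carrier[OF K])
  have KW: "(K * W) $$ (r,y) = (\<Sum>x<N. K $$ (r,x) * W $$ (x,y))" if "y < N" for y
    by (rule index_mult_sum[OF K W rc(1) that])
  have "(K * W * mat_adjoint K) $$ (r,c) = (\<Sum>y<N. (K * W) $$ (r,y) * mat_adjoint K $$ (y,c))"
    by (rule index_mult_sum[OF mult_carrier_mat[OF K W] aK rc])
  also have "\<dots> = (\<Sum>y<N. \<Sum>x<N. K $$ (r,x) * W $$ (x,y) * cnj (K $$ (c,y)))"
    using rc by (intro sum.cong refl) (simp add: KW index_adjoint[OF K] sum_distrib_right)
  also have "\<dots> = (\<Sum>x<N. \<Sum>y<N. K $$ (r,x) * W $$ (x,y) * cnj (K $$ (c,y)))" by (rule sum.swap)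
  finally show ?thesis .
qed

lemma qf_sum_mat:
  assumes "\<And>r c. r < N \<Longrightarrow> c < N \<Longrightarrow> A $$ (r,c) = (\<Sum>j\<in>J. of_real (p j) * B j $$ (r,c))"
  shows "qf N A u = (\<Sum>j\<in>J. p j * qf N (B j) u)"
proof -
  have "(\<Sum>r<N. \<Sum>c<N. cnj (u r) * A $$ (r,c) * u c)
     = (\<Sum>r<N. \<Sum>c<N. \<Sum>j\<in>J. of_real (p j) * (cnj (u r) * B j $$ (r,c) * u c))"
    by (intro sum.cong refl) (auto simp: assms sum_distrib_left sum_distrib_right mult_ac intro!: sum.cong)
  also have "\<dots> = (\<Sum>j\<in>J. of_real (p j) * (\<Sum>r<N. \<Sum>c<N. cnj (u r) * B j $$ (r,c) * u c))"
    unfolding sum_distrib_left by (rule sum_swap3[symmetric])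
  finally show ?thesis unfolding qf_def by (simp only: Re_sum Re_of_real_mult)
qed

lemma kron_index:
  assumes "U \<in> carrier_mat m m" "V \<in> carrier_mat n n" "i < m" "j < n" "k < m" "l < n"
  shows "kron U V $$ (i*n+j, k*n+l) = U $$ (i,k) * V $$ (j,l)"
  using assms prod_index_less[of i m j n] prod_index_less[of k m l n] by (simp add: kron_def)

lemma unitary_rows:
  assumes "unitary U" "U \<in> carrier_mat n n" "i < n" "k < n"
  shows "(\<Sum>j<n. U $$ (i,j) * cnj (U $$ (k,j))) = (if i = k then 1 else 0)"
proof -
  have aU: "mat_adjoint U \<in> carrier_mat n n" by (rule adjoint_carrier[OF assms(2)])
  have "mat_adjoint U * U = 1\<^sub>m n" using assms(1,2) by (simp add: unitary_def)
  hence "U * mat_adjoint U = 1\<^sub>m n" by (rule mat_mult_left_right_inverse[OF aU assms(2)])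
  hence "(U * mat_adjoint U) $$ (i,k) = (if i = k then 1 else 0)" using assms by simp
  moreover have "(U * mat_adjoint U) $$ (i,k) = (\<Sum>j<n. U $$ (i,j) * cnj (U $$ (k,j)))"
    using assms aU by (simp add: scalar_prod_def lessThan_atLeast0 index_adjoint[OF assms(2)])
  ultimately show ?thesis by simp
qed

lemma kron_rows:
  assumes U: "unitary U" "U \<in> carrier_mat m m" and V: "unitary V" "V \<in> carrier_mat n n"
    and rc: "r < m*n" "c < m*n"
  shows "(\<Sum>x<m*n. kron U V $$ (r,x) * cnj (kron U V $$ (c,x))) = (if r = c then 1 else 0)"
proof -
  obtain i j where ij: "i < m" "j < n" "r = i*n+j" using rc(1) by (rule prod_indexE)
  obtain k l where kl: "k < m" "l < n" "c = k*n+l" using rc(2) by (rule prod_indexE)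
  have "(\<Sum>x<m*n. kron U V $$ (r,x) * cnj (kron U V $$ (c,x)))
     = (\<Sum>x<m. \<Sum>y<n. (U $$ (i,x) * cnj (U $$ (k,x))) * (V $$ (j,y) * cnj (V $$ (l,y))))"
    unfolding sum_prod_index using ij kl by (intro sum.cong refl) (simp add: kron_index[OF U(2) V(2)])
  also have "\<dots> = (\<Sum>x<m. U $$ (i,x) * cnj (U $$ (k,x))) * (\<Sum>y<n. V $$ (j,y) * cnj (V $$ (l,y)))"
    by (rule sum_product[symmetric])
  also have "\<dots> = (if r = c then 1 else 0)"
    using unitary_rows[OF U ij(1) kl(1)] unitary_rows[OF V ij(2) kl(2)] ij kl by (auto simp: index_eq_iff)
  finally show ?thesis .
qed

text \<open>The antisymmetric vectors of all blocks together are one orthonormal family. Block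
  \<open>j\<close> contributes \<open>- (p j / m)\<close> at each of its m(m-1)/2 vectors, so the
  total is \<open>- ((m - 1) / 2)\<close> whatever the convex weights.\<close>

lemma negativity_conjugate_Phi:
  assumes W: "W \<in> DEWs m n" and mn: "2 \<le> m" "m \<le> n"
    and U: "U \<in> carrier_mat m m" "unitary U" and V: "V \<in> carrier_mat n n" "unitary V"
    and k: "1 \<le> k" "k \<le> n div m" and p: "(\<Sum>j=1..k. p j) = (1::real)"
    and eq: "kron U V * W * mat_adjoint (kron U V) =
      mat (m*n) (m*n) (\<lambda>(r,c). \<Sum>j=1..k. complex_of_real (p j) * ptrans m n (proj (Phi m n j)) $$ (r,c))"
  shows "negativity W = (real m - 1) / 2"
proof (rule antisym)
  show "negativity W \<le> (real m - 1) / 2" using DEWs_negativity_le[OF W] mn by simp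
  define N where "N = m * n"
  define K where "K = kron U V"
  note Wb = DEWs_basic[OF W, folded N_def]
  have K: "K \<in> carrier_mat N N" using U V by (auto simp: K_def kron_def N_def)
  have Kr: "(\<Sum>x<N. K $$ (r,x) * cnj (K $$ (c,x))) = (if r = c then 1 else 0)" if "r < N" "c < N" for r c
    using kron_rows[OF U(2,1) V(2,1)] that by (simp add: K_def N_def)
  define T where "T = K * W * mat_adjoint K"
  \<comment> \<open>\<open>R\<close> is the adjoint of \<open>K\<close>. It pulls trial vectors for
    the conjugated matrix back to trial vectors for \<open>W\<close>, isometrically because the rows
    of \<open>K\<close> are orthonormal.\<close>
  define R where "R e x = (\<Sum>y<N. cnj (K $$ (y,x)) * e y)" for e x
  have RR: "ip N (R e) (R g) = ip N e g" for e g
  proof -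
    have "ip N (R e) (R g) = (\<Sum>x<N. \<Sum>y<N. \<Sum>z<N. cnj (e y) * g z * (K $$ (y,x) * cnj (K $$ (z,x))))"
      unfolding ip_def R_def cnj_sum sum_product by (simp add: mult_ac)
    also have "\<dots> = (\<Sum>y<N. \<Sum>z<N. \<Sum>x<N. cnj (e y) * g z * (K $$ (y,x) * cnj (K $$ (z,x))))" by (rule sum_swap3)
    also have "\<dots> = (\<Sum>y<N. \<Sum>z<N. if y = z then cnj (e y) * g z else 0)"
      unfolding sum_distrib_left[symmetric] by (intro sum.cong refl) (simp add: Kr)
    finally show ?thesis by (simp add: ip_def)
  qed
  have qR: "qf N W (R e) = qf N T e" for e
  proof -
    have "(\<Sum>r<N. \<Sum>c<N. cnj (e r) * T $$ (r,c) * e c)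
       = (\<Sum>r<N. \<Sum>c<N. \<Sum>x<N. \<Sum>y<N. (K $$ (r,x) * cnj (e r)) * W $$ (x,y) * (cnj (K $$ (c,y)) * e c))"
      unfolding T_def by (intro sum.cong refl) (simp add: index_conjugation[OF K Wb(2)] sum_distrib_left sum_distrib_right mult_ac)
    also have "\<dots> = (\<Sum>r<N. \<Sum>x<N. \<Sum>y<N. \<Sum>c<N. (K $$ (r,x) * cnj (e r)) * W $$ (x,y) * (cnj (K $$ (c,y)) * e c))"
      by (rule sum.cong[OF refl], rule sum_swap3)
    also have "\<dots> = (\<Sum>x<N. \<Sum>y<N. \<Sum>r<N. \<Sum>c<N. (K $$ (r,x) * cnj (e r)) * W $$ (x,y) * (cnj (K $$ (c,y)) * e c))"
      by (rule sum_swap3)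
    also have "\<dots> = (\<Sum>x<N. \<Sum>y<N. cnj (R e x) * W $$ (x,y) * R e y)"
      by (intro sum.cong refl) (simp add: R_def sum_distrib_left sum_distrib_right mult_ac)
    finally show ?thesis by (simp add: qf_def)
  qed
  define x where "x = (\<lambda>_::nat. 1 / sqrt (real m))"
  have Phi: "Phi m n j = dvec m n ((j-1)*m) x" "m + (j-1)*m \<le> n" if "j \<in> {1..k}" for j
    using Phi_dvec[of j n m] that k unfolding x_def by auto
  have qT: "qf N T e = (\<Sum>j=1..k. p j * ptf m n (($) (dvec m n ((j-1)*m) x)) e)" for e
  proof -
    have "qf N T e = (\<Sum>j=1..k. p j * qf N (ptrans m n (proj (Phi m n j))) e)"
      unfolding T_def K_def eq by (rule qf_sum_mat) (simp add: N_def)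
    also have "\<dots> = (\<Sum>j=1..k. p j * ptf m n (($) (dvec m n ((j-1)*m) x)) e)"
      by (intro sum.cong refl) (simp add: Phi N_def qf_ptrans_proj)
    finally show ?thesis .
  qed
  have far: "m \<le> (j-1)*m - (l-1)*m \<or> m \<le> (l-1)*m - (j-1)*m" if "j \<noteq> l" "j \<in> {1..k}" "l \<in> {1..k}" for j l
  proof (cases "j < l")
    case True
    hence "1 * m \<le> ((l - 1) - (j - 1)) * m" using that by (intro mult_le_mono1) auto
    thus ?thesis by (simp add: diff_mult_distrib)
  next
    case False
    hence "1 * m \<le> ((j - 1) - (l - 1)) * m" using that by (intro mult_le_mono1) auto
    thus ?thesis by (simp add: diff_mult_distrib)
  qed
  have qTe: "qf N T (antisymv n ((j-1)*m) a b) = - (p j / real m)" if j: "j \<in> {1..k}" and ab: "a < b" "b < m" for j a b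
  proof -
    have "qf N T (antisymv n ((j-1)*m) a b) = (\<Sum>l=1..k. if l = j then - (p j / real m) else 0)"
      unfolding qT
    proof (intro sum.cong refl)
      fix l assume l: "l \<in> {1..k}"
      show "p l * ptf m n (($) (dvec m n ((l-1)*m) x)) (antisymv n ((j-1)*m) a b) = (if l = j then - (p j / real m) else 0)"
      proof (cases "l = j")
        case True
        thus ?thesis using ptf_dvec_antisymv[OF Phi(2)[OF j] ab] mn by (simp add: x_def)
      next
        case False
        thus ?thesis using ptf_dvec_antisymv_other[OF Phi(2)[OF l] Phi(2)[OF j] far[OF False l j] ab] by simp
      qed
    qed
    thus ?thesis using j by simp
  qed
  define J where "J = (SIGMA j:{1..k}. SIGMA b:{..<m}. {..<b})"
  define e where "e = (\<lambda>(j,b,a). antisymv n ((j-1)*m) a b)"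
  have J: "finite J" by (simp add: J_def)
  have eo: "ip N (e z) (e z') = (if z = z' then 1 else 0)" if "z \<in> J" "z' \<in> J" for z z'
  proof -
    obtain j b a j' b' a' where z: "z = (j,b,a)" "z' = (j',b',a')" by (cases z, cases z')
    have h: "j \<in> {1..k}" "b < m" "a < b" "j' \<in> {1..k}" "b' < m" "a' < b'" using that by (auto simp: J_def z)
    have "(j-1)*m = (j'-1)*m \<longleftrightarrow> j = j'" using h mn by auto
    moreover have "(j-1)*m = (j'-1)*m \<or> m \<le> (j-1)*m - (j'-1)*m \<or> m \<le> (j'-1)*m - (j-1)*m"
      using far[of j j'] h by blast
    moreover have "b + (j-1)*m < n" "b' + (j'-1)*m < n" using Phi(2)[OF h(1)] Phi(2)[OF h(4)] h by linarith+
    ultimately show ?thesis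
      using ip_antisymv_antisymv[OF h(3,2) _ h(6,5), of "(j-1)*m" n "(j'-1)*m"]
      by (auto simp: z e_def N_def)
  qed
  have "ons N J (\<lambda>z. R (e z))" using eo by (simp add: ons_def RR)
  from negativity_ge[OF Wb(1-3) J this]
  have "- (\<Sum>z\<in>J. qf N T (e z)) \<le> negativity W" by (simp add: qR)
  moreover have "(\<Sum>z\<in>J. qf N T (e z)) = - ((real m - 1) / 2)"
  proof -
    have "(\<Sum>z\<in>J. qf N T (e z)) = (\<Sum>(j,z)\<in>J. - (p j / real m))"
      using qTe by (intro sum.cong refl) (auto simp: J_def e_def simp del: One_nat_def)
    also have "\<dots> = (\<Sum>j=1..k. \<Sum>z\<in>(SIGMA b:{..<m}. {..<b}). - (p j / real m))"
      unfolding J_def by (rule sum.Sigma[symmetric]) auto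
    also have "\<dots> = (\<Sum>j=1..k. - (p j / real m) * (real m * (real m - 1) / 2))"
    proof (intro sum.cong refl)
      fix j
      have "real (card (SIGMA b:{..<m}. {..<b})) = (\<Sum>q<m. \<Sum>p<q. 1 * 1)" by simp
      also have "\<dots> = real m * (real m - 1) / 2"
        using sum_mult_triangle[of "\<lambda>_. 1" m] by (simp add: power2_eq_square algebra_simps)
      finally show "(\<Sum>z\<in>(SIGMA b:{..<m}. {..<b}). - (p j / real m)) = - (p j / real m) * (real m * (real m - 1) / 2)"
        unfolding sum_constant by (simp only: mult.commute)
    qed
    also have "\<dots> = (\<Sum>j=1..k. p j) * - ((real m - 1) / 2)"
      unfolding sum_distrib_right using mn by (intro sum.cong refl) (simp add: field_simps)
    finally show ?thesis unfolding p by simp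
  qed
  ultimately show "(real m - 1) / 2 \<le> negativity W" by simp
qed

text \<open>Equality leaves \<open>P = 0\<close> and only maximally entangled eigenvectors in
  \<open>Q\<close>, whose coefficient rows are mutually orthogonal within and across eigenvectors.
  Rescaled, these rows are \<open>k * m\<close> orthonormal vectors of the second factor; a unitary
  that sends them to standard basis vectors turns each eigenvector into some
  \<open>Phi m n j\<close>.\<close>

lemma DEWs_maximal_negativity:
  assumes W: "W \<in> DEWs m n" and mn: "2 \<le> m" "m \<le> n" and neg: "negativity W = (real m - 1) / 2"
  shows "\<exists>U V k p. U \<in> carrier_mat m m \<and> unitary U \<and> V \<in> carrier_mat n n \<and> unitary V \<and>
           1 \<le> k \<and> k \<le> n div m \<and>
           (\<forall>j\<in>{1..k}. 0 \<le> p j) \<and> (\<Sum>j=1..k. p j) = (1::real) \<and>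
           kron U V * W * mat_adjoint (kron U V) =
             mat (m*n) (m*n) (\<lambda>(r,c). \<Sum>j=1..k. complex_of_real (p j) *
                                         ptrans m n (proj (Phi m n j)) $$ (r,c))"
proof -
  define N where "N = m * n"
  have m0: "0 < m" using mn by simp
  obtain P Q where P: "psd P" "P \<in> carrier_mat N N" and Q: "psd Q" "Q \<in> carrier_mat N N"
    and WPQ: "W = P + ptrans m n Q" and tr: "Re (trace P) + Re (trace Q) = 1"
    unfolding N_def by (rule DEWsE[OF W]) blast
  note Wb = DEWs_basic[OF W, folded N_def]
  obtain \<psi> where o: "ons N {..<N} \<psi>"
    and ent: "\<And>r c. r < N \<Longrightarrow> c < N \<Longrightarrow> Q $$ (r,c) = (\<Sum>a<N. of_real (eigvals Q ! a) * \<psi> a r * cnj (\<psi> a c))"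
    and qG: "\<And>u. qf N (ptrans m n Q) u = (\<Sum>a<N. eigvals Q ! a * ptf m n (\<psi> a) u)"
    using qf_ptrans_spectral[OF psd_hermitian[OF Q(1)] Q(2)[unfolded N_def]] unfolding N_def by blast
  obtain u where u: "ons N {..<N} u" "\<And>i. i < N \<Longrightarrow> qf N W (u i) = eigvals W ! i"
    by (rule spectral_qf[OF Wb(1,2)]) blast
  define I where "I = {i. i < N \<and> eigvals W ! i < 0}"
  have I: "finite I" "ons N I u" using ons_subset[OF u(1), of I] by (auto simp: I_def)
  define q where "q a = eigvals Q ! a" for a
  define S where "S a = (\<Sum>i\<in>I. ptf m n (\<psi> a) (u i))" for a
  have q0: "0 \<le> q a" if "a < N" for a using psd_eigvals_nonneg[OF Q that] by (simp add: q_def)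
  have trQ: "Re (trace Q) = (\<Sum>a<N. q a)" by (simp add: q_def trace_eigvals[OF psd_hermitian[OF Q(1)] Q(2)])
  have ge: "- ((real m - 1) / 2) \<le> S a" if "a < N" for a
    unfolding S_def using ptf_ge_neg(1)[of m n "\<psi> a" I u] onsD[OF o, of a a] that I m0 by (simp add: N_def)
  have sW: "(\<Sum>i\<in>I. qf N W (u i)) = - ((real m - 1) / 2)"
    using negativity_eigvals[OF Wb(1-3)] neg u(2) by (simp add: I_def)
  have z0: "(\<Sum>i\<in>I. qf N P (u i)) + (real m - 1) / 2 * Re (trace P) + (\<Sum>a<N. q a * (S a + (real m - 1) / 2)) = 0"
  proof -
    have "(\<Sum>a<N. q a * (S a + (real m - 1) / 2)) = (\<Sum>a<N. q a * S a) + (real m - 1) / 2 * Re (trace Q)"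
      unfolding trQ by (simp add: distrib_left sum.distrib sum_distrib_left mult.commute)
    moreover have "(\<Sum>a<N. q a * S a) = (\<Sum>i\<in>I. qf N (ptrans m n Q) (u i))"
      unfolding qG S_def q_def sum_distrib_left by (rule sum.swap)
    moreover have "(\<Sum>i\<in>I. qf N P (u i)) + (\<Sum>i\<in>I. qf N (ptrans m n Q) (u i)) = - ((real m - 1) / 2)"
      using sW unfolding WPQ N_def qf_add[OF P(2)[unfolded N_def] ptrans_carrier] by (simp add: sum.distrib)
    moreover have "(real m - 1) / 2 * Re (trace P) + (real m - 1) / 2 * Re (trace Q) = (real m - 1) / 2"
      unfolding distrib_left[symmetric] tr by simp
    ultimately show ?thesis by linarith
  qed
  have n1: "0 \<le> (\<Sum>i\<in>I. qf N P (u i))" by (intro sum_nonneg psd_qf_nonneg[OF P])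
  have n2: "0 \<le> (real m - 1) / 2 * Re (trace P)" using psd_trace_nonneg[OF P] mn by (intro mult_nonneg_nonneg) auto
  have nn: "\<forall>a\<in>{..<N}. 0 \<le> q a * (S a + (real m - 1) / 2)"
  proof
    fix a assume "a \<in> {..<N}"
    thus "0 \<le> q a * (S a + (real m - 1) / 2)" using q0[of a] ge[of a] by (intro mult_nonneg_nonneg) auto
  qed
  hence n3: "0 \<le> (\<Sum>a<N. q a * (S a + (real m - 1) / 2))" by (intro sum_nonneg) auto
  have z: "(real m - 1) / 2 * Re (trace P) = 0" "(\<Sum>a<N. q a * (S a + (real m - 1) / 2)) = 0"
    using z0 n1 n2 n3 by linarith+
  hence trP: "Re (trace P) = 0" using mn by simp
  have P0: "P = 0\<^sub>m N N" using psd_trace_zero[OF P] trP by simp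
  have WG: "W = ptrans m n Q" unfolding WPQ P0 N_def by simp
  have s1: "(\<Sum>a<N. q a) = 1" using trP tr trQ by simp
  have eqS: "S a = - ((real m - 1) / 2)" if "a < N" "q a \<noteq> 0" for a
    using z(2) that nn sum_nonneg_eq_0_iff[OF finite_lessThan, of N "\<lambda>a. q a * (S a + (real m - 1) / 2)"] by auto
  have gram: "(\<Sum>j<n. \<psi> a (i*n+j) * cnj (\<psi> a (k*n+j))) = (if i = k then 1 / of_nat m else 0)"
    if a: "a < N" "q a \<noteq> 0" and ik: "i < m" "k < m" for a i k
    using onsD[OF o, of a a] a(1) eqS[OF a] I
    by (intro gram_maximally_entangled[OF _ ik] ptf_ge_neg(2)[OF _ I[unfolded N_def] m0]) (auto simp: N_def S_def)
  have cross: "ip n (\<lambda>j. \<psi> a (i*n+j)) (\<lambda>j. \<psi> b (k*n+j)) = 0"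
    if a: "a < N" "q a \<noteq> 0" and b: "b < N" "q b \<noteq> 0" and "a \<noteq> b" and ik: "i < m" "k < m" for a b i k
    using maximal_negativity_orthogonal[OF mn(1) I[unfolded N_def] gram[OF a] eqS[OF a, unfolded S_def] gram[OF b] eqS[OF b, unfolded S_def] _ ik]
      onsD[OF o, of a b] that by (simp add: N_def)
  define A where "A = {a. a < N \<and> q a \<noteq> 0}"
  have Af: "finite A" by (simp add: A_def)
  define k where "k = card A"
  have sA: "(\<Sum>a\<in>A. q a) = 1"
    unfolding s1[symmetric] A_def by (intro sum.mono_neutral_left) auto
  have k1: "1 \<le> k" using sA Af unfolding k_def by (metis card_0_eq less_one not_less sum.empty zero_neq_one)
  obtain h where h: "bij_betw h {0..<k} A" using ex_bij_betw_nat_finite[OF Af] unfolding k_def by blast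
  have hA: "h t < N" "q (h t) \<noteq> 0" if "t < k" for t using bij_betwE[OF h] that by (auto simp: A_def)
  have hinj: "h t = h t' \<longleftrightarrow> t = t'" if "t < k" "t' < k" for t t'
    using bij_betw_imp_inj_on[OF h] that by (auto dest: inj_onD)
  define s where "s = complex_of_real (sqrt (real m))"
  have ss: "cnj s * s = of_nat m" unfolding s_def complex_cnj_complex_of_real of_real_mult[symmetric] by simp
  have s0: "s \<noteq> 0" using m0 by (simp add: s_def)
  \<comment> \<open>Row \<open>r mod m\<close> of the coefficient matrix of eigenvector number
    \<open>r div m\<close>, scaled to unit length.\<close>
  define C where "C r l = s * \<psi> (h (r div m)) ((r mod m)*n+l)" for r l
  have Cons: "ons n {..<k*m} C"
    unfolding ons_def
  proof (intro ballI)
    fix r r' assume "r \<in> {..<k*m}" "r' \<in> {..<k*m}"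
    hence rm: "r div m < k" "r' div m < k" "r mod m < m" "r' mod m < m" using m0 by (auto simp: less_mult_imp_div_less)
    have e: "ip n (C r) (C r') = of_nat m * ip n (\<lambda>l. \<psi> (h (r div m)) ((r mod m)*n+l)) (\<lambda>l. \<psi> (h (r' div m)) ((r' mod m)*n+l))"
      unfolding C_def ip_scale_left ip_scale_right ss[symmetric] by (simp add: mult_ac)
    show "ip n (C r) (C r') = (if r = r' then 1 else 0)"
    proof (cases "r div m = r' div m")
      case True
      hence rr: "r = r' \<longleftrightarrow> r' mod m = r mod m" by (metis div_mult_mod_eq)
      have "ip n (\<lambda>l. \<psi> (h (r div m)) ((r mod m)*n+l)) (\<lambda>l. \<psi> (h (r' div m)) ((r' mod m)*n+l))
        = (\<Sum>l<n. \<psi> (h (r div m)) ((r' mod m)*n+l) * cnj (\<psi> (h (r div m)) ((r mod m)*n+l)))"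
        by (simp add: ip_def True mult.commute)
      thus ?thesis unfolding e rr using gram[OF hA[OF rm(1)] rm(4,3)] m0 by simp
    next
      case False
      hence "h (r div m) \<noteq> h (r' div m)" using hinj rm by simp
      thus ?thesis unfolding e using cross[OF hA[OF rm(1)] hA[OF rm(2)] _ rm(3,4)] False by auto
    qed
  qed
  have kmn: "k * m \<le> n"
  proof -
    have "real (k * m) = (\<Sum>r<k*m. Re (ip n (C r) (C r)))" using onsD[OF Cons] by simp
    also have "\<dots> = (\<Sum>r<k*m. \<Sum>l<n. (cmod (C r l))\<^sup>2)" by (simp add: ip_self)
    also have "\<dots> = (\<Sum>l<n. \<Sum>r<k*m. (cmod (C r l))\<^sup>2)" by (rule sum.swap)
    \<comment> \<open>Dimension count by double summation: Bessel's inequality for the l-th basis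
      vector bounds the contribution of coordinate \<open>l\<close> by 1.\<close>
    also have "\<dots> \<le> (\<Sum>l<n. 1)"
    proof (rule sum_mono)
      fix l assume "l \<in> {..<n}"
      hence l: "l < n" by simp
      have "(\<Sum>r<k*m. (cmod (C r l))\<^sup>2) = (\<Sum>r<k*m. (cmod (ip n (C r) (ket l)))\<^sup>2)"
        using l by (intro sum.cong refl) (simp add: cmod_ip_commute[of n _ "ket l"] ip_ket)
      also have "\<dots> \<le> Re (ip n (ket l) (ket l))" by (rule bessel_ons[OF _ Cons]) simp
      also have "\<dots> = 1" using l by (simp add: ip_ket) (simp add: ket_def)
      finally show "(\<Sum>r<k*m. (cmod (C r l))\<^sup>2) \<le> 1" .
    qed
    finally have "real (k * m) \<le> real n" by simp
    thus ?thesis by (simp only: of_nat_le_iff)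
  qed
  hence kn: "k \<le> n div m" using m0 by (simp add: less_eq_div_iff_mult_less_eq)
  obtain C' where C': "ons n {..<n} C'" "\<And>r. r < k*m \<Longrightarrow> C' r = C r" using extend_ons[OF Cons kmn] by blast
  \<comment> \<open>The rows of \<open>V\<close> are the conjugated basis vectors, so
    \<open>V\<close> sends the r-th of them to the r-th standard basis vector.\<close>
  define V where "V = mat n n (\<lambda>(r,l). cnj (C' r l))"
  have Vc: "V \<in> carrier_mat n n" by (simp add: V_def)
  have V: "unitary V"
  proof -
    have "mat_adjoint V * V = 1\<^sub>m n"
    proof (rule eq_matI)
      fix i j assume "i < dim_row (1\<^sub>m n)" "j < dim_col (1\<^sub>m n)"
      hence ij: "i < n" "j < n" by auto
      have "(mat_adjoint V * V) $$ (i,j) = (\<Sum>r<n. mat_adjoint V $$ (i,r) * V $$ (r,j))"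
        by (rule index_mult_sum[OF adjoint_carrier[OF Vc] Vc ij])
      also have "\<dots> = (\<Sum>r<n. C' r i * cnj (C' r j))"
      proof (intro sum.cong refl)
        fix r assume "r \<in> {..<n}"
        hence r: "r < n" by simp
        show "mat_adjoint V $$ (i,r) * V $$ (r,j) = C' r i * cnj (C' r j)"
          unfolding index_adjoint[OF Vc ij(1) r] using r ij by (simp add: V_def)
      qed
      also have "\<dots> = (if i = j then 1 else 0)" by (rule ons_complete[OF C'(1) ij])
      finally show "(mat_adjoint V * V) $$ (i,j) = 1\<^sub>m n $$ (i,j)" using ij by simp
    qed (use adjoint_carrier[OF Vc] Vc in auto)
    thus ?thesis using Vc by (simp add: unitary_def)
  qed
  \<comment> \<open>No rotation of the first factor is needed: the left Schmidt basis of a maximally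
    entangled vector is arbitrary, and the standard basis has been used for all
    eigenvectors.\<close>
  define U where "U = (1\<^sub>m m :: complex mat)"
  have Uc: "U \<in> carrier_mat m m" by (simp add: U_def)
  have U: "unitary U"
  proof -
    have "mat_adjoint U = 1\<^sub>m m"
      using adjoint_carrier[OF Uc] by (intro eq_matI) (auto simp: U_def index_adjoint[of _ m m])
    thus ?thesis by (simp add: unitary_def U_def)
  qed
  define p where "p j = q (h (j - 1))" for j
  have p0: "\<forall>j\<in>{1..k}. 0 \<le> p j" using q0 hA by (auto simp: p_def)
  have p1: "(\<Sum>j=1..k. p j) = 1"
  proof -
    have "(\<Sum>j=1..k. p j) = (\<Sum>t=0..<k. q (h t))"
      using sum_lam[of 1 "\<lambda>t. q (h t)" k] by (simp add: p_def)
    also have "\<dots> = (\<Sum>a\<in>A. q a)" by (rule sum.reindex_bij_betw[OF h])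
    finally show ?thesis using sA by simp
  qed
  define K where "K = kron U V"
  have K: "K \<in> carrier_mat N N" using Uc Vc by (auto simp: K_def kron_def N_def)
  have Kent: "K $$ (i*n+j, x*n+y) = (if x = i then cnj (C' j y) else 0)"
    if "i < m" "j < n" "x < m" "y < n" for i j x y
    unfolding K_def kron_index[OF Uc Vc that] using that by (simp add: U_def V_def)
  have Went: "W $$ (i*n+j, x*n+y) = (\<Sum>a\<in>A. of_real (q a) * \<psi> a (x*n+j) * cnj (\<psi> a (i*n+y)))"
    if "i < m" "j < n" "x < m" "y < n" for i j x y
  proof -
    have "W $$ (i*n+j, x*n+y) = (\<Sum>a<N. of_real (q a) * \<psi> a (x*n+j) * cnj (\<psi> a (i*n+y)))"
      unfolding WG ptrans_index[OF that] using that by (simp add: ent prod_index_less N_def q_def)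
    also have "\<dots> = (\<Sum>a\<in>A. of_real (q a) * \<psi> a (x*n+j) * cnj (\<psi> a (i*n+y)))"
      unfolding A_def by (intro sum.mono_neutral_right) auto
    finally show ?thesis .
  qed
  have Cpsi: "ip n (C' j) (\<lambda>y. \<psi> (h t) (x*n+y)) = (if j = t*m + x then 1 / s else 0)"
    if "j < n" "t < k" "x < m" for j t x
  proof -
    have "t * m + x < k * m" by (rule prod_index_less[OF that(2,3)])
    hence tx: "t*m+x < n" "C' (t*m+x) = C (t*m+x)" using kmn C'(2) by auto
    have "ip n (C' j) (C' (t*m+x)) = s * ip n (C' j) (\<lambda>y. \<psi> (h t) (x*n+y))"
      unfolding tx(2) unfolding C_def ip_scale_right using that m0 by simp
    thus ?thesis using onsD[OF C'(1), of j "t*m+x"] tx(1) that s0 by (auto simp: field_simps split: if_splits)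
  qed
  have "K * W * mat_adjoint K = mat (m*n) (m*n) (\<lambda>(r,c). \<Sum>j=1..k. complex_of_real (p j) *
                                         ptrans m n (proj (Phi m n j)) $$ (r,c))"
  proof (rule eq_matI)
    fix r c assume "r < dim_row (mat (m*n) (m*n) (\<lambda>(r,c). \<Sum>j=1..k. complex_of_real (p j) * ptrans m n (proj (Phi m n j)) $$ (r,c)))"
      "c < dim_col (mat (m*n) (m*n) (\<lambda>(r,c). \<Sum>j=1..k. complex_of_real (p j) * ptrans m n (proj (Phi m n j)) $$ (r,c)))"
    hence rc: "r < N" "c < N" by (auto simp: N_def)
    obtain i j where ij: "i < m" "j < n" "r = i*n+j" using rc(1) unfolding N_def by (rule prod_indexE)
    obtain x y where xy: "x < m" "y < n" "c = x*n+y" using rc(2) unfolding N_def by (rule prod_indexE)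
    have "(K * W * mat_adjoint K) $$ (r,c) = (\<Sum>i'<m. \<Sum>j'<n. \<Sum>x'<m. \<Sum>y'<n. K $$ (r,i'*n+j') * W $$ (i'*n+j',x'*n+y') * cnj (K $$ (c,x'*n+y')))"
      unfolding index_conjugation[OF K Wb(2) rc] N_def sum_prod_index ..
    also have "\<dots> = (\<Sum>i'<m. if i' = i then \<Sum>j'<n. \<Sum>x'<m. \<Sum>y'<n. K $$ (r,i*n+j') * W $$ (i*n+j',x'*n+y') * cnj (K $$ (c,x'*n+y')) else 0)"
      by (intro sum.cong refl) (auto simp: ij Kent)
    also have "\<dots> = (\<Sum>j'<n. \<Sum>x'<m. \<Sum>y'<n. K $$ (r,i*n+j') * W $$ (i*n+j',x'*n+y') * cnj (K $$ (c,x'*n+y')))"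
      using ij(1) by simp
    also have "\<dots> = (\<Sum>j'<n. \<Sum>x'<m. if x' = x then \<Sum>y'<n. K $$ (r,i*n+j') * W $$ (i*n+j',x*n+y') * cnj (K $$ (c,x*n+y')) else 0)"
      by (intro sum.cong refl) (auto simp: xy Kent)
    also have "\<dots> = (\<Sum>j'<n. \<Sum>y'<n. K $$ (r,i*n+j') * W $$ (i*n+j',x*n+y') * cnj (K $$ (c,x*n+y')))"
      using xy(1) by simp
    also have "\<dots> = (\<Sum>j'<n. \<Sum>y'<n. \<Sum>a\<in>A. of_real (q a) * ((cnj (C' j j') * \<psi> a (x*n+j')) * (C' y y' * cnj (\<psi> a (i*n+y')))))"
    proof (intro sum.cong refl)
      fix j' y' assume "j' \<in> {..<n}" "y' \<in> {..<n}"
      hence jy: "j' < n" "y' < n" by auto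
      have e: "K $$ (r,i*n+j') = cnj (C' j j')" "K $$ (c,x*n+y') = cnj (C' y y')"
        using Kent[OF ij(1,2) ij(1) jy(1)] Kent[OF xy(1,2) xy(1) jy(2)] by (auto simp: ij xy)
      show "K $$ (r,i*n+j') * W $$ (i*n+j',x*n+y') * cnj (K $$ (c,x*n+y'))
        = (\<Sum>a\<in>A. of_real (q a) * ((cnj (C' j j') * \<psi> a (x*n+j')) * (C' y y' * cnj (\<psi> a (i*n+y')))))"
        unfolding e Went[OF ij(1) jy(1) xy(1) jy(2)] by (simp add: sum_distrib_left sum_distrib_right mult_ac)
    qed
    also have "\<dots> = (\<Sum>a\<in>A. \<Sum>j'<n. \<Sum>y'<n. of_real (q a) * ((cnj (C' j j') * \<psi> a (x*n+j')) * (C' y y' * cnj (\<psi> a (i*n+y')))))"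
      by (rule sum_swap3[symmetric])
    also have "\<dots> = (\<Sum>a\<in>A. of_real (q a) * (ip n (C' j) (\<lambda>l. \<psi> a (x*n+l)) * cnj (ip n (C' y) (\<lambda>l. \<psi> a (i*n+l)))))"
      unfolding ip_def cnj_sum sum_product by (simp add: sum_distrib_left)
    also have "\<dots> = (\<Sum>t=0..<k. of_real (q (h t)) * (ip n (C' j) (\<lambda>l. \<psi> (h t) (x*n+l)) * cnj (ip n (C' y) (\<lambda>l. \<psi> (h t) (i*n+l)))))"
      by (rule sum.reindex_bij_betw[OF h, symmetric])
    also have "\<dots> = (\<Sum>t=0..<k. of_real (q (h t)) * ((if j = t*m+x then 1 / s else 0) * cnj (if y = t*m+i then 1 / s else 0)))"
      using ij xy by (intro sum.cong refl) (simp add: Cpsi)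
    also have "\<dots> = (\<Sum>t=1..k. of_real (p t) * ((if j = (t-1)*m+x then 1 / s else 0) * cnj (if y = (t-1)*m+i then 1 / s else 0)))"
      using sum_lam[of 1 "\<lambda>t. of_real (q (h t)) * ((if j = t*m+x then 1 / s else 0) * cnj (if y = t*m+i then 1 / s else 0))" k]
      by (simp add: p_def)
    also have "\<dots> = (\<Sum>t=1..k. of_real (p t) * ptrans m n (proj (Phi m n t)) $$ (r,c))"
    proof (intro sum.cong refl)
      fix t assume t: "t \<in> {1..k}"
      have ph: "Phi m n t = dvec m n ((t-1)*m) (\<lambda>_. 1 / sqrt (real m))" using Phi_dvec(1)[of t n m] t kn by auto
      have "ptrans m n (proj (Phi m n t)) $$ (r,c) = Phi m n t $ (x*n+j) * cnj (Phi m n t $ (i*n+y))"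
        unfolding ij(3) xy(3) ptrans_index[OF ij(1,2) xy(1,2)] using ij xy by (simp add: proj_def ph dvec_def prod_index_less)
      also have "\<dots> = (if j = (t-1)*m+x then 1 / s else 0) * cnj (if y = (t-1)*m+i then 1 / s else 0)"
        unfolding ph dvec_index[OF xy(1) ij(2)] dvec_index[OF ij(1) xy(2)] by (simp add: s_def add.commute)
      finally show "of_real (p t) * ((if j = (t-1)*m+x then 1 / s else 0) * cnj (if y = (t-1)*m+i then 1 / s else 0))
        = of_real (p t) * ptrans m n (proj (Phi m n t)) $$ (r,c)" by simp
    qed
    finally show "(K * W * mat_adjoint K) $$ (r,c) = mat (m*n) (m*n) (\<lambda>(r,c). \<Sum>j=1..k. complex_of_real (p j) *
                                         ptrans m n (proj (Phi m n j)) $$ (r,c)) $$ (r,c)"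
      using rc by (simp add: N_def)
  qed (use K Wb(2) adjoint_carrier[OF K] in \<open>auto simp: N_def\<close>)
  thus ?thesis using Uc U Vc V k1 kn p0 p1 unfolding K_def by blast
qed

section \<open>The ranges of the spectral quantities\<close>

lemma is_inf_image_open:
  assumes "\<And>W. W \<in> D \<Longrightarrow> c < f W" "\<And>x. c < x \<Longrightarrow> x \<le> d \<Longrightarrow> \<exists>W\<in>D. f W = x" "c < d"
  shows "is_inf (f ` D) c"
  by (rule is_inf_open[OF _ _ assms(3)]) (use assms(1,2) in blast)+

lemma is_sup_image_open:
  assumes "\<And>W. W \<in> D \<Longrightarrow> f W < c" "\<And>x. d \<le> x \<Longrightarrow> x < c \<Longrightarrow> \<exists>W\<in>D. f W = x" "d < c"
  shows "is_sup (f ` D) c"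
  by (rule is_sup_open[OF _ _ assms(3)]) (use assms(1,2) in blast)+

lemma is_inf_image_attained: "W \<in> D \<Longrightarrow> f W = c \<Longrightarrow> (\<And>W. W \<in> D \<Longrightarrow> c \<le> f W) \<Longrightarrow> is_inf (f ` D) c"
  by (auto simp: is_inf_def)

lemma is_sup_image_attained: "W \<in> D \<Longrightarrow> f W = c \<Longrightarrow> (\<And>W. W \<in> D \<Longrightarrow> f W \<le> c) \<Longrightarrow> is_sup (f ` D) c"
  by (auto simp: is_sup_def)

lemma purity_range:
  assumes mn: "2 \<le> m" "m \<le> n"
  defines "D \<equiv> DEWs m n" and "purity \<equiv> (\<lambda>W. Re (trace (W * W)))"
  shows "(\<forall>x. 1 / (real (m*n) - 1) < x \<and> x \<le> 1 \<longrightarrow> (\<exists>W\<in>D. purity W = x)) \<and>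
    is_inf (purity ` D) (1 / (real (m*n) - 1)) \<and> 1 / (real (m*n) - 1) \<notin> purity ` D \<and>
    is_sup (purity ` D) 1 \<and> 1 \<in> purity ` D"
proof -
  define x where "x = (\<lambda>i::nat. if i < 2 then sqrt (1/2) else 0)"
  have x: "\<And>i. 2 \<le> i \<Longrightarrow> x i = 0" "(x 0)\<^sup>2 + (x 1)\<^sup>2 = 1" "0 < x 1" "x 1 \<le> x 0" by (auto simp: x_def)
  have N: "2 \<le> m*n" "1 / (real (m*n) - 1) < 1" using mn4[OF mn] mn_real[OF mn] by auto
  have surj: "\<exists>W\<in>D. purity W = y" if "1 / (real (m*n) - 1) < y" "y \<le> 1" for y
    using mixed_ew_purity[OF mn x that] mixed_ew_DEWs[OF mn x] unfolding D_def purity_def by metis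
  have gt: "1 / (real (m*n) - 1) < purity W" if "W \<in> D" for W
    using DEWs_purity_gt[OF _ N(1)] that unfolding D_def purity_def by blast
  have le: "purity W \<le> 1" if "W \<in> D" for W
    using DEWs_purity(1) that unfolding D_def purity_def by blast
  obtain W where W: "W \<in> D" "purity W = 1" using surj[of 1] N by blast
  have "is_inf (purity ` D) (1 / (real (m*n) - 1))"
    by (rule is_inf_image_open[where d=1, OF gt surj N(2)])
  moreover have "is_sup (purity ` D) 1" by (rule is_sup_image_attained[where f=purity, OF W le])
  moreover have "1 / (real (m*n) - 1) \<notin> purity ` D" using gt by (metis image_iff less_irrefl)
  moreover have "1 \<in> purity ` D" using W by (metis image_eqI)
  ultimately show ?thesis using surj by blast
qed

lemma purity_eq_one_iff:
  "\<forall>W\<in>DEWs m n. Re (trace (W * W)) = 1 \<longleftrightarrow>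
    (\<exists>\<psi>. unit_vec (m*n) \<psi> \<and> entangled m n \<psi> \<and> W = ptrans m n (proj \<psi>))"
proof (intro ballI iffI)
  fix W assume W: "W \<in> DEWs m n"
  show "\<exists>\<psi>. unit_vec (m*n) \<psi> \<and> entangled m n \<psi> \<and> W = ptrans m n (proj \<psi>)" if "Re (trace (W * W)) = 1"
    by (rule DEWs_purity(2)[OF W that])
  assume "\<exists>\<psi>. unit_vec (m*n) \<psi> \<and> entangled m n \<psi> \<and> W = ptrans m n (proj \<psi>)"
  then obtain \<psi> where \<psi>: "unit_vec (m*n) \<psi>" "W = ptrans m n (proj \<psi>)" by blast
  show "Re (trace (W * W)) = 1"
    unfolding \<psi>(2) by (rule purity_ptrans_proj[OF \<psi>(1) DEWs_basic(1)[OF W, unfolded \<psi>(2)]])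
qed

lemma last_eigval_range:
  assumes mn: "2 \<le> m" "m \<le> n"
  defines "D \<equiv> DEWs m n" and "l \<equiv> (\<lambda>W. eigvals W ! (m*n-1))"
  shows "(\<forall>x. -1/2 \<le> x \<and> x < 0 \<longrightarrow> (\<exists>W\<in>D. l W = x)) \<and>
     is_inf (l ` D) (-1/2) \<and> -1/2 \<in> l ` D \<and> is_sup (l ` D) 0 \<and> 0 \<notin> l ` D"
proof -
  define x where "x = (\<lambda>i::nat. if i < 2 then sqrt (1/2) else 0)"
  have x: "\<And>i. 2 \<le> i \<Longrightarrow> x i = 0" "(x 0)\<^sup>2 + (x 1)\<^sup>2 = 1" "0 < x 1" "x 1 \<le> x 0" by (auto simp: x_def)
  have h: "x 0 * x 1 = 1 / 2" by (simp add: x_def)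
  have surj: "\<exists>W\<in>D. l W = y" if "-1/2 \<le> y" "y < 0" for y
  proof -
    \<comment> \<open>The smallest eigenvalue of the mixture is \<open>- t / 2\<close>, hence
      \<open>t = - 2 * y\<close>.\<close>
    have t: "0 < - 2 * y" "- 2 * y \<le> 1" using that by auto
    show ?thesis
      using mixed_ew_DEWs[OF mn x t] mixed_ew_last_eigval[OF mn x t h] unfolding D_def l_def
      by (intro bexI[of _ "mixed_ew m n x (- 2 * y)"]) auto
  qed
  have neg: "l W < 0" if "W \<in> D" for W using DEWs_basic(4) that unfolding D_def l_def by blast
  have ge: "-1/2 \<le> l W" if "W \<in> D" for W using DEWs_last_eigval_ge[OF _ mn(1)] that unfolding D_def l_def by fastforce
  have "\<exists>W\<in>D. l W = -1/2" by (rule surj) auto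
  then obtain W where W: "W \<in> D" "l W = -1/2" by blast
  have "is_inf (l ` D) (-1/2)" by (rule is_inf_image_attained[where f=l, OF W ge])
  moreover have "is_sup (l ` D) 0" by (rule is_sup_image_open[where d="-1/2", OF neg surj]) auto
  moreover have "-1/2 \<in> l ` D" using W by (metis image_eqI)
  moreover have "0 \<notin> l ` D" using neg by (metis image_iff less_irrefl)
  ultimately show ?thesis using surj by blast
qed

lemma last_eigval_minimal_iff:
  assumes "2 \<le> m"
  shows "\<forall>W\<in>DEWs m n. eigvals W ! (m*n-1) = -1/2 \<longleftrightarrow>
    (\<exists>\<psi>. unit_vec (m*n) \<psi> \<and> nonzero_schmidt m n \<psi> = {#sqrt 2 / 2, sqrt 2 / 2#} \<and> W = ptrans m n (proj \<psi>))"
  using DEWs_last_eigval_eq[OF _ assms] by simp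

lemma first_eigval_range:
  assumes mn: "2 \<le> m" "m \<le> n"
  defines "D \<equiv> DEWs m n" and "l \<equiv> (\<lambda>W. eigvals W ! 0)"
  shows "(\<forall>x. 1 / (real (m*n) - 1) < x \<and> x < 1 \<longrightarrow> (\<exists>W\<in>D. l W = x)) \<and>
     is_inf (l ` D) (1 / (real (m*n) - 1)) \<and> 1 / (real (m*n) - 1) \<notin> l ` D \<and>
     is_sup (l ` D) 1 \<and> 1 \<notin> l ` D"
proof -
  define c where "c = 1 / (real (m*n) - 1)"
  have N: "2 \<le> m*n" "0 < c" "c \<le> 1 / 3" using mn4[OF mn] mn_real[OF mn] by (auto simp: c_def field_simps)
  have surj: "\<exists>W\<in>D. l W = y" if y: "c < y" "y < 1" for y
  proof -
    \<comment> \<open>Some number strictly between \<open>y\<close> and 1, to serve as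
      \<open>(x 0)\<^sup>2\<close>. It must depend on \<open>y\<close>: a fixed example reaches no
      largest eigenvalue beyond its own \<open>(x 0)\<^sup>2\<close>, and 1 itself would make the
      vector a product.\<close>
    define A where "A = (1 + y) / 2"
    have A: "1 / 2 \<le> A" "A < 1" "y < A" using y N by (auto simp: A_def)
    define x where "x = (\<lambda>i::nat. if i = 0 then sqrt A else if i = 1 then sqrt (1 - A) else 0)"
    have x: "\<And>i. 2 \<le> i \<Longrightarrow> x i = 0" "(x 0)\<^sup>2 + (x 1)\<^sup>2 = 1" "0 < x 1" "x 1 \<le> x 0" using A by (auto simp: x_def)
    define t where "t = (y - c) / (A - c)"
    have Ac: "0 < A - c" using A y by simp
    have t: "0 < t" "t \<le> 1" using y A Ac by (auto simp: t_def)
    have "l (mixed_ew m n x t) = (1 - t) * c + t * A"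
      using mixed_ew_first_eigval[OF mn x t] A by (simp add: l_def c_def x_def)
    also have "\<dots> = c + t * (A - c)" by (simp add: algebra_simps)
    also have "\<dots> = y" using Ac by (simp add: t_def)
    finally show ?thesis using mixed_ew_DEWs[OF mn x t] unfolding D_def by blast
  qed
  have gt: "c < l W" if "W \<in> D" for W
    using DEWs_first_eigval_gt[OF _ N(1)] that unfolding D_def l_def c_def by blast
  have lt: "l W < 1" if "W \<in> D" for W
  proof -
    note Wb = DEWs_basic[OF that[unfolded D_def]]
    \<comment> \<open>The purity is at most 1, and the nonzero square of the negative eigenvalue
      leaves strictly less than 1 for the largest one.\<close>
    have "(l W)\<^sup>2 + (eigvals W ! (m*n-1))\<^sup>2 = (\<Sum>i\<in>{0,m*n-1}. (eigvals W ! i)\<^sup>2)"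
      using N(1) mn by (simp add: l_def)
    also have "\<dots> \<le> (\<Sum>i<m*n. (eigvals W ! i)\<^sup>2)" using N mn by (intro sum_mono2) auto
    also have "\<dots> \<le> 1" using DEWs_purity(1)[OF that[unfolded D_def]] unfolding sum_sq_entries(2)[OF Wb(1,2)] .
    finally have "(l W)\<^sup>2 + (eigvals W ! (m*n-1))\<^sup>2 \<le> 1" .
    moreover have "0 < (eigvals W ! (m*n-1))\<^sup>2" using Wb(4) by (simp add: zero_less_power2)
    ultimately have "(l W)\<^sup>2 < 1\<^sup>2" unfolding one_power2 by linarith
    thus ?thesis by (rule power2_less_imp_less) simp
  qed
  have "is_inf (l ` D) c" by (rule is_inf_image_open[where d="1/2", OF gt surj]) (use N in auto)
  moreover have "is_sup (l ` D) 1" by (rule is_sup_image_open[where d="1/2", OF lt surj]) (use N in auto)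
  moreover have "c \<notin> l ` D" "1 \<notin> l ` D" using gt lt by (metis image_iff less_irrefl)+
  ultimately show ?thesis using surj unfolding c_def by blast
qed

lemma negativity_range:
  assumes mn: "2 \<le> m" "m \<le> n"
  defines "D \<equiv> DEWs m n"
  shows "(\<forall>W\<in>D. 0 < negativity W \<and> negativity W \<le> (real m - 1) / 2) \<and>
     (\<forall>x. 0 < x \<and> x \<le> (real m - 1) / 2 \<longrightarrow> (\<exists>W\<in>D. negativity W = x)) \<and>
     is_sup (negativity ` D) ((real m - 1) / 2) \<and> (real m - 1) / 2 \<in> negativity ` D \<and>
     is_inf (negativity ` D) 0 \<and> 0 \<notin> negativity ` D"
proof -
  define M where "M = (real m - 1) / 2"
  have M: "0 < M" using mn by (simp add: M_def)
  have b: "0 < negativity W" "negativity W \<le> M" if "W \<in> D" for W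
    using DEWs_negativity_pos DEWs_negativity_le[of W m n] that mn unfolding D_def M_def by auto
  have surj: "\<exists>W\<in>D. negativity W = y" if y: "0 < y" "y \<le> M" for y
  proof -
    have t: "0 < y / M" "y / M \<le> 1" using y M by auto
    obtain W where "W \<in> D" "negativity W = y / M * M"
      using negativity_example[OF mn t] unfolding D_def M_def by blast
    thus ?thesis using M by auto
  qed
  obtain W where W: "W \<in> D" "negativity W = M" using surj[OF M] by blast
  have "is_sup (negativity ` D) M" by (rule is_sup_image_attained[where f=negativity, OF W b(2)])
  moreover have "is_inf (negativity ` D) 0" by (rule is_inf_image_open[where d=M, OF b(1) surj M])
  moreover have "M \<in> negativity ` D" using W by (metis image_eqI)
  moreover have "0 \<notin> negativity ` D" using b(1) by (metis image_iff less_irrefl)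
  ultimately show ?thesis using b surj unfolding M_def by blast
qed

lemma negativity_maximal_iff:
  assumes mn: "2 \<le> m" "m \<le> n"
  shows "\<forall>W\<in>DEWs m n. negativity W = (real m - 1) / 2 \<longleftrightarrow>
        (\<exists>U V k p. U \<in> carrier_mat m m \<and> unitary U \<and> V \<in> carrier_mat n n \<and> unitary V \<and>
           1 \<le> k \<and> k \<le> n div m \<and>
           (\<forall>j\<in>{1..k}. 0 \<le> p j) \<and> (\<Sum>j=1..k. p j) = (1::real) \<and>
           kron U V * W * mat_adjoint (kron U V) =
             mat (m*n) (m*n) (\<lambda>(r,c). \<Sum>j=1..k. complex_of_real (p j) *
                                         ptrans m n (proj (Phi m n j)) $$ (r,c)))"
  using DEWs_maximal_negativity[OF _ mn] negativity_conjugate_Phi[OF _ mn] by blast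

lemma two_largest_attained:
  assumes n: "2 \<le> n" and x: "\<And>i. 2 \<le> i \<Longrightarrow> x i = 0" "0 < x 0 * x 1"
    and D: "ptrans 2 n (proj (dvec 2 n 0 x)) \<in> DEWs 2 n"
  shows "(x 0)\<^sup>2 + x 0 * x 1 \<le> (\<Sum>i<2. eigvals (ptrans 2 n (proj (dvec 2 n 0 x))) ! i)"
    and "(x 0)\<^sup>2 + (x 1)\<^sup>2 + x 0 * x 1 \<le> (\<Sum>i<3. eigvals (ptrans 2 n (proj (dvec 2 n 0 x))) ! i)"
proof -
  define W where "W = ptrans 2 n (proj (dvec 2 n 0 x))"
  note Wb = DEWs_basic[OF D, folded W_def]
  define h where "h = complex_of_real (1 / sqrt 2)"
  have hh: "h * h = 1 / 2" "cnj h = h" unfolding h_def by (rule sqrt_half_sq) simp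
  have hr: "Re h * Re h = 1 / 2" "Im h = 0" by (auto simp: h_def)
  define w where "w y = h * (ket 1 y + ket n y)" for y
  \<comment> \<open>The three positive eigenvectors |00>, (|01> + |10>)/sqrt 2 and |11>, with
    eigenvalues \<open>(x 0)\<^sup>2\<close>, \<open>x 0 * x 1\<close> and
    \<open>(x 1)\<^sup>2\<close>.\<close>
  define v where "v i = (if i = 0 then ket 0 else if i = (1::nat) then w else ket (n+1))" for i
  have idx: "0 < 2*n" "1 < 2*n" "n < 2*n" "n + 1 < 2*n" using n by auto
  have w: "ip (2*n) w g = h * (g 1 + g n)" for g
    unfolding w_def ip_scale_left ip_add_left hh using idx by (simp add: ip_ket)
  have o: "ons (2*n) {..<3} v"
    unfolding ons_def
  proof (intro ballI)
    fix i j assume "i \<in> {..<3::nat}" "j \<in> {..<3::nat}"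
    hence "i \<in> {0,1,2}" "j \<in> {0,1,2}" by auto
    thus "ip (2*n) (v i) (v j) = (if i = j then 1 else 0)"
      using idx n hh by (auto simp: v_def w ip_ket) (auto simp: ket_def w_def algebra_simps)
  qed
  have q: "qf (2*n) W u = (x 0)\<^sup>2 * (cmod (u 0))\<^sup>2 + (x 1)\<^sup>2 * (cmod (u (n+1)))\<^sup>2
    + 2 * (x 0 * x 1) * Re (cnj (u 1) * u n)" for u
    unfolding W_def using n x(1) by (simp add: qf_ptrans_proj ptf_two del: One_nat_def)
  have qv: "qf (2*n) W (v 0) = (x 0)\<^sup>2" "qf (2*n) W (v 1) = x 0 * x 1" "qf (2*n) W (v 2) = (x 1)\<^sup>2"
    using n hr unfolding q by (auto simp: v_def ket_def w_def)
  have "(\<Sum>j<2. qf (2*n) W (v j)) \<le> (\<Sum>i<2. eigvals W ! i)"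
    by (rule ky_fan_upper[OF Wb(1,2)]) (use ons_subset[OF o, of "{..<2}"] n in auto)
  thus "(x 0)\<^sup>2 + x 0 * x 1 \<le> (\<Sum>i<2. eigvals (ptrans 2 n (proj (dvec 2 n 0 x))) ! i)"
    using qv by (simp add: W_def numeral_2_eq_2)
  have "(\<Sum>j<3. qf (2*n) W (v j)) \<le> (\<Sum>i<3. eigvals W ! i)"
    by (rule ky_fan_upper[OF Wb(1,2)]) (use o n in auto)
  moreover have "(\<Sum>j<3. qf (2*n) W (v j)) = qf (2*n) W (v 0) + qf (2*n) W (v 1) + qf (2*n) W (v 2)"
    by (simp add: eval_nat_numeral)
  ultimately show "(x 0)\<^sup>2 + (x 1)\<^sup>2 + x 0 * x 1 \<le> (\<Sum>i<3. eigvals (ptrans 2 n (proj (dvec 2 n 0 x))) ! i)"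
    using qv by (simp add: W_def)
qed

lemma sum_split_eigvals:
  fixes f :: "nat \<Rightarrow> real"
  assumes "k \<le> N" shows "(\<Sum>i<N. f i) = (\<Sum>i<k. f i) + (\<Sum>i=k..<N. f i)"
  using sum.atLeastLessThan_concat[of 0 k N f] assms by (simp add: lessThan_atLeast0)

lemma rational_bound: "1 - (1 + sqrt 2) / 2 = - 1 / (2 + 2 * sqrt 2)"
proof -
  have "(1 - (1 + sqrt 2) / 2) * (2 + 2 * sqrt 2) = - 1" by (simp add: field_simps)
  moreover have "2 + 2 * sqrt 2 \<noteq> 0" using real_sqrt_ge_zero[of 2] by linarith
  ultimately show ?thesis by (metis nonzero_eq_divide_eq)
qed

text \<open>As the trace is 1, the sum from the third eigenvalue on is 1 minus the two largest, so
  an upper bound for those is what is needed.\<close>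

lemma two_qubit_sum_from_third:
  assumes n: "2 \<le> n"
  defines "D \<equiv> DEWs 2 n"
  shows "is_inf ((\<lambda>W. \<Sum>i=3..2*n. eigvals W ! (i - 1)) ` D) (-1 / (2 + 2 * sqrt 2))" (is ?inf)
    and "\<exists>x1 x2::real. 0 < x1 \<and> 0 < x2 \<and> x1^2 + x2^2 = 1 \<and>
          x1^2 + x1 * x2 = 1 + 1 / (2 + 2 * sqrt 2) \<and>
          (let W = ptrans 2 n (proj (vec (2*n) (\<lambda>r. if r = 0 then complex_of_real x1
                                   else if r = n + 1 then complex_of_real x2 else 0)))
           in W \<in> D \<and> (\<Sum>i=3..2*n. eigvals W ! (i - 1)) = -1 / (2 + 2 * sqrt 2))" (is ?ex)
proof -
  have sum3: "(\<Sum>i=3..2*n. eigvals W ! (i - 1)) = 1 - (\<Sum>i<2. eigvals W ! i)" if "W \<in> D" for W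
    using sum_lam[of 3 "\<lambda>i. eigvals W ! i" "2*n"] sum_split_eigvals[of 2 "2*n" "\<lambda>i. eigvals W ! i"]
      DEWs_basic(6)[OF that[unfolded D_def]] n by simp
  have lower: "- 1 / (2 + 2 * sqrt 2) \<le> (\<Sum>i=3..2*n. eigvals W ! (i - 1))" if "W \<in> D" for W
    using DEWs_two_largest_le[OF that[unfolded D_def] n] unfolding sum3[OF that] rational_bound[symmetric]
    by (simp add: numeral_2_eq_2 field_simps)
  \<comment> \<open>The cosine and sine of pi/8, the maximiser met in
    \<open>ptf_upper_two\<close>.\<close>
  define x1 x2 where "x1 = sqrt ((2 + sqrt 2) / 4)" and "x2 = sqrt ((2 - sqrt 2) / 4)"
  have s2: "sqrt 2 < 2" using real_sqrt_less_iff[of 2 4] by simp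
  have s0: "0 < sqrt 2" by simp
  have p: "0 < x1" "0 < x2" using s2 s0 unfolding x1_def x2_def by (auto intro!: real_sqrt_gt_zero add_pos_pos simp del: real_sqrt_gt_0_iff)
  have sq: "x1\<^sup>2 = (2 + sqrt 2) / 4" "x2\<^sup>2 = (2 - sqrt 2) / 4"
    using s2 s0 unfolding x1_def x2_def by (auto simp: add_nonneg_nonneg)
  have "x1 * x2 = sqrt ((2 + sqrt 2) / 4 * ((2 - sqrt 2) / 4))" unfolding x1_def x2_def by (rule real_sqrt_mult[symmetric])
  also have "(2 + sqrt 2) / 4 * ((2 - sqrt 2) / 4) = 2 / 4\<^sup>2" by (simp add: algebra_simps power2_eq_square)
  also have "sqrt (2 / 4\<^sup>2) = sqrt 2 / 4" by (simp only: real_sqrt_divide real_sqrt_abs abs_numeral)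
  finally have x12: "x1 * x2 = sqrt 2 / 4" .
  have sum1: "x1\<^sup>2 + x2\<^sup>2 = 1" unfolding sq by (simp add: field_simps)
  have sum2: "x1\<^sup>2 + x1 * x2 = (1 + sqrt 2) / 2" unfolding sq x12 by (simp add: field_simps)
  define x where "x = (\<lambda>i::nat. if i = 0 then x1 else if i = 1 then x2 else 0)"
  have vec: "vec (2*n) (\<lambda>r. if r = 0 then complex_of_real x1 else if r = n + 1 then complex_of_real x2 else 0) = dvec 2 n 0 x"
  proof (rule eq_vecI)
    fix r assume "r < dim_vec (dvec 2 n 0 x)"
    hence r: "r < 2 * n" by (simp add: dvec_def)
    then obtain i j where ij: "i < 2" "j < n" "r = i * n + j" by (rule prod_indexE)
    have "i = 0 \<or> i = 1" using ij by auto
    thus "vec (2*n) (\<lambda>r. if r = 0 then complex_of_real x1 else if r = n + 1 then complex_of_real x2 else 0) $ r = dvec 2 n 0 x $ r"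
      using r ij n by (auto simp: dvec_index[of _ 2 _ n 0, simplified] x_def dvec_def)
  qed (simp add: dvec_def)
  have "unit_vec (2*n) (dvec 2 n 0 x)" using n sum1 by (intro unit_dvec) (auto simp: x_def numeral_2_eq_2)
  moreover have "ptf 2 n (($) (dvec 2 n 0 x)) (antisymv n 0 0 1) < 0"
    using ptf_dvec_antisymv[of 2 0 n 0 1 x] n p by (simp add: x_def)
  ultimately have WD: "ptrans 2 n (proj (dvec 2 n 0 x)) \<in> D" unfolding D_def by (rule ptrans_proj_DEWs)
  have "(x 0)\<^sup>2 + x 0 * x 1 \<le> (\<Sum>i<2. eigvals (ptrans 2 n (proj (dvec 2 n 0 x))) ! i)"
    by (rule two_largest_attained(1)[OF n _ _ WD[unfolded D_def]]) (use p in \<open>auto simp: x_def\<close>)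
  hence "(\<Sum>i=3..2*n. eigvals (ptrans 2 n (proj (dvec 2 n 0 x))) ! (i - 1)) \<le> - 1 / (2 + 2 * sqrt 2)"
    unfolding sum3[OF WD] rational_bound[symmetric] using sum2 by (simp add: x_def)
  hence eq: "(\<Sum>i=3..2*n. eigvals (ptrans 2 n (proj (dvec 2 n 0 x))) ! (i - 1)) = - 1 / (2 + 2 * sqrt 2)"
    using lower[OF WD] by simp
  show ?inf
    by (rule is_inf_image_attained[where f="\<lambda>W. \<Sum>i=3..2*n. eigvals W ! (i - 1)", OF WD eq lower])
  have "(1 + sqrt 2) / 2 = 1 - (1 - (1 + sqrt 2) / 2)" by simp
  also have "\<dots> = 1 + 1 / (2 + 2 * sqrt 2)" unfolding rational_bound by simp
  finally have "x1\<^sup>2 + x1 * x2 = 1 + 1 / (2 + 2 * sqrt 2)" unfolding sum2 .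
  thus ?ex using p sum1 WD eq unfolding vec[symmetric] by (intro exI[of _ x1] exI[of _ x2]) (auto simp: Let_def)
qed

text \<open>The lower bound -1/2 for \<open>m = 2\<close> holds for families of any size. It is
  attained because the spectrum of the example is 1/2 three times, -1/2 once and otherwise 0, which
  is inferred from sums instead of from explicit eigenvectors.\<close>

lemma two_qubit_sum_from_fourth:
  assumes n: "2 \<le> n" and k: "4 \<le> k" "k \<le> 2*n"
  defines "D \<equiv> DEWs 2 n"
  shows "is_inf ((\<lambda>W. \<Sum>i=k..2*n. eigvals W ! (i - 1)) ` D) (-1/2)" (is ?inf)
    and "\<exists>\<psi>. unit_vec (2*n) \<psi> \<and> nonzero_schmidt 2 n \<psi> = {#1 / sqrt 2, 1 / sqrt 2#} \<and>
               ptrans 2 n (proj \<psi>) \<in> D \<and>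
               (\<Sum>i=k..2*n. eigvals (ptrans 2 n (proj \<psi>)) ! (i - 1)) = -1/2" (is ?ex)
proof -
  have sumk: "(\<Sum>i=k..2*n. eigvals W ! (i - 1)) = (\<Sum>i=k-1..<2*n. eigvals W ! i)" for W
    using k by (intro sum_lam) simp
  have lower: "- 1 / 2 \<le> (\<Sum>i=k..2*n. eigvals W ! (i - 1))" if "W \<in> D" for W
  proof -
    have "- (1 / 2) \<le> (\<Sum>i=k-1..<2*n. eigvals W ! i)"
      by (rule DEWs_eigvals_lower[OF that[unfolded D_def]]) (auto intro: ptf_ge_two)
    thus ?thesis unfolding sumk by simp
  qed
  define x where "x = (\<lambda>i::nat. if i < 2 then 1 / sqrt 2 else 0)"
  define \<psi> where "\<psi> = dvec 2 n 0 x"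
  have x: "x 0 * x 1 = 1 / 2" "(x 0)\<^sup>2 = 1 / 2" "(x 1)\<^sup>2 = 1 / 2" by (auto simp: x_def power_divide)
  have sum1: "(\<Sum>i<2. (x i)\<^sup>2) = 1" by (simp add: numeral_2_eq_2) (simp add: x_def power_divide)
  have u: "unit_vec (2*n) \<psi>" unfolding \<psi>_def using n sum1 by (intro unit_dvec) auto
  define W where "W = ptrans 2 n (proj \<psi>)"
  have "ptf 2 n (($) \<psi>) (antisymv n 0 0 1) < 0"
    using ptf_dvec_antisymv[of 2 0 n 0 1 x] n x by (simp add: \<psi>_def)
  hence WD: "W \<in> DEWs 2 n" unfolding W_def by (rule ptrans_proj_DEWs[OF u])
  note Wb = DEWs_basic[OF WD]
  define d where "d i = eigvals W ! i" for i
  have ns: "nonzero_schmidt 2 n \<psi> = {#1 / sqrt 2, 1 / sqrt 2#}"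
    using nonzero_schmidt_dvec[of 2 2 n x] n by (simp add: \<psi>_def x_def numeral_2_eq_2)
  have last: "d (2*n-1) = - (1/2)"
  proof -
    have "\<exists>\<psi>. unit_vec (2*n) \<psi> \<and> nonzero_schmidt 2 n \<psi> = {#sqrt 2 / 2, sqrt 2 / 2#} \<and> W = ptrans 2 n (proj \<psi>)"
    proof -
      have "1 / sqrt 2 = sqrt 2 / 2" by (simp add: field_simps)
      thus ?thesis using u ns W_def by metis
    qed
    thus ?thesis using DEWs_last_eigval_eq[OF WD] by (simp add: d_def)
  qed
  have three: "3 / 2 \<le> (\<Sum>i<3. d i)"
    using two_largest_attained(2)[OF n, of x] WD x by (simp add: d_def W_def \<psi>_def x_def)
  have pur: "(\<Sum>i<2*n. (d i)\<^sup>2) = 1"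
    using purity_ptrans_proj[OF u] Wb(1) sum_sq_entries(2)[OF Wb(1,2)] unfolding W_def d_def by simp
  \<comment> \<open>Three eigenvalues of total at least 3/2 have squares of total at least 3/4. With
    the square 1/4 of the last one the purity 1 is used up, and the eigenvalues in between are
    0.\<close>
  have "0 \<le> (\<Sum>i<3. (d i - 1 / 2)\<^sup>2)" by (intro sum_nonneg) auto
  also have "\<dots> = (\<Sum>i<3. (d i)\<^sup>2) - (\<Sum>i<3. d i) + 3 / 4"
    by (simp add: power2_diff sum.distrib sum_subtractf power_divide)
  finally have "3 / 4 \<le> (\<Sum>i<3. (d i)\<^sup>2)" using three by simp
  moreover have "(\<Sum>i<2*n. (d i)\<^sup>2) = (\<Sum>i<3. (d i)\<^sup>2) + (\<Sum>i=3..<2*n-1. (d i)\<^sup>2) + (d (2*n-1))\<^sup>2"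
  proof -
    have "(\<Sum>i<2*n-1. (d i)\<^sup>2) = (\<Sum>i<3. (d i)\<^sup>2) + (\<Sum>i=3..<2*n-1. (d i)\<^sup>2)"
      using n by (intro sum_split_eigvals) auto
    thus ?thesis using sum_butlast[of "2*n" "\<lambda>i. (d i)\<^sup>2"] n by simp
  qed
  moreover have "(d (2*n-1))\<^sup>2 = 1 / 4" unfolding last by (simp add: power_divide)
  ultimately have le0: "(\<Sum>i=3..<2*n-1. (d i)\<^sup>2) \<le> 0" using pur by linarith
  hence "(\<Sum>i=3..<2*n-1. (d i)\<^sup>2) = 0" by (intro antisym sum_nonneg) auto
  hence mid: "d i = 0" if "3 \<le> i" "i < 2*n-1" for i using that by (simp add: sum_nonneg_eq_0_iff)
  have "(\<Sum>i=k-1..<2*n. d i) = (\<Sum>i\<in>{2*n-1}. d i)"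
  proof (rule sum.mono_neutral_right)
    show "\<forall>i\<in>{k-1..<2*n} - {2*n-1}. d i = 0"
    proof
      fix i assume "i \<in> {k-1..<2*n} - {2*n-1}"
      hence "3 \<le> i" "i < 2*n-1" using k by auto
      thus "d i = 0" by (rule mid)
    qed
  qed (use k n in auto)
  hence eq: "(\<Sum>i=k..2*n. eigvals W ! (i - 1)) = - 1 / 2" unfolding sumk using last by (simp add: d_def)
  show ?inf
    by (rule is_inf_image_attained[where f="\<lambda>W. \<Sum>i=k..2*n. eigvals W ! (i - 1)", OF WD[folded D_def]])
       (use eq lower in auto)
  show ?ex using u ns WD eq unfolding D_def W_def by blast
qed

lemma qubit_tail_sums:
  assumes mn: "2 \<le> m" "m \<le> n"
  shows "m = 2 \<longrightarrow>
      is_inf ((\<lambda>W. \<Sum>i=3..2*n. eigvals W ! (i - 1)) ` DEWs m n) (-1 / (2 + 2 * sqrt 2)) \<and>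
      (\<exists>x1 x2::real. 0 < x1 \<and> 0 < x2 \<and> x1^2 + x2^2 = 1 \<and>
          x1^2 + x1 * x2 = 1 + 1 / (2 + 2 * sqrt 2) \<and>
          (let W = ptrans m n (proj (vec (2*n) (\<lambda>r. if r = 0 then complex_of_real x1
                                   else if r = n + 1 then complex_of_real x2 else 0)))
           in W \<in> DEWs m n \<and> (\<Sum>i=3..2*n. eigvals W ! (i - 1)) = -1 / (2 + 2 * sqrt 2))) \<and>
      (\<forall>k. 4 \<le> k \<and> k \<le> 2*n \<longrightarrow>
          is_inf ((\<lambda>W. \<Sum>i=k..2*n. eigvals W ! (i - 1)) ` DEWs m n) (-1/2) \<and>
          (\<exists>\<psi>. unit_vec (m*n) \<psi> \<and>
               nonzero_schmidt m n \<psi> = {#1 / sqrt 2, 1 / sqrt 2#} \<and>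
               ptrans m n (proj \<psi>) \<in> DEWs m n \<and>
               (\<Sum>i=k..2*n. eigvals (ptrans m n (proj \<psi>)) ! (i - 1)) = -1/2))" (is "_ \<longrightarrow> ?thesis_two")
proof
  assume m: "m = 2"
  hence n: "2 \<le> n" using mn by simp
  show ?thesis_two
    unfolding m by (intro conjI allI impI two_qubit_sum_from_third two_qubit_sum_from_fourth n) auto
qed

lemma smallest_eigvals_sums:
  assumes mn: "3 \<le> m" "m \<le> n"
  defines "D \<equiv> DEWs m n" and "d \<equiv> (\<lambda>W i. eigvals W ! (i - 1))"
  shows "is_inf ((\<lambda>W. d W (m*n) + d W (m*n - 1)) ` D) (- sqrt 2 / 2) \<and>
      (\<exists>\<psi>. unit_vec (m*n) \<psi> \<and>
           nonzero_schmidt m n \<psi> = {#sqrt 2 / 2, 1/2, 1/2#} \<and>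
           ptrans m n (proj \<psi>) \<in> D \<and>
           d (ptrans m n (proj \<psi>)) (m*n) + d (ptrans m n (proj \<psi>)) (m*n - 1) = - sqrt 2 / 2) \<and>
      is_inf ((\<lambda>W. d W (m*n) + d W (m*n - 1) + d W (m*n - 2)) ` D) (-1) \<and>
      (\<exists>\<psi>. unit_vec (m*n) \<psi> \<and>
           nonzero_schmidt m n \<psi> = {#1 / sqrt 3, 1 / sqrt 3, 1 / sqrt 3#} \<and>
           ptrans m n (proj \<psi>) \<in> D \<and>
           d (ptrans m n (proj \<psi>)) (m*n) + d (ptrans m n (proj \<psi>)) (m*n - 1)
             + d (ptrans m n (proj \<psi>)) (m*n - 2) = -1)"
proof -
  define N where "N = m * n"
  have N: "9 \<le> N" using mult_le_mono[of 3 m 3 n] mn by (simp add: N_def)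
  have d2: "d W N + d W (N - 1) = (\<Sum>i=N-2..<N. eigvals W ! i)" for W
  proof -
    have "{N-2..<N} = {N-1, N-2}" using N by auto
    thus ?thesis using N by (simp add: d_def numeral_2_eq_2)
  qed
  have d3: "d W N + d W (N - 1) + d W (N - 2) = (\<Sum>i=N-3..<N. eigvals W ! i)" for W
  proof -
    have "{N-3..<N} = {N-1, N-2, N-3}" using N by auto
    moreover have "N - 1 \<noteq> N - 2" "N - 1 \<noteq> N - 3" "N - 2 \<noteq> N - 3" using N by auto
    moreover have "N - 1 - 1 = N - 2" "N - 2 - 1 = N - 3" by auto
    ultimately show ?thesis by (simp add: d_def add.assoc del: One_nat_def)
  qed
  have l2: "- sqrt 2 / 2 \<le> d W N + d W (N - 1)" if "W \<in> D" for W
  proof -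
    have "- (sqrt 2 / 2) \<le> (\<Sum>i\<in>{N-2..<N}. eigvals W ! i)"
      unfolding N_def using N by (intro DEWs_eigvals_lower[OF that[unfolded D_def]]) (auto intro!: ptf_ge2 mn simp: N_def)
    thus ?thesis unfolding d2 by simp
  qed
  have l3: "- 1 \<le> d W N + d W (N - 1) + d W (N - 2)" if "W \<in> D" for W
  proof -
    have "- 1 \<le> (\<Sum>i\<in>{N-3..<N}. eigvals W ! i)"
      unfolding N_def using N by (intro DEWs_eigvals_lower[OF that[unfolded D_def]]) (auto intro!: ptf_ge3[simplified] mn simp: N_def)
    thus ?thesis unfolding d3 .
  qed
  have ex: "unit_vec N (dvec m n 0 x) \<and> ptrans m n (proj (dvec m n 0 x)) \<in> D \<and>
      nonzero_schmidt m n (dvec m n 0 x) = {#x 0, x 1, x 2#} \<and>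
      d (ptrans m n (proj (dvec m n 0 x))) N + d (ptrans m n (proj (dvec m n 0 x))) (N - 1) \<le> - (x 0 * x 1 + x 0 * x 2) \<and>
      d (ptrans m n (proj (dvec m n 0 x))) N + d (ptrans m n (proj (dvec m n 0 x))) (N - 1) + d (ptrans m n (proj (dvec m n 0 x))) (N - 2)
        \<le> - (x 0 * x 1 + x 0 * x 2 + x 1 * x 2)"
    if x: "\<And>i. i < 3 \<Longrightarrow> 0 < x i" "\<And>i. 3 \<le> i \<Longrightarrow> x i = 0" and s: "(x 0)\<^sup>2 + (x 1)\<^sup>2 + (x 2)\<^sup>2 = 1" for x
  proof -
    have "(\<Sum>i<m. (x i)\<^sup>2) = (\<Sum>i<3. (x i)\<^sup>2)" using mn x by (intro sum.mono_neutral_right) auto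
    hence s1: "(\<Sum>i<m. (x i)\<^sup>2) = 1" using s by (simp add: eval_nat_numeral)
    have u: "unit_vec N (dvec m n 0 x)" unfolding N_def using mn s1 by (intro unit_dvec) auto
    have "ptf m n (($) (dvec m n 0 x)) (antisymv n 0 0 1) < 0"
      using ptf_dvec_antisymv[of m 0 n 0 1 x] mn x(1)[of 0] x(1)[of 1] by simp
    hence WD: "ptrans m n (proj (dvec m n 0 x)) \<in> DEWs m n" by (rule ptrans_proj_DEWs[OF u[unfolded N_def]])
    have "nonzero_schmidt m n (dvec m n 0 x) = mset (map x [0..<3])"
      by (rule nonzero_schmidt_dvec[OF mn x])
    hence ns: "nonzero_schmidt m n (dvec m n 0 x) = {#x 0, x 1, x 2#}" by (simp add: upt_conv_Cons numeral_2_eq_2)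
    have "(\<Sum>i=m*n-2..<m*n. eigvals (ptrans m n (proj (dvec m n 0 x))) ! i) \<le> - (\<Sum>(p,q)\<in>{(0,1),(0,2)}. x p * x q)"
      by (rule trial_lower[OF mn(2) s1 _ _ WD]) (use mn N in \<open>auto simp: N_def\<close>)
    moreover have "(\<Sum>i=m*n-3..<m*n. eigvals (ptrans m n (proj (dvec m n 0 x))) ! i) \<le> - (\<Sum>(p,q)\<in>{(0,1),(0,2),(1,2)}. x p * x q)"
      by (rule trial_lower[OF mn(2) s1 _ _ WD]) (use mn N in \<open>auto simp: N_def\<close>)
    ultimately show ?thesis using u WD ns unfolding d3 unfolding d2 D_def by (simp add: N_def)
  qed
  \<comment> \<open>The point where both squares in \<open>ptf_ge2\<close> vanish; the equal
    coefficients \<open>y\<close> below likewise give equality in the three products of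
    \<open>ptf_ge3\<close>.\<close>
  define x where "x = (\<lambda>i::nat. if i = 0 then sqrt 2 / 2 else if i < 3 then 1 / 2 else 0)"
  have x: "\<And>i. i < 3 \<Longrightarrow> 0 < x i" "\<And>i. 3 \<le> i \<Longrightarrow> x i = 0" "(x 0)\<^sup>2 + (x 1)\<^sup>2 + (x 2)\<^sup>2 = 1"
    "x 0 * x 1 + x 0 * x 2 = sqrt 2 / 2" by (auto simp: x_def power_divide)
  define y where "y = (\<lambda>i::nat. if i < 3 then 1 / sqrt 3 else 0)"
  have y: "\<And>i. i < 3 \<Longrightarrow> 0 < y i" "\<And>i. 3 \<le> i \<Longrightarrow> y i = 0" "(y 0)\<^sup>2 + (y 1)\<^sup>2 + (y 2)\<^sup>2 = 1"
    "y 0 * y 1 + y 0 * y 2 + y 1 * y 2 = 1" by (auto simp: y_def power_divide)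
  define X where "X = dvec m n 0 x"
  define Y where "Y = dvec m n 0 y"
  have X: "unit_vec N X" "ptrans m n (proj X) \<in> D" "nonzero_schmidt m n X = {#sqrt 2 / 2, 1/2, 1/2#}"
    "d (ptrans m n (proj X)) N + d (ptrans m n (proj X)) (N - 1) = - sqrt 2 / 2"
    using ex[OF x(1-3)] x(4) l2[of "ptrans m n (proj X)"] unfolding X_def[symmetric] by (auto simp: x_def)
  have Y: "unit_vec N Y" "ptrans m n (proj Y) \<in> D" "nonzero_schmidt m n Y = {#1 / sqrt 3, 1 / sqrt 3, 1 / sqrt 3#}"
    "d (ptrans m n (proj Y)) N + d (ptrans m n (proj Y)) (N - 1) + d (ptrans m n (proj Y)) (N - 2) = - 1"
    using ex[OF y(1-3)] y(4) l3[of "ptrans m n (proj Y)"] unfolding Y_def[symmetric] by (auto simp: y_def)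
  have "is_inf ((\<lambda>W. d W N + d W (N - 1)) ` D) (- sqrt 2 / 2)"
    by (rule is_inf_image_attained[where f="\<lambda>W. d W N + d W (N - 1)", OF X(2,4) l2])
  moreover have "is_inf ((\<lambda>W. d W N + d W (N - 1) + d W (N - 2)) ` D) (- 1)"
    by (rule is_inf_image_attained[where f="\<lambda>W. d W N + d W (N - 1) + d W (N - 2)", OF Y(2,4) l3])
  ultimately show ?thesis using X Y unfolding N_def by blast
qed

theorem theorem1:
  fixes m n :: nat
  assumes "2 \<le> m" and "m \<le> n"
  defines "D \<equiv> DEWs m n"
  defines "lam \<equiv> (\<lambda>W i. eigvals W ! (i - 1))"
  defines "purity \<equiv> (\<lambda>W. Re (trace (W * W)))"
  shows
  \<comment> \<open>(i)\<close>
  "((\<forall>x. 1 / (real (m*n) - 1) < x \<and> x \<le> 1 \<longrightarrow> (\<exists>W\<in>D. purity W = x)) \<and>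
    is_inf (purity ` D) (1 / (real (m*n) - 1)) \<and> 1 / (real (m*n) - 1) \<notin> purity ` D \<and>
    is_sup (purity ` D) 1 \<and> 1 \<in> purity ` D)
  \<comment> \<open>(ii)\<close>
  \<and> (\<forall>W\<in>D. purity W = 1 \<longleftrightarrow>
        (\<exists>\<psi>. unit_vec (m*n) \<psi> \<and> entangled m n \<psi> \<and> W = ptrans m n (proj \<psi>)))
  \<comment> \<open>(iii)\<close>
  \<and> ((\<forall>x. -1/2 \<le> x \<and> x < 0 \<longrightarrow> (\<exists>W\<in>D. lam W (m*n) = x)) \<and>
     is_inf ((\<lambda>W. lam W (m*n)) ` D) (-1/2) \<and> -1/2 \<in> (\<lambda>W. lam W (m*n)) ` D \<and>
     is_sup ((\<lambda>W. lam W (m*n)) ` D) 0 \<and> 0 \<notin> (\<lambda>W. lam W (m*n)) ` D)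
  \<comment> \<open>(iv)\<close>
  \<and> (\<forall>W\<in>D. lam W (m*n) = -1/2 \<longleftrightarrow>
        (\<exists>\<psi>. unit_vec (m*n) \<psi> \<and> nonzero_schmidt m n \<psi> = {#sqrt 2 / 2, sqrt 2 / 2#} \<and>
             W = ptrans m n (proj \<psi>)))
  \<comment> \<open>(v)\<close>
  \<and> ((\<forall>x. 1 / (real (m*n) - 1) < x \<and> x < 1 \<longrightarrow> (\<exists>W\<in>D. lam W 1 = x)) \<and>
     is_inf ((\<lambda>W. lam W 1) ` D) (1 / (real (m*n) - 1)) \<and>
     1 / (real (m*n) - 1) \<notin> (\<lambda>W. lam W 1) ` D \<and>
     is_sup ((\<lambda>W. lam W 1) ` D) 1 \<and> 1 \<notin> (\<lambda>W. lam W 1) ` D)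
  \<comment> \<open>(vi)\<close>
  \<and> ((\<forall>W\<in>D. 0 < negativity W \<and> negativity W \<le> (real m - 1) / 2) \<and>
     (\<forall>x. 0 < x \<and> x \<le> (real m - 1) / 2 \<longrightarrow> (\<exists>W\<in>D. negativity W = x)) \<and>
     is_sup (negativity ` D) ((real m - 1) / 2) \<and> (real m - 1) / 2 \<in> negativity ` D \<and>
     is_inf (negativity ` D) 0 \<and> 0 \<notin> negativity ` D)
  \<comment> \<open>(vii)\<close>
  \<and> (\<forall>W\<in>D. negativity W = (real m - 1) / 2 \<longleftrightarrow>
        (\<exists>U V k p. U \<in> carrier_mat m m \<and> unitary U \<and> V \<in> carrier_mat n n \<and> unitary V \<and>
           1 \<le> k \<and> k \<le> n div m \<and>
           (\<forall>j\<in>{1..k}. 0 \<le> p j) \<and> (\<Sum>j=1..k. p j) = (1::real) \<and>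
           kron U V * W * mat_adjoint (kron U V) =
             mat (m*n) (m*n) (\<lambda>(r,c). \<Sum>j=1..k. complex_of_real (p j) *
                                         ptrans m n (proj (Phi m n j)) $$ (r,c))))
  \<comment> \<open>(viii)\<close>
  \<and> (m = 2 \<longrightarrow>
      is_inf ((\<lambda>W. \<Sum>i=3..2*n. lam W i) ` D) (-1 / (2 + 2 * sqrt 2)) \<and>
      (\<exists>x1 x2::real. 0 < x1 \<and> 0 < x2 \<and> x1^2 + x2^2 = 1 \<and>
          x1^2 + x1 * x2 = 1 + 1 / (2 + 2 * sqrt 2) \<and>
          (let W = ptrans m n (proj (vec (2*n) (\<lambda>r. if r = 0 then complex_of_real x1
                                   else if r = n + 1 then complex_of_real x2 else 0)))
           in W \<in> D \<and> (\<Sum>i=3..2*n. lam W i) = -1 / (2 + 2 * sqrt 2))) \<and>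
      (\<forall>k. 4 \<le> k \<and> k \<le> 2*n \<longrightarrow>
          is_inf ((\<lambda>W. \<Sum>i=k..2*n. lam W i) ` D) (-1/2) \<and>
          (\<exists>\<psi>. unit_vec (m*n) \<psi> \<and>
               nonzero_schmidt m n \<psi> = {#1 / sqrt 2, 1 / sqrt 2#} \<and>
               ptrans m n (proj \<psi>) \<in> D \<and>
               (\<Sum>i=k..2*n. lam (ptrans m n (proj \<psi>)) i) = -1/2)))
  \<comment> \<open>(ix)\<close>
  \<and> (3 \<le> m \<longrightarrow>
      is_inf ((\<lambda>W. lam W (m*n) + lam W (m*n - 1)) ` D) (- sqrt 2 / 2) \<and>
      (\<exists>\<psi>. unit_vec (m*n) \<psi> \<and>
           nonzero_schmidt m n \<psi> = {#sqrt 2 / 2, 1/2, 1/2#} \<and>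
           ptrans m n (proj \<psi>) \<in> D \<and>
           lam (ptrans m n (proj \<psi>)) (m*n) + lam (ptrans m n (proj \<psi>)) (m*n - 1) = - sqrt 2 / 2) \<and>
      is_inf ((\<lambda>W. lam W (m*n) + lam W (m*n - 1) + lam W (m*n - 2)) ` D) (-1) \<and>
      (\<exists>\<psi>. unit_vec (m*n) \<psi> \<and>
           nonzero_schmidt m n \<psi> = {#1 / sqrt 3, 1 / sqrt 3, 1 / sqrt 3#} \<and>
           ptrans m n (proj \<psi>) \<in> D \<and>
           lam (ptrans m n (proj \<psi>)) (m*n) + lam (ptrans m n (proj \<psi>)) (m*n - 1)
             + lam (ptrans m n (proj \<psi>)) (m*n - 2) = -1))"
  \<comment> \<open>\<open>diff_self_eq_0\<close> reduces the list index \<open>1 - 1\<close> coming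
    from \<open>lam W 1\<close> to 0.\<close>
  unfolding D_def lam_def purity_def diff_self_eq_0
  by (rule conjI[OF purity_range[OF assms(1,2)] conjI[OF purity_eq_one_iff conjI[OF last_eigval_range[OF assms(1,2)]
        conjI[OF last_eigval_minimal_iff[OF assms(1)] conjI[OF first_eigval_range[OF assms(1,2)] conjI[OF negativity_range[OF assms(1,2)]
        conjI[OF negativity_maximal_iff[OF assms(1,2)] conjI[OF qubit_tail_sums[OF assms(1,2)]]]]]]]]])
    (rule impI, erule smallest_eigvals_sums[OF _ assms(2)])

end
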